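(* Fix an integer $k\ge 2$ and let $p^k(n)$ denote the number of partitions of $n$ into perfect $k$-th powers. Let $n$ be a sufficiently large natural number, and choose positive numbers $X$ and $Y$ satisfying \[ n = X\left( \frac{1}{k^2}\, \zeta\!\left(\tfrac{k+1}{k}\right)\Gamma\!\left(\tfrac{1}{k}\right)X^{1/k} - \frac{1}{2}-\frac{1}{2}\zeta(-k)X^{-1}\right), \qquad Y = \frac{k+1}{2k^3}\, \zeta\!\left(\tfrac{k+1}{k}\right)\Gamma\!\left(\tfrac{1}{k}\right)X^{1/k} - \frac{1}{4}. \] Then, for each $J\in\mathbb{N}$, there are real numbers $c_1, c_2, \ldots, c_{J}$ (independent of $n$) such that \[ p^k(n) = \frac{\exp\left(\frac{k+1}{k^2}\zeta(\frac{k+1}{k})\Gamma(\frac{1}{k})X^{\frac{1}{k}} - \frac{1}{2}\right)}{(2\pi)^{\frac{k+2}{2}}X^{\frac{3}{2}}Y^{\frac{1}{2}}} \left( \pi^{\frac{1}{2}} + \sum_{j=1}^{J} c_jY^{-j} + O(Y^{-J-1})\right). \]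
   Context: A partition of $n$ is a non-increasing sequence of positive integers summing to $n$; $p^k(n)$ counts those partitions all of whose parts are perfect $k$-th powers, so $\sum_{n\ge0}p^k(n)z^n=\prod_{m\ge1}(1-z^{m^k})^{-1}$. Here $\zeta$ is the Riemann zeta function and $\Gamma$ the Gamma function. The implied constant in the $O$-term may depend on $k$ and $J$. *)

theory Defs
  imports "HOL-Complex_Analysis.Complex_Analysis"
begin

definition is_partition :: "nat \<Rightarrow> nat list \<Rightarrow> bool" where
  "is_partition n xs \<longleftrightarrow> sorted_wrt (\<ge>) xs \<and> (\<forall>x\<in>set xs. x > 0) \<and> sum_list xs = n"

definition power_partitions :: "nat \<Rightarrow> nat \<Rightarrow> nat list set" where
  "power_partitions k n = {xs. is_partition n xs \<and> (\<forall>x\<in>set xs. \<exists>m. x = m ^ k)}"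

definition power_partition_count :: "nat \<Rightarrow> nat \<Rightarrow> nat" where
  "power_partition_count k n = card (power_partitions k n)"

lemma finite_power_partitions: "finite (power_partitions k n)"
proof (rule finite_subset)
  show "power_partitions k n \<subseteq> {xs. set xs \<subseteq> {..n} \<and> length xs \<le> n}"
  proof
    fix xs assume "xs \<in> power_partitions k n"
    then have pos: "\<forall>x\<in>set xs. x > 0" and s: "sum_list xs = n"
      by (auto simp: power_partitions_def is_partition_def)
    have "length xs \<le> sum_list xs"
      using pos by (induction xs) auto
    then show "xs \<in> {xs. set xs \<subseteq> {..n} \<and> length xs \<le> n}"
      using member_le_sum_list s by auto
  qed
  show "finite {xs. set xs \<subseteq> {..n} \<and> length xs \<le> n}"
    by (rule finite_lists_length_le) simp
qed

definition is_zeta :: "(complex \<Rightarrow> complex) \<Rightarrow> bool" where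
  "is_zeta f \<longleftrightarrow> f holomorphic_on - {1} \<and>
     (\<forall>s. Re s > 1 \<longrightarrow> (\<lambda>n. 1 / of_nat (Suc n) powr s) sums f s)"

lemma is_zeta_unique:
  assumes f: "is_zeta f" and g: "is_zeta g" and s: "s \<noteq> 1"
  shows "f s = g s"
proof -
  show ?thesis
  proof (rule analytic_continuation_open[where s = "{s. Re s > 1}" and s' = "- {1}" and f = f and g = g])
    show "open {s. Re s > 1}" by (rule open_halfspace_Re_gt)
    show "{s. Re s > 1} \<noteq> {}" by (auto intro!: exI[of _ "2::complex"])
    show "open (- {1 :: complex})" by (intro open_Compl closed_singleton)
    show "connected (- {1 :: complex})" by (rule connected_punctured_universe) simp
    show "{s. Re s > 1} \<subseteq> - {1}" by auto
    show "f holomorphic_on - {1}" "g holomorphic_on - {1}"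
      using f g by (auto simp: is_zeta_def)
    show "f z = g z" if "z \<in> {s. Re s > 1}" for z
      using f g that sums_unique2 by (fastforce simp: is_zeta_def)
    show "s \<in> - {1}" using s by simp
  qed
qed

(* The Riemann zeta function, i.e. the analytic continuation of the Dirichlet series.
   It is determined away from s = 1; its value at the pole is unspecified. *)
definition zeta :: "complex \<Rightarrow> complex" where
  "zeta = (SOME f. is_zeta f)"

(* zeta is real-valued on the real axis apart from the pole. *)
definition zeta_real :: "real \<Rightarrow> real" where
  "zeta_real x = Re (zeta (of_real x))"

(* The pair of equations that ties the parameters X and Y to n. *)
definition saddle_params :: "nat \<Rightarrow> nat \<Rightarrow> real \<Rightarrow> real \<Rightarrow> bool" where
  "saddle_params k n X Y \<longleftrightarrow> X > 0 \<and> Y > 0 \<and>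
     real n = X * (1 / real k ^ 2 * zeta_real ((real k + 1) / real k) * Gamma (1 / real k)
                     * X powr (1 / real k) - 1 / 2 - 1 / 2 * zeta_real (- real k) * X powi (-1)) \<and>
     Y = (real k + 1) / (2 * real k ^ 3) * zeta_real ((real k + 1) / real k) * Gamma (1 / real k)
           * X powr (1 / real k) - 1 / 4"

end

theory Submission
  imports Defs "HOL-Probability.Distributions" "HOL-Real_Asymp.Real_Asymp"
begin

text \<open>
  The circle method with a saddle point. Write \<open>F \<tau>\<close> for the value of the generating function at \<open>exp (- \<tau>)\<close>, so that
  \<open>p\<^sup>k(n)\<close> is the mean of \<open>F \<tau> exp (n \<tau>)\<close> over the segment \<open>Re \<tau> = 1 / X, |Im \<tau>| \<le> \<pi>\<close>.

  Major arc. With \<open>t\<^sup>k = \<tau>\<close>, \<open>log (F \<tau>)\<close> is the sum of \<open>- log (1 - exp (- (m t)\<^sup>k))\<close> over \<open>m \<ge> 1\<close>. Subtracting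
  \<open>(k / 2) log (1 + (m t)\<^sup>-\<^sup>2)\<close>, whose sum is known from the product formula of the sine, removes the logarithmic
  singularity at \<open>0\<close>, and Euler--Maclaurin summation applies. Only one boundary term survives, because the odd Taylor
  coefficients of the summand vanish except the one of order \<open>k\<close> (for odd \<open>k\<close>). So \<open>log (F \<tau>)\<close> equals
  \<open>A \<tau>\<^sup>-\<^sup>1\<^sup>/\<^sup>k + (log \<tau>) / 2 - (k / 2) log (2 \<pi>) + \<zeta>(-k) \<tau> / 2\<close> up to an error smaller than every power of \<open>\<tau>\<close>, in a sector.

  Minor arcs. If \<open>(r 2\<^sup>i)\<^sup>k \<theta>\<close> stays close to the integers as long as \<open>(r 2\<^sup>i)\<^sup>k \<le> X\<close>, then \<open>\<theta>\<close> is within \<open>O(1 / X)\<close> of a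
  fraction with denominator \<open>r\<^sup>k\<close>. Two consecutive odd \<open>r\<close> are coprime, so this cannot happen for both of them unless \<open>\<theta>\<close> is
  close to an integer. As the chains \<open>r 2\<^sup>i\<close> are disjoint for distinct odd \<open>r\<close>, there are many \<open>m\<close> for which
  \<open>m\<^sup>k \<theta>\<close> is far from the integers, and each of them makes \<open>F \<tau>\<close> smaller by a constant factor.

  For \<open>\<tau> = (1 + \<i> u) / X\<close> the saddle point equations turn the exponent into \<open>Y G(\<i> u)\<close> plus terms independent of \<open>X\<close> and \<open>Y\<close>,
  where \<open>G(z) = z\<^sup>2 + O(z\<^sup>3)\<close>, and Laplace's method gives the expansion in powers of \<open>1 / Y\<close>.
\<close>


text \<open>The subtracted term is chosen for three reasons: at 0, (k/2) log(1 + z^-2) has the same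
  singularity -k log z as - log(1 - exp(-z^k)); what remains of it there is even, so odd Taylor
  coefficients are untouched; and it decays like z^-2, enough for convergence along the whole
  sector. Euler--Maclaurin summation leaves its constant, an integral, unevaluated; it is found
  afterwards by squeezing t log F(t^k) for real t tending to 0. The value zeta(-k) enters because it
  and the surviving boundary term are multiples of the same Bernoulli number, which is read off by
  continuing zeta through Euler--Maclaurin summation as well. An error below every power of tau is
  essential: Y grows only like X^(1/k), a fixed power of 1/X is a fixed power of 1/Y, and J is
  arbitrary. The shift 1/4 makes Y the exact coefficient of z^2 in the full exponent: (log(1 + z) -
  z)/2, which stems from (log tau)/2 and from the -1/2 in the equation for n, has quadratic part
  -z^2/4, and G/4 cancels it.\<close>

section \<open>Bernoulli coefficients and the Euler--Maclaurin step\<close>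

text \<open>In the usual notation this is \<open>B\<^sub>n / n!\<close>, with \<open>B\<^sub>1 = - 1 / 2\<close>.\<close>

definition bern_coeff :: "nat \<Rightarrow> real" where
  "bern_coeff n = fps_nth (inverse (Abs_fps (\<lambda>n. 1 / fact (Suc n)))) n"

lemma bern_coeff_0 [simp]: "bern_coeff 0 = 1"
  by (simp add: bern_coeff_def)

text \<open>Coefficient comparison in the product of (e^x - 1)/x with its inverse.\<close>

lemma bern_coeff_conv:
  "(\<Sum>j\<le>n. bern_coeff j / fact (Suc (n - j))) = (if n = 0 then 1 else 0)"
proof -
  let ?f = "Abs_fps (\<lambda>n. 1 / fact (Suc n)) :: real fps"
  have "inverse ?f * ?f = 1"
    by (rule inverse_mult_eq_1) simp
  then have "fps_nth (inverse ?f * ?f) n = fps_nth 1 n"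
    by simp
  then show ?thesis
    by (simp add: fps_mult_nth bern_coeff_def atLeast0AtMost del: fact_Suc)
qed

text \<open>The series b(x) = x/(e^x - 1) satisfies b(-x) = e^x b(x), hence b(-x) - b(x) = (e^x - 1)
  b(x) = x.\<close>

lemma bern_coeff_parity: "(- 1) ^ n * bern_coeff n - bern_coeff n = (if n = 1 then 1 else 0)"
proof -
  define f where "f = (Abs_fps (\<lambda>n. 1 / fact (Suc n)) :: real fps)"
  define f' where "f' = (Abs_fps (\<lambda>n. (- 1) ^ n * fps_nth f n) :: real fps)"
  define b where "b = (Abs_fps bern_coeff)"
  define b' where "b' = (Abs_fps (\<lambda>n. (- 1) ^ n * bern_coeff n))"
  have b: "b = inverse f"
    by (rule fps_ext) (simp add: b_def f_def bern_coeff_def)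
  have bf: "b * f = 1"
    unfolding b by (rule inverse_mult_eq_1) (simp add: f_def)
  have bf': "b' * f' = 1"
  proof (rule fps_ext)
    fix n
    have "fps_nth (b' * f') n = (\<Sum>i=0..n. (- 1) ^ i * (- 1) ^ (n - i) * (bern_coeff i * fps_nth f (n - i)))"
      by (simp add: fps_mult_nth b'_def f'_def mult_ac)
    also have "\<dots> = (\<Sum>i=0..n. (- 1) ^ n * (bern_coeff i * fps_nth f (n - i)))"
      by (intro sum.cong refl) (simp flip: power_add)
    also have "\<dots> = (- 1) ^ n * fps_nth (b * f) n"
      by (simp add: fps_mult_nth b_def sum_distrib_left)
    also have "\<dots> = fps_nth 1 n"
      by (simp add: bf)
    finally show "fps_nth (b' * f') n = fps_nth 1 n" .
  qed
  have Xf: "fps_X * f = fps_exp 1 - 1"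
    by (rule fps_ext) (auto simp: f_def gr0_conv_Suc simp del: fact_Suc)
  have Xf': "fps_X * f' = 1 - fps_exp (- 1)"
    by (rule fps_ext) (auto simp: f_def f'_def gr0_conv_Suc field_simps simp del: fact_Suc)
  have e: "fps_exp 1 * fps_exp (- 1) = (1 :: real fps)"
    using fps_exp_add_mult [of 1 "- 1 :: real", symmetric] by simp
  have "fps_X * (f' * fps_exp 1) = (1 - fps_exp (- 1)) * fps_exp 1"
    by (simp flip: Xf' add: mult_ac)
  also have "\<dots> = fps_X * f"
    by (simp add: Xf e algebra_simps)
  finally have ff': "f' * fps_exp 1 = f"
    using fps_X_neq_zero mult_cancel_left by blast
  have "b' = b' * (f * b)"
    using bf by (simp add: mult.commute)
  also have "\<dots> = (b' * f') * fps_exp 1 * b"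
    by (subst ff' [symmetric]) (simp only: mult_ac)
  also have "\<dots> = fps_exp 1 * b"
    by (simp add: bf')
  finally have "b' - b = (fps_X * f) * b"
    by (simp add: Xf algebra_simps)
  also have "\<dots> = fps_X"
    using bf by (simp add: mult_ac)
  finally have "fps_nth (b' - b) n = fps_nth fps_X n"
    by simp
  then show ?thesis
    by (simp add: b_def b'_def fps_X_def)
qed

lemma bern_coeff_odd: "odd n \<Longrightarrow> n \<noteq> 1 \<Longrightarrow> bern_coeff n = 0"
  using bern_coeff_parity [of n] by simp

text \<open>The truncation of D/(e^D - 1), with D = t d/dz, applied to \<open>\<psi> 0\<close>; here
  \<open>\<psi> j\<close> stands for the derivative of order j. Its increment over a step t
  approximates \<open>t * \<psi> 1 z\<close>, so sums of \<open>\<psi> 1\<close> telescope.\<close>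

definition em_sum :: "nat \<Rightarrow> (nat \<Rightarrow> complex \<Rightarrow> complex) \<Rightarrow> complex \<Rightarrow> complex \<Rightarrow> complex" where
  "em_sum N \<psi> t z = (\<Sum>j\<le>N. of_real (bern_coeff j) * t ^ j * \<psi> j z)"

lemma sum_diag_reindex:
  fixes f :: "nat \<Rightarrow> nat \<Rightarrow> 'a::comm_monoid_add"
  shows "(\<Sum>j\<le>N. \<Sum>i\<le>N-j. f j i) = (\<Sum>n\<le>N. \<Sum>j\<le>n. f j (n - j))"
proof -
  have "(\<Sum>j\<le>N. \<Sum>i\<le>N-j. f j i) = (\<Sum>(j,i)\<in>(SIGMA j:{..N}. {..N-j}). f j i)"
    by (subst sum.Sigma) auto
  also have "\<dots> = (\<Sum>(n,j)\<in>(SIGMA n:{..N}. {..n}). f j (n - j))"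
    by (rule sum.reindex_bij_witness[of _ "\<lambda>(n,j). (j, n-j)" "\<lambda>(j,i). (j+i, j)"]) auto
  also have "\<dots> = (\<Sum>n\<le>N. \<Sum>j\<le>n. f j (n - j))"
    by (subst sum.Sigma) auto
  finally show ?thesis .
qed

text \<open>The operator identity \<open>(e\<^sup>D - 1) (D / (e\<^sup>D - 1)) = D\<close>, truncated at order \<open>N\<close>: the coefficients
  of all derivatives of order between 2 and \<open>N\<close> cancel, and Taylor's theorem bounds the rest.\<close>

lemma em_step:
  fixes \<psi> :: "nat \<Rightarrow> complex \<Rightarrow> complex"
  assumes N: "N \<ge> 1"
    and der: "\<And>i x. x \<in> closed_segment z (z + t) \<Longrightarrow> i \<le> N \<Longrightarrow> (\<psi> i has_field_derivative \<psi> (Suc i) x) (at x)"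
    and B: "\<And>x. x \<in> closed_segment z (z + t) \<Longrightarrow> norm (\<psi> (Suc N) x) \<le> B"
  shows "norm (em_sum N \<psi> t (z + t) - em_sum N \<psi> t z - t * \<psi> 1 z)
           \<le> (\<Sum>j\<le>N. \<bar>bern_coeff j\<bar>) * B * norm t ^ Suc N"
proof -
  \<comment> \<open>Taylor remainder of \<open>\<psi> j\<close> at order N - j: multiplied by t^j it
    has order t^(N+1) for every j.\<close>
  define R where "R j = \<psi> j (z + t) - (\<Sum>i\<le>N-j. \<psi> (j + i) z * t ^ i / fact i)" for j
  have B0: "B \<ge> 0"
    using order_trans [OF norm_ge_zero B [of z]] by simp
  have R: "norm (R j) \<le> B * norm t ^ Suc (N - j)" if "j \<le> N" for j
  proof -
    have "norm (R j) \<le> B * norm t ^ Suc (N - j) / fact (N - j)"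
      using field_Taylor [of "closed_segment z (z + t)" "N - j" "\<lambda>i. \<psi> (j + i)" B z "z + t"] that B
        has_field_derivative_at_within [OF der]
      unfolding R_def by simp
    also have "\<dots> \<le> B * norm t ^ Suc (N - j) / 1"
      using B0 by (intro divide_left_mono) auto
    finally show ?thesis by simp
  qed
  have "em_sum N \<psi> t (z + t) =
      (\<Sum>j\<le>N. of_real (bern_coeff j) * t ^ j * (\<Sum>i\<le>N-j. \<psi> (j + i) z * t ^ i / fact i))
      + (\<Sum>j\<le>N. of_real (bern_coeff j) * t ^ j * R j)"
    by (simp add: em_sum_def R_def algebra_simps flip: sum.distrib)
  also have "(\<Sum>j\<le>N. of_real (bern_coeff j) * t ^ j * (\<Sum>i\<le>N-j. \<psi> (j + i) z * t ^ i / fact i))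
     = (\<Sum>j\<le>N. \<Sum>i\<le>N-j. of_real (bern_coeff j) / fact i * (t ^ (j + i) * \<psi> (j + i) z))"
    by (simp add: sum_distrib_left power_add mult_ac)
  also have "\<dots> = (\<Sum>n\<le>N. (\<Sum>j\<le>n. of_real (bern_coeff j) / fact (n - j)) * (t ^ n * \<psi> n z))"
    by (subst sum_diag_reindex) (simp add: sum_distrib_right)
  also have "\<dots> = (\<Sum>n\<le>N. of_real (bern_coeff n) * t ^ n * \<psi> n z + (if n = 1 then t * \<psi> 1 z else 0))"
  proof (rule sum.cong)
    fix n assume "n \<in> {..N}"
    \<comment> \<open>With n = m + 1 and the term j = n split off, the rest is the convolution at m,
      which is nonzero only for m = 0. This yields the single surviving term
      \<open>t * \<psi> 1 z\<close>.\<close>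
    have "(\<Sum>j\<le>n. bern_coeff j / fact (n - j)) = bern_coeff n + (if n = 1 then 1 else 0)"
    proof (cases n)
      case (Suc m)
      have "(\<Sum>j\<le>n. bern_coeff j / fact (n - j)) = (\<Sum>j\<le>m. bern_coeff j / fact (Suc (m - j))) + bern_coeff n"
        unfolding Suc by (simp add: Suc_diff_le del: fact_Suc)
      then show ?thesis
        using bern_coeff_conv [of m] Suc by simp
    qed simp
    then have "(\<Sum>j\<le>n. complex_of_real (bern_coeff j) / fact (n - j)) = of_real (bern_coeff n + (if n = 1 then 1 else 0))"
      by (metis (no_types, lifting) of_real_divide of_real_fact of_real_sum sum.cong)
    then show "(\<Sum>j\<le>n. complex_of_real (bern_coeff j) / fact (n - j)) * (t ^ n * \<psi> n z) =
        of_real (bern_coeff n) * t ^ n * \<psi> n z + (if n = 1 then t * \<psi> 1 z else 0)"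
      by (auto simp: algebra_simps)
  qed simp
  also have "\<dots> = em_sum N \<psi> t z + t * \<psi> 1 z"
    using N by (simp add: em_sum_def sum.distrib)
  finally have "em_sum N \<psi> t (z + t) - em_sum N \<psi> t z - t * \<psi> 1 z
      = (\<Sum>j\<le>N. of_real (bern_coeff j) * t ^ j * R j)"
    by simp
  also have "norm \<dots> \<le> (\<Sum>j\<le>N. \<bar>bern_coeff j\<bar> * (B * norm t ^ Suc N))"
  proof (rule sum_norm_le)
    fix j assume j: "j \<in> {..N}"
    have "norm (of_real (bern_coeff j) * t ^ j * R j) \<le> \<bar>bern_coeff j\<bar> * norm t ^ j * (B * norm t ^ Suc (N - j))"
      using R [of j] j by (simp add: norm_mult norm_power mult_left_mono)
    also have "\<dots> = \<bar>bern_coeff j\<bar> * (B * (norm t ^ (j + Suc (N - j))))"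
      by (simp add: power_add mult_ac)
    also have "j + Suc (N - j) = Suc N"
      using j by auto
    finally show "norm (of_real (bern_coeff j) * t ^ j * R j) \<le> \<bar>bern_coeff j\<bar> * (B * norm t ^ Suc N)" .
  qed
  finally show ?thesis
    by (simp only: sum_distrib_right mult.assoc)
qed

section \<open>Analytic continuation of the zeta function\<close>

text \<open>For i > 0 and s different from 1 the factor j = 0 cancels the denominator; only i = 0
  keeps the pole at s = 1.\<close>

definition zeta_coeff :: "complex \<Rightarrow> nat \<Rightarrow> complex" where
  "zeta_coeff s i = (\<Prod>j<i. 1 - s - of_nat j) / (1 - s)"

text \<open>For \<open>i > 0\<close> this is the derivative of order \<open>i - 1\<close> of \<open>x powr (- s)\<close>; for \<open>i = 0\<close> it is the primitive
  that tends to \<open>0\<close> at infinity when \<open>Re s > 1\<close>.\<close>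

definition zeta_deriv :: "complex \<Rightarrow> nat \<Rightarrow> complex \<Rightarrow> complex" where
  "zeta_deriv s i x = zeta_coeff s i * x powr (1 - s - of_nat i)"

definition zeta_err :: "nat \<Rightarrow> complex \<Rightarrow> nat \<Rightarrow> complex" where
  "zeta_err N s m = em_sum N (zeta_deriv s) 1 (of_nat m + 1) - em_sum N (zeta_deriv s) 1 (of_nat m) - of_nat m powr (- s)"

text \<open>For Re s > 1 this is the telescoped Dirichlet series, the boundary term at infinity
  being 0. The error series converges for Re s > 1 - N, so the same expression continues zeta to
  that half-plane.\<close>

definition zeta_em :: "nat \<Rightarrow> complex \<Rightarrow> complex" where
  "zeta_em N s = - em_sum N (zeta_deriv s) 1 1 - (\<Sum>m. zeta_err N s (Suc m))"

lemma zeta_deriv_has_derivative: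
  assumes "x \<notin> \<real>\<^sub>\<le>\<^sub>0"
  shows "(zeta_deriv s i has_field_derivative zeta_deriv s (Suc i) x) (at x)"
proof -
  have "((\<lambda>x. zeta_coeff s i * x powr (1 - s - of_nat i)) has_field_derivative
      zeta_coeff s i * ((1 - s - of_nat i) * x powr (1 - s - of_nat i - 1))) (at x)"
    using assms by (intro DERIV_cmult has_field_derivative_powr)
  also have "zeta_coeff s i * ((1 - s - of_nat i) * x powr (1 - s - of_nat i - 1)) = zeta_deriv s (Suc i) x"
  proof -
    have "1 - s - of_nat i - 1 = 1 - s - of_nat (Suc i)"
      by simp
    then show ?thesis
      by (simp only: zeta_deriv_def zeta_coeff_def prod.lessThan_Suc) simp
  qed
  finally show ?thesis
    by (simp add: zeta_deriv_def [abs_def])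
qed

definition bern_abs_sum :: "nat \<Rightarrow> real" where
  "bern_abs_sum N = (\<Sum>j\<le>N. \<bar>bern_coeff j\<bar>)"

lemma bern_abs_sum_nonneg: "bern_abs_sum N \<ge> 0"
  by (simp add: bern_abs_sum_def sum_nonneg)

text \<open>\<open>em_step\<close> with step 1; since Re s + N is nonnegative, |x^(-s-N)| is largest
  at the left end of the segment.\<close>

lemma zeta_err_bound:
  assumes N: "N \<ge> 1" and s: "Re s + real N \<ge> 0" "s \<noteq> 1" and m: "m \<ge> 1"
  shows "norm (zeta_err N s m) \<le> bern_abs_sum N * norm (zeta_coeff s (Suc N)) * real m powr (- (Re s + real N))"
proof -
  have seg: "\<exists>y\<ge>real m. x = of_real y" if x: "x \<in> closed_segment (of_nat m) (of_nat m + 1)" for x :: complex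
  proof -
    obtain u where "0 \<le> u" "x = (1 - u) *\<^sub>R of_nat m + u *\<^sub>R (of_nat m + 1)"
      using x unfolding in_segment by blast
    then have "x = of_real (real m + u)" "real m + u \<ge> real m"
      by (auto simp: scaleR_conv_of_real algebra_simps)
    then show ?thesis by blast
  qed
  have "norm (em_sum N (zeta_deriv s) 1 (of_nat m + 1) - em_sum N (zeta_deriv s) 1 (of_nat m) - 1 * zeta_deriv s 1 (of_nat m))
      \<le> (\<Sum>j\<le>N. \<bar>bern_coeff j\<bar>) * (norm (zeta_coeff s (Suc N)) * real m powr (- (Re s + real N))) * norm (1::complex) ^ Suc N"
  proof (rule em_step [OF N])
    fix i x assume "x \<in> closed_segment (of_nat m) (of_nat m + (1::complex))"
    then obtain y where "y \<ge> real m" "x = of_real y"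
      using seg by blast
    then show "(zeta_deriv s i has_field_derivative zeta_deriv s (Suc i) x) (at x)"
      using m by (intro zeta_deriv_has_derivative) auto
  next
    fix x assume "x \<in> closed_segment (of_nat m) (of_nat m + (1::complex))"
    then obtain y where y: "y \<ge> real m" "x = of_real y"
      using seg by blast
    have "norm (zeta_deriv s (Suc N) x) = norm (zeta_coeff s (Suc N)) * y powr (- (Re s + real N))"
      using y m by (simp add: zeta_deriv_def norm_mult norm_powr_real_powr)
    also have "y powr (- (Re s + real N)) \<le> real m powr (- (Re s + real N))"
      using y m s by (intro powr_mono2') auto
    finally show "norm (zeta_deriv s (Suc N) x) \<le> norm (zeta_coeff s (Suc N)) * real m powr (- (Re s + real N))"
      by (simp add: mult_left_mono)
  qed
  also have "zeta_deriv s 1 (of_nat m) = of_nat m powr (- s)"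
    using s by (simp add: zeta_deriv_def zeta_coeff_def)
  finally show ?thesis
    by (simp add: zeta_err_def bern_abs_sum_def mult.assoc)
qed

lemma summable_zeta_err:
  assumes N: "N \<ge> 1" and s: "Re s > 1 - real N" "s \<noteq> 1"
  shows "summable (\<lambda>m. zeta_err N s (Suc m))"
proof (rule summable_comparison_test')
  have "summable (\<lambda>m. real m powr (- (Re s + real N)))"
    using s by (subst summable_real_powr_iff) auto
  then have "summable (\<lambda>m. real (Suc m) powr (- (Re s + real N)))"
    by (subst summable_Suc_iff)
  then show "summable (\<lambda>m. bern_abs_sum N * norm (zeta_coeff s (Suc N)) * real (Suc m) powr (- (Re s + real N)))"
    by (rule summable_mult)
  show "norm (zeta_err N s (Suc m)) \<le> bern_abs_sum N * norm (zeta_coeff s (Suc N)) * real (Suc m) powr (- (Re s + real N))" for m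
    using zeta_err_bound [OF N, of s "Suc m"] s by simp
qed

lemma zeta_em_sums:
  assumes N: "N \<ge> 1" and s: "Re s > 1"
  shows "(\<lambda>n. 1 / of_nat (Suc n) powr s) sums zeta_em N s"
proof -
  have [simp]: "s \<noteq> 1"
    using s by auto
  have sm: "summable (\<lambda>m. zeta_err N s (Suc m))"
    using summable_zeta_err [OF N, of s] s by simp
  have part: "(\<Sum>n<M. 1 / of_nat (Suc n) powr s) =
      em_sum N (zeta_deriv s) 1 (of_nat (Suc M)) - em_sum N (zeta_deriv s) 1 1 - (\<Sum>n<M. zeta_err N s (Suc n))" for M
    by (induction M) (simp_all add: zeta_err_def powr_minus divide_inverse add_ac)
  have "(\<lambda>M. em_sum N (zeta_deriv s) 1 (of_nat (Suc M))) \<longlonglongrightarrow> (\<Sum>j\<le>N. of_real (bern_coeff j) * 1 ^ j * (zeta_coeff s j * 0))"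
    unfolding em_sum_def zeta_deriv_def
  proof (intro tendsto_intros)
    fix j
    have "(\<lambda>M. real (Suc M) powr (1 - Re s - real j)) \<longlonglongrightarrow> 0"
      using s by (intro tendsto_neg_powr filterlim_compose [OF filterlim_real_sequentially filterlim_Suc]) auto
    then show "(\<lambda>M. complex_of_nat (Suc M) powr (1 - s - of_nat j)) \<longlonglongrightarrow> 0"
      by (subst tendsto_norm_zero_iff [symmetric]) (simp add: norm_powr_real_powr del: of_nat_Suc)
  qed
  then have "(\<lambda>M. em_sum N (zeta_deriv s) 1 (of_nat (Suc M)) - em_sum N (zeta_deriv s) 1 1 - (\<Sum>n<M. zeta_err N s (Suc n)))
      \<longlonglongrightarrow> 0 - em_sum N (zeta_deriv s) 1 1 - (\<Sum>n. zeta_err N s (Suc n))"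
    by (intro tendsto_diff summable_LIMSEQ [OF sm] tendsto_const) simp
  then show ?thesis
    unfolding sums_def part zeta_em_def by simp
qed

lemma holomorphic_zeta_em:
  assumes N: "N \<ge> 1"
  shows "zeta_em N holomorphic_on {s. Re s > 1 - real N} - {1}"
proof -
  let ?S = "{s. Re s > 1 - real N} - {1}"
  have op: "open ?S"
    by (intro open_Diff open_halfspace_Re_gt) auto
  have hol_em: "(\<lambda>s. em_sum N (zeta_deriv s) 1 x) holomorphic_on ?S" if "x \<noteq> 0" for x
    unfolding em_sum_def zeta_deriv_def zeta_coeff_def by (intro holomorphic_intros) (use that in auto)
  have hol_err: "(\<lambda>s. zeta_err N s (Suc m)) holomorphic_on ?S" for m
  proof -
    have "complex_of_nat (Suc m) + 1 = of_nat (Suc (Suc m))"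
      by simp
    then have "complex_of_nat (Suc m) + 1 \<noteq> 0" "complex_of_nat (Suc m) \<noteq> 0"
      by (simp_all only: of_nat_neq_0 not_False_eq_True)
    then show ?thesis
      unfolding zeta_err_def by (intro holomorphic_intros hol_em) auto
  qed
  have "(\<lambda>s. \<Sum>m. zeta_err N s (Suc m)) holomorphic_on ?S"
  proof (rule holomorphic_uniform_sequence [OF op])
    show "(\<lambda>s. \<Sum>m<M. zeta_err N s (Suc m)) holomorphic_on ?S" for M
      by (intro holomorphic_intros hol_err)
    fix s assume s: "s \<in> ?S"
    obtain d0 where d0: "d0 > 0" "cball s d0 \<subseteq> ?S"
      using op s open_contains_cball by blast
    \<comment> \<open>Half the distance of s from the line Re s = 1 - N: on the whole disc the
      exponent stays at least 1 + \<open>\<epsilon>\<close>, which gives one summable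
      majorant.\<close>
    define \<epsilon> where "\<epsilon> = (Re s + real N - 1) / 2"
    define d where "d = min d0 \<epsilon>"
    have \<epsilon>: "\<epsilon> > 0"
      using s by (simp add: \<epsilon>_def)
    have d: "d > 0" "cball s d \<subseteq> ?S"
      using d0 \<epsilon> by (auto simp: d_def)
    have Re: "Re w + real N \<ge> 1 + \<epsilon>" if "w \<in> cball s d" for w
    proof -
      have "\<bar>Re s - Re w\<bar> \<le> \<epsilon>"
        using that abs_Re_le_cmod [of "s - w"] by (simp add: dist_norm d_def)
      then have "Re w \<ge> Re s - \<epsilon>"
        by linarith
      then show ?thesis
        by (simp add: \<epsilon>_def field_simps)
    qed
    have "continuous_on (cball s d) (\<lambda>w. zeta_coeff w (Suc N))"
      unfolding zeta_coeff_def by (intro continuous_intros) (use d(2) in auto)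
    then have "compact ((\<lambda>w. zeta_coeff w (Suc N)) ` cball s d)"
      by (intro compact_continuous_image) auto
    then obtain C where C: "\<And>w. w \<in> cball s d \<Longrightarrow> norm (zeta_coeff w (Suc N)) \<le> C"
      using compact_imp_bounded bounded_iff by (metis image_eqI)
    have "uniform_limit (cball s d) (\<lambda>M w. \<Sum>m<M. zeta_err N w (Suc m)) (\<lambda>w. \<Sum>m. zeta_err N w (Suc m)) sequentially"
    proof (rule Weierstrass_m_test)
      fix m w assume w: "w \<in> cball s d"
      have "norm (zeta_err N w (Suc m)) \<le> bern_abs_sum N * norm (zeta_coeff w (Suc N)) * real (Suc m) powr (- (Re w + real N))"
        using Re [OF w] \<epsilon> w d(2) by (intro zeta_err_bound [OF N]) auto
      also have "\<dots> \<le> bern_abs_sum N * C * real (Suc m) powr (- (1 + \<epsilon>))"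
        using Re [OF w] C [OF w] bern_abs_sum_nonneg order_trans [OF norm_ge_zero C [OF w]]
        by (intro mult_mono powr_mono mult_nonneg_nonneg) auto
      finally show "norm (zeta_err N w (Suc m)) \<le> bern_abs_sum N * C * real (Suc m) powr (- (1 + \<epsilon>))" .
    next
      have "summable (\<lambda>m. real m powr (- (1 + \<epsilon>)))"
        using \<epsilon> by (subst summable_real_powr_iff) auto
      then have "summable (\<lambda>m. real (Suc m) powr (- (1 + \<epsilon>)))"
        by (subst summable_Suc_iff)
      then show "summable (\<lambda>m. bern_abs_sum N * C * real (Suc m) powr (- (1 + \<epsilon>)))"
        by (rule summable_mult)
    qed
    then show "\<exists>d>0. cball s d \<subseteq> ?S \<and> uniform_limit (cball s d) (\<lambda>M w. \<Sum>m<M. zeta_err N w (Suc m)) (\<lambda>w. \<Sum>m. zeta_err N w (Suc m)) sequentially"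
      using d by blast
  qed
  then show ?thesis
    unfolding zeta_em_def [abs_def] by (intro holomorphic_intros hol_em) auto
qed

lemma zeta_em_indep:
  assumes "1 \<le> N" "N \<le> M" "Re s > 1 - real N" "s \<noteq> 1"
  shows "zeta_em N s = zeta_em M s"
proof (rule analytic_continuation_open[where s = "{s. Re s > 1}" and s' = "{s. Re s > 1 - real N} - {1}"
    and f = "zeta_em N" and g = "zeta_em M"])
  show "open {s. Re s > 1}" by (rule open_halfspace_Re_gt)
  show "{s. Re s > 1} \<noteq> {}" by (auto intro!: exI[of _ "2::complex"])
  show "open ({s. Re s > 1 - real N} - {1})" by (intro open_Diff open_halfspace_Re_gt) auto
  show "connected ({s. Re s > 1 - real N} - {1})"
    by (rule connected_open_delete) (auto intro!: convex_connected convex_halfspace_Re_gt open_halfspace_Re_gt)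
  show "{s. Re s > 1} \<subseteq> {s. Re s > 1 - real N} - {1}" by auto
  show "zeta_em N holomorphic_on {s. Re s > 1 - real N} - {1}"
    using assms by (intro holomorphic_zeta_em)
  show "zeta_em M holomorphic_on {s. Re s > 1 - real N} - {1}"
    using assms by (intro holomorphic_on_subset [OF holomorphic_zeta_em [of M]]) auto
  show "zeta_em N z = zeta_em M z" if "z \<in> {s. Re s > 1}" for z
    using zeta_em_sums [of N z] zeta_em_sums [of M z] that assms sums_unique2 by auto
  show "s \<in> {s. Re s > 1 - real N} - {1}" using assms by simp
qed

text \<open>The order grows with |Re s| so that s always lies in the half-plane of
  \<open>zeta_em\<close>; by \<open>zeta_em_indep\<close> the choice does not affect the
  value.\<close>

definition zeta_ext :: "complex \<Rightarrow> complex" where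
  "zeta_ext s = zeta_em (nat \<lceil>\<bar>Re s\<bar>\<rceil> + 2) s"

lemma zeta_ext_eq:
  assumes "N \<ge> 1" "Re s > 1 - real N" "s \<noteq> 1"
  shows "zeta_ext s = zeta_em N s"
proof -
  define M where "M = nat \<lceil>\<bar>Re s\<bar>\<rceil> + 2"
  have M: "M \<ge> 1" "Re s > 1 - real M"
    unfolding M_def by (simp, linarith)
  have "zeta_em M s = zeta_em (max M N) s"
    by (rule zeta_em_indep) (use M assms in auto)
  also have "\<dots> = zeta_em N s"
    by (rule zeta_em_indep [symmetric]) (use M assms in auto)
  finally show ?thesis
    by (simp add: zeta_ext_def M_def)
qed

lemma is_zeta_zeta_ext: "is_zeta zeta_ext"
  unfolding is_zeta_def
proof (intro conjI allI impI)
  show "(\<lambda>n. 1 / of_nat (Suc n) powr s) sums zeta_ext s" if "Re s > 1" for s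
    unfolding zeta_ext_def by (rule zeta_em_sums) (use that in auto)
  have "zeta_ext field_differentiable at s" if s: "s \<noteq> 1" for s
  proof -
    define N where "N = nat \<lceil>\<bar>Re s\<bar>\<rceil> + 2"
    have N: "N \<ge> 1" "Re s > 1 - real N"
      unfolding N_def by (simp, linarith)
    let ?S = "{s. Re s > 1 - real N} - {1}"
    have op: "open ?S"
      by (intro open_Diff open_halfspace_Re_gt) auto
    have "zeta_em N field_differentiable at s"
      using holomorphic_on_imp_differentiable_at [OF holomorphic_zeta_em op] N s by auto
    then obtain D where "(zeta_em N has_field_derivative D) (at s)"
      by (auto simp: field_differentiable_def)
    then have "(zeta_ext has_field_derivative D) (at s)"
      by (rule has_field_derivative_transform_within_open [OF _ op]) (use N s in \<open>auto simp: zeta_ext_eq\<close>)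
    then show ?thesis
      by (auto simp: field_differentiable_def)
  qed
  then show "zeta_ext holomorphic_on - {1}"
    by (auto simp: holomorphic_on_def intro: field_differentiable_at_within)
qed

text \<open>Existence of a continuation is what gives the \<open>SOME\<close> in the definition of
  \<open>zeta\<close> its meaning.\<close>

lemma is_zeta_zeta: "is_zeta zeta"
  unfolding zeta_def by (rule someI [where P = is_zeta, OF is_zeta_zeta_ext])

lemma zeta_real_sums:
  assumes x: "x > 1"
  shows "(\<lambda>n. 1 / real (Suc n) powr x) sums zeta_real x"
proof -
  have "(\<lambda>n. 1 / of_nat (Suc n) powr of_real x) sums zeta (of_real x)"
    using is_zeta_zeta x by (simp add: is_zeta_def del: of_nat_Suc)
  moreover have "1 / of_nat (Suc n) powr of_real x = complex_of_real (1 / real (Suc n) powr x)" for n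
    using powr_of_real [of "real (Suc n)" x] by (simp del: of_nat_Suc)
  ultimately have "(\<lambda>n. complex_of_real (1 / real (Suc n) powr x)) sums zeta (of_real x)"
    by (simp only:)
  from sums_Re [OF this] show ?thesis
    unfolding zeta_real_def by (simp only: Re_complex_of_real)
qed

text \<open>At s = -k the summand is the polynomial x^k, so Euler--Maclaurin summation of order k +
  2 is exact: all error terms vanish and only the boundary value at 1 remains.\<close>

lemma zeta_real_neg:
  assumes k: "k \<ge> 1"
  shows "zeta_real (- real k) = - fact k * bern_coeff (Suc k)"
proof -
  define N where "N = k + 2"
  define s where "s = - complex_of_nat k"
  have s1: "s \<noteq> 1"
  proof
    assume "s = 1"
    then have "Re s = 1" by simp
    then show False by (simp add: s_def)
  qed
  have fac: "1 - s - of_nat j = of_nat (Suc k - j)" if "j \<le> Suc k" for j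
    using that by (simp add: s_def of_nat_diff)
  have prod: "(\<Prod>j<i. 1 - s - of_nat j) = fact (Suc k) / fact (Suc k - i)" if "i \<le> Suc k" for i
    using that
  proof (induction i)
    case (Suc i)
    then have "(\<Prod>j<i. 1 - s - of_nat j) = fact (Suc k) / fact (Suc k - i)"
      by simp
    moreover have "Suc k - i = Suc (k - i)"
      using Suc.prems by simp
    moreover have "1 - s - of_nat i = of_nat (Suc (k - i))"
      using fac [of i] Suc.prems by (simp add: Suc_diff_le)
    ultimately have "(\<Prod>j<Suc i. 1 - s - of_nat j) = fact (Suc k) / (of_nat (Suc (k - i)) * fact (k - i)) * of_nat (Suc (k - i))"
      by (simp only: prod.lessThan_Suc fact_Suc)
    moreover have "complex_of_nat (Suc (k - i)) \<noteq> 0"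
      by (simp only: of_nat_neq_0 not_False_eq_True)
    ultimately show ?case
      by (simp del: of_nat_Suc fact_Suc)
  qed (simp del: fact_Suc)
  have c: "zeta_coeff s i = fact k / fact (Suc k - i)" if "i \<le> Suc k" for i
  proof -
    have "1 - s = of_nat (Suc k)"
      by (simp add: s_def)
    then show ?thesis
      unfolding zeta_coeff_def prod [OF that] fact_Suc of_nat_mult by (simp del: of_nat_Suc)
  qed
  have c0: "zeta_coeff s i = 0" if "i \<ge> k + 2" for i
    using that fac [of "Suc k"] by (auto simp: zeta_coeff_def intro!: bexI [of _ "Suc k"])
  have err: "zeta_err N s (Suc m) = 0" for m
    using zeta_err_bound [of N s "Suc m"] c0 [of "Suc N"] s1 by (simp add: N_def s_def)
  have "zeta_em N s = - em_sum N (zeta_deriv s) 1 1"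
    by (simp add: zeta_em_def err)
  also have "em_sum N (zeta_deriv s) 1 1 = (\<Sum>j\<le>N. of_real (bern_coeff j) * zeta_coeff s j)"
    by (simp add: em_sum_def zeta_deriv_def)
  also have "\<dots> = (\<Sum>j\<le>Suc k. of_real (bern_coeff j) * zeta_coeff s j)"
    by (rule sum.mono_neutral_right) (auto simp: N_def intro!: c0)
  also have "\<dots> = (\<Sum>j\<le>Suc k. of_real (fact k * (bern_coeff j / fact (Suc k - j))))"
    by (rule sum.cong) (auto simp: c)
  also have "\<dots> = of_real (fact k * (\<Sum>j\<le>Suc k. bern_coeff j / fact (Suc k - j)))"
    by (simp add: sum_distrib_left del: sum.atMost_Suc)
  \<comment> \<open>Without its last term the sum is the convolution at k, which vanishes because k
    is positive.\<close>
  also have "(\<Sum>j\<le>Suc k. bern_coeff j / fact (Suc k - j)) = (\<Sum>j\<le>k. bern_coeff j / fact (Suc (k - j))) + bern_coeff (Suc k)"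
    by (simp add: Suc_diff_le del: fact_Suc)
  also have "\<dots> = bern_coeff (Suc k)"
    using bern_coeff_conv [of k] k by simp
  finally have "zeta_em N s = of_real (- fact k * bern_coeff (Suc k))"
    by simp
  moreover have "zeta s = zeta_em N s"
    using is_zeta_unique [OF is_zeta_zeta is_zeta_zeta_ext s1] zeta_ext_eq [of N s] s1 by (simp add: N_def s_def)
  ultimately have "zeta s = of_real (- fact k * bern_coeff (Suc k))"
    by simp
  moreover have "of_real (- real k) = s"
    by (simp add: s_def)
  ultimately show ?thesis
    unfolding zeta_real_def by simp
qed

section \<open>Euler--Maclaurin summation along rays of a sector\<close>

text \<open>Telescoping, since 1/(a + y)^2 is at most (1/a - 1/(a + y))/y. The induction runs over
  \<open>Suc M\<close>, because the term m = 0 has to be paid for separately by 1/y.\<close>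

lemma sum_inverse_square_bound:
  fixes y :: real
  assumes y: "0 < y" "y \<le> 1"
  shows "(\<Sum>m<M. 1 / (1 + real m * y) ^ 2) \<le> 2 / y"
proof -
  have "(\<Sum>m<Suc M. 1 / (1 + real m * y) ^ 2) \<le> 2 / y - 1 / (y * (1 + real M * y))" for M
  proof (induction M)
    case 0
    then show ?case using y by (simp add: field_simps)
  next
    case (Suc M)
    define a where "a = 1 + real M * y"
    have a: "a \<ge> 1"
      using y by (simp add: a_def)
    have "1 / (a + y) ^ 2 \<le> 1 / (a * (a + y))"
      unfolding power2_eq_square using a y by (intro divide_left_mono mult_right_mono) auto
    also have "\<dots> = 1 / (y * a) - 1 / (y * (a + y))"
    proof -
      have "a \<noteq> 0" "y \<noteq> 0" "a + y \<noteq> 0"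
        using a y by auto
      then show ?thesis
        by (simp add: divide_simps)
    qed
    finally have "1 / (1 + real (Suc M) * y) ^ 2 \<le> 1 / (y * (1 + real M * y)) - 1 / (y * (1 + real (Suc M) * y))"
      by (simp add: a_def algebra_simps)
    then show ?case
      using Suc.IH unfolding sum.lessThan_Suc [of _ "Suc M"] by linarith
  qed
  from this [of M] show ?thesis
    using y by (auto intro: order_trans [rotated] simp: field_simps add_nonneg_nonneg)
qed

section \<open>Sectors, and primitives along their rays\<close>

definition csector :: "real \<Rightarrow> complex set" where
  "csector c = {z. \<bar>Im z\<bar> \<le> c * Re z}"

lemma convex_cone: "convex (csector c)"
proof -
  have "csector c = {z. Im z - c * Re z \<le> 0} \<inter> {z. - Im z - c * Re z \<le> 0}"
    by (auto simp: csector_def)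
  moreover have "{z. Im z - c * Re z \<le> 0} = {z. inner (Complex (- c) 1) z \<le> 0}"
    by (auto simp: inner_complex_def)
  moreover have "{z. - Im z - c * Re z \<le> 0} = {z. inner (Complex (- c) (- 1)) z \<le> 0}"
    by (auto simp: inner_complex_def)
  ultimately show ?thesis
    by (simp add: convex_Int convex_halfspace_le)
qed

lemma csector_scale: "z \<in> csector c \<Longrightarrow> r \<ge> 0 \<Longrightarrow> of_real r * z \<in> csector c"
  using mult_left_mono [of "\<bar>Im z\<bar>" "c * Re z" r] by (simp add: csector_def abs_mult mult.left_commute)

lemma csector_Re_nonneg: "z \<in> csector c \<Longrightarrow> c > 0 \<Longrightarrow> Re z \<ge> 0"
  using zero_le_mult_iff [of c "Re z"] order_trans [OF abs_ge_zero, of "Im z" "c * Re z"] by (auto simp: csector_def)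

lemma csector_norm_le:
  assumes "z \<in> csector c" "0 < c" "c \<le> 1"
  shows "norm z \<le> 2 * Re z"
proof -
  have r: "Re z \<ge> 0"
    using assms csector_Re_nonneg by blast
  have "norm z \<le> \<bar>Re z\<bar> + \<bar>Im z\<bar>"
    by (rule cmod_le)
  also have "\<bar>Im z\<bar> \<le> c * Re z"
    using assms by (simp add: csector_def)
  also have "c * Re z \<le> 1 * Re z"
    using assms r by (intro mult_right_mono) auto
  finally show ?thesis
    using r by simp
qed

text \<open>Cauchy's inequality on the circle of radius \<open>\<rho>\<close>: since
  \<open>\<rho>\<close> is at most 1/2, points w of the circle have 1 + |w| at least (1 + |z|)/2,
  whence the factor 4.\<close>

lemma higher_deriv_bound_inverse_square:
  assumes g: "g holomorphic_on D" and "open D" and \<rho>: "0 < \<rho>" "\<rho> \<le> 1 / 2" "cball z \<rho> \<subseteq> D"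
    and bound: "\<And>z. z \<in> D \<Longrightarrow> norm (g z) \<le> C / (1 + norm z) ^ 2" and C: "C \<ge> 0"
  shows "norm ((deriv ^^ n) g z) \<le> fact n * (4 * C) / \<rho> ^ n / (1 + norm z) ^ 2"
proof -
  have "norm ((deriv ^^ n) g z) \<le> fact n * (4 * C / (1 + norm z) ^ 2) / \<rho> ^ n"
  proof (rule Cauchy_inequality)
    show "g holomorphic_on ball z \<rho>"
      using \<rho> by (intro holomorphic_on_subset [OF g]) auto
    show "continuous_on (cball z \<rho>) g"
      using \<rho> by (intro holomorphic_on_imp_continuous_on holomorphic_on_subset [OF g]) auto
    fix w assume w: "norm (z - w) = \<rho>"
    then have "w \<in> D"
      using \<rho> by (auto simp: dist_norm)
    have "norm z \<le> norm w + \<rho>"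
      using norm_triangle_sub [of z w] w by simp
    then have *: "(1 + norm z) / 2 \<le> 1 + norm w"
      using \<rho> norm_ge_zero [of w] by argo
    have "norm (g w) \<le> C / (1 + norm w) ^ 2"
      by (rule bound) fact
    also have "\<dots> \<le> C / ((1 + norm z) / 2) ^ 2"
    proof (rule divide_left_mono)
      show "((1 + norm z) / 2)\<^sup>2 \<le> (1 + norm w)\<^sup>2"
        using * by (rule power_mono) (simp add: add_nonneg_nonneg)
      have "(1 + norm w) > 0" "(1 + norm z) / 2 > 0"
        by (simp_all add: add_pos_nonneg)
      then show "0 < (1 + norm w)\<^sup>2 * ((1 + norm z) / 2)\<^sup>2"
        by simp
    qed fact
    also have "\<dots> = 4 * C / (1 + norm z) ^ 2"
      by (simp add: power_divide)
    finally show "norm (g w) \<le> 4 * C / (1 + norm z) ^ 2" .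
  qed (use \<rho> in auto)
  then show ?thesis
    by (simp add: field_simps)
qed

text \<open>The primitive of a function of size \<open>O(|z|\<^sup>-\<^sup>2)\<close> has the same limit at infinity along every ray of the sector,
  which makes the constant \<open>I\<close> below independent of the direction of \<open>t\<close>.\<close>

lemma primitive_limit_ray:
  assumes c: "0 < c" "c \<le> 1" and C: "C \<ge> 0"
    and der: "\<And>z. z \<in> csector c \<Longrightarrow> (\<Phi> has_field_derivative g z) (at z within csector c)"
    and bound: "\<And>z. z \<in> csector c \<Longrightarrow> norm (g z) \<le> C / (1 + norm z) ^ 2"
    and lim: "(\<lambda>m. \<Phi> (of_nat m)) \<longlonglongrightarrow> L" and t: "t \<in> csector c" "t \<noteq> 0"
  shows "(\<lambda>m. \<Phi> (of_nat m * t)) \<longlonglongrightarrow> L"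
proof -
  have nt: "norm t > 0"
    using t by simp
  \<comment> \<open>An integer within 1 above |m t|. The segment from it to m t has length O(R),
    with R = |m t|, and stays at distance at least R/2 from 0, where the derivative is O(R^-2); the
    two values of the primitive thus differ by O(1/R).\<close>
  define n where "n m = nat \<lceil>norm (of_nat m * t)\<rceil>" for m :: nat
  have n_ge: "real (n m) \<ge> real m * norm t" for m
    using real_nat_ceiling_ge [of "norm (of_nat m * t)"] by (simp add: n_def norm_mult)
  have n_le: "real (n m) \<le> real m * norm t + 1" for m
    unfolding n_def by (simp add: norm_mult of_nat_nat ceiling_correct less_imp_le)
  have lin: "filterlim (\<lambda>m. real m * norm t) at_top sequentially"
    using nt by (intro filterlim_at_top_mult_tendsto_pos [OF tendsto_const] filterlim_real_sequentially) auto
  have "filterlim (\<lambda>m. real (n m)) at_top sequentially"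
    by (rule filterlim_at_top_mono [OF lin]) (use n_ge in auto)
  then have "filterlim n at_top sequentially"
    by (simp add: filterlim_sequentially_iff_filterlim_real)
  then have lim_n: "(\<lambda>m. \<Phi> (of_nat (n m))) \<longlonglongrightarrow> L"
    by (rule filterlim_compose [OF lim])
  have diff: "norm (\<Phi> (of_nat m * t) - \<Phi> (of_nat (n m))) \<le> 8 * C / (1 + real m * norm t)" for m
  proof -
    let ?z = "of_nat m * t" and ?w = "of_nat (n m) :: complex"
    have z: "?z \<in> csector c"
      using csector_scale [OF t(1), of "real m"] by simp
    have w: "?w \<in> csector c"
      using c by (auto simp: csector_def)
    have seg: "closed_segment ?w ?z \<subseteq> csector c"
      using convex_cone z w by (metis convex_contains_segment)
    define R where "R = real m * norm t"
    have R: "R \<ge> 0" "norm ?z = R" "real (n m) \<ge> R" "real (n m) \<le> R + 1"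
      using n_ge n_le by (auto simp: R_def norm_mult)
    have "norm (\<Phi> ?z - \<Phi> ?w) \<le> C / (1 + R / 2) ^ 2 * norm (?z - ?w)"
    proof (rule field_differentiable_bound [where S = "closed_segment ?w ?z" and f' = g])
      fix x assume x: "x \<in> closed_segment ?w ?z"
      then show "(\<Phi> has_field_derivative g x) (at x within closed_segment ?w ?z)"
        using der seg by (meson DERIV_subset subsetD)
      obtain u where u: "0 \<le> u" "u \<le> 1" "x = (1 - u) *\<^sub>R ?w + u *\<^sub>R ?z"
        using x unfolding in_segment by blast
      \<comment> \<open>In the sector |z| is at most 2 Re z, so a lower bound on the real part holds
        at both ends and hence on the whole segment.\<close>
      have "R / 2 \<le> Re ?w" "R / 2 \<le> Re ?z"
        using R csector_norm_le [OF z c] by auto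
      then have "(1 - u) * (R / 2) + u * (R / 2) \<le> (1 - u) * Re ?w + u * Re ?z"
        using u by (intro add_mono mult_left_mono) auto
      moreover have "(1 - u) * (R / 2) + u * (R / 2) = R / 2"
        by (simp add: field_simps)
      ultimately have "R / 2 \<le> Re x"
        by (simp add: u(3))
      then have "R / 2 \<le> norm x"
        using complex_Re_le_cmod order_trans by blast
      have "norm (g x) \<le> C / (1 + norm x) ^ 2"
        using x seg by (intro bound) auto
      also have "\<dots> \<le> C / (1 + R / 2) ^ 2"
        using \<open>R / 2 \<le> norm x\<close> R C by (intro divide_left_mono power_mono mult_pos_pos zero_less_power) (auto simp: add_pos_nonneg)
      finally show "norm (g x) \<le> C / (1 + R / 2) ^ 2" .
    qed auto
    also have "\<dots> \<le> C / (1 + R / 2) ^ 2 * (2 * (1 + R))"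
    proof (intro mult_left_mono)
      have "norm (?z - ?w) \<le> norm ?z + norm ?w"
        by (rule norm_triangle_ineq4)
      then show "norm (?z - ?w) \<le> 2 * (1 + R)"
        using R by simp
    qed (use C in auto)
    also have "\<dots> \<le> C / ((1 + R) / 2) ^ 2 * (2 * (1 + R))"
      using R C by (intro mult_right_mono divide_left_mono power_mono mult_pos_pos zero_less_power) auto
    also have "\<dots> = 8 * C / (1 + R)"
    proof -
      have e: "C / (s / 2) ^ 2 * (2 * s) = 8 * C / s" if "s > 0" for s
        using that by (simp add: field_simps power2_eq_square)
      show ?thesis
        by (rule e) (use R in simp)
    qed
    finally show ?thesis
      by (simp add: R_def)
  qed
  have "(\<lambda>m. 8 * C / (1 + real m * norm t)) \<longlonglongrightarrow> 0"
    by (rule tendsto_divide_0 [OF tendsto_const])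
       (intro filterlim_at_top_imp_at_infinity filterlim_tendsto_add_at_top [OF tendsto_const] lin)
  then have "(\<lambda>m. \<Phi> (of_nat m * t) - \<Phi> (of_nat (n m))) \<longlonglongrightarrow> 0"
    by (rule Lim_null_comparison [rotated]) (use diff in auto)
  from tendsto_add [OF this lim_n] show ?thesis
    by simp
qed

text \<open>Summing \<open>em_step\<close> over m. The constant I is the integral of g over the
  positive axis; it is quantified before N and t, so it depends neither on the order nor on the
  direction. The growing count of about 1/|t| relevant terms costs one power of t, so the error is
  of order N and not N + 1.\<close>

lemma em_cone_sum:
  assumes "open D" "convex D" and g: "g holomorphic_on D" and c: "0 < c" "c \<le> 1"
    and \<rho>: "0 < \<rho>" "\<rho> \<le> 1 / 2" "\<And>z. z \<in> csector c \<Longrightarrow> cball z \<rho> \<subseteq> D"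
    and bound: "\<And>z. z \<in> D \<Longrightarrow> norm (g z) \<le> C / (1 + norm z) ^ 2"
  shows "\<exists>I. \<forall>N\<ge>1. \<exists>K. \<forall>t\<in>csector c. t \<noteq> 0 \<longrightarrow> norm t \<le> 1 \<longrightarrow>
     summable (\<lambda>m. g (of_nat m * t)) \<and>
     norm (t * (\<Sum>m. g (of_nat m * t)) - I + (\<Sum>j=1..N. of_real (bern_coeff j) * t ^ j * (deriv ^^ (j - 1)) g 0))
        \<le> K * norm t ^ N"
proof -
  have sub: "csector c \<subseteq> D"
    using \<rho> by fastforce
  have z0: "0 \<in> csector c"
    by (simp add: csector_def)
  have C: "C \<ge> 0"
    using bound [of 0] sub z0 order_trans [OF norm_ge_zero] by force
  obtain \<Phi> where \<Phi>: "\<And>x. x \<in> D \<Longrightarrow> (\<Phi> has_field_derivative g x) (at x within D)"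
    using holomorphic_convex_primitive' [OF \<open>convex D\<close> \<open>open D\<close> g] by blast
  \<comment> \<open>A primitive of g in place 0 shifts all indices by one, as \<open>em_sum\<close>
    expects; this is where derivatives of order j - 1 in the conclusion come from.\<close>
  define \<psi> where "\<psi> i = (case i of 0 \<Rightarrow> \<Phi> | Suc j \<Rightarrow> (deriv ^^ j) g)" for i
  have \<psi>_der: "(\<psi> i has_field_derivative \<psi> (Suc i) x) (at x)" if "x \<in> D" for i x
  proof (cases i)
    case 0
    then show ?thesis
      using \<Phi> [OF that] at_within_open [OF that \<open>open D\<close>] by (simp add: \<psi>_def)
  next
    case (Suc j)
    have "(deriv ^^ j) g holomorphic_on D"
      by (rule holomorphic_higher_deriv [OF g \<open>open D\<close>])
    then show ?thesis
      using holomorphic_derivI [OF _ \<open>open D\<close> that] by (simp add: Suc \<psi>_def)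
  qed
  define Cn where "Cn n = fact n * (4 * C) / \<rho> ^ n" for n
  have Cn: "Cn n \<ge> 0" for n
    using C \<rho> by (simp add: Cn_def)
  have \<psi>_bound: "norm (\<psi> (Suc n) z) \<le> Cn n / (1 + norm z) ^ 2" if "z \<in> csector c" for n z
    using higher_deriv_bound_inverse_square [OF g \<open>open D\<close> \<rho>(1,2) \<rho>(3) [OF that] bound C, of n]
    by (simp add: \<psi>_def Cn_def)
  have \<psi>_lim: "(\<lambda>m. \<psi> (Suc n) (of_nat m * t)) \<longlonglongrightarrow> 0" if t: "t \<in> csector c" "t \<noteq> 0" for n t
  proof (rule Lim_null_comparison [OF always_eventually])
    show "\<forall>m. norm (\<psi> (Suc n) (of_nat m * t)) \<le> Cn n / (1 + real m * norm t) ^ 2"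
      using \<psi>_bound [OF csector_scale [OF t(1)]] by (metis norm_mult norm_of_nat of_nat_0_le_iff of_real_of_nat_eq)
    have "filterlim (\<lambda>m. real m * norm t) at_top sequentially"
      using t by (intro filterlim_at_top_mult_tendsto_pos [OF tendsto_const] filterlim_real_sequentially) auto
    then show "(\<lambda>m. Cn n / (1 + real m * norm t) ^ 2) \<longlonglongrightarrow> 0"
      by (intro tendsto_divide_0 [OF tendsto_const] filterlim_at_top_imp_at_infinity filterlim_pow_at_top
            filterlim_tendsto_add_at_top [OF tendsto_const]) auto
  qed
  define E where "E N t m = em_sum N \<psi> t (of_nat (Suc m) * t) - em_sum N \<psi> t (of_nat m * t) - t * g (of_nat m * t)" for N t m
  have E_bound: "norm (E N t m) \<le> (\<Sum>j\<le>N. \<bar>bern_coeff j\<bar>) * Cn N * norm t ^ Suc N * (1 / (1 + real m * norm t) ^ 2)"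
    if t: "t \<in> csector c" and N: "N \<ge> 1" for N t m
  proof -
    have seg: "x \<in> csector c \<and> norm x \<ge> real m * norm t" if x: "x \<in> closed_segment (of_nat m * t) (of_nat m * t + t)" for x
    proof -
      obtain u where u: "0 \<le> u" "x = (1 - u) *\<^sub>R (of_nat m * t) + u *\<^sub>R (of_nat m * t + t)"
        using x unfolding in_segment by blast
      then have "x = of_real (real m + u) * t"
        by (simp add: scaleR_conv_of_real algebra_simps)
      then show ?thesis
        using csector_scale [OF t, of "real m + u"] u(1) by (auto simp: norm_mult intro!: mult_right_mono simp del: of_real_add)
    qed
    have "norm (em_sum N \<psi> t (of_nat m * t + t) - em_sum N \<psi> t (of_nat m * t) - t * \<psi> 1 (of_nat m * t))
      \<le> (\<Sum>j\<le>N. \<bar>bern_coeff j\<bar>) * (Cn N / (1 + real m * norm t) ^ 2) * norm t ^ Suc N"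
    proof (rule em_step [OF N])
      fix i x assume "x \<in> closed_segment (of_nat m * t) (of_nat m * t + t)"
      then show "(\<psi> i has_field_derivative \<psi> (Suc i) x) (at x)"
        using seg sub \<psi>_der by blast
    next
      fix x assume x: "x \<in> closed_segment (of_nat m * t) (of_nat m * t + t)"
      then have "norm (\<psi> (Suc N) x) \<le> Cn N / (1 + norm x) ^ 2"
        using \<psi>_bound seg by blast
      also have "\<dots> \<le> Cn N / (1 + real m * norm t) ^ 2"
        using seg [OF x] Cn [of N]
        by (intro divide_left_mono power_mono mult_pos_pos zero_less_power) (auto simp: add_pos_nonneg)
      finally show "norm (\<psi> (Suc N) x) \<le> Cn N / (1 + real m * norm t) ^ 2" .
    qed
    moreover have "of_nat m * t + t = of_nat (Suc m) * t"
      by (simp add: algebra_simps)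
    ultimately show ?thesis
      by (simp add: E_def \<psi>_def mult_ac)
  qed
  have sq_summable: "summable (\<lambda>m. 1 / (1 + real m * y) ^ 2)" "(\<Sum>m. 1 / (1 + real m * y) ^ 2) \<le> 2 / y"
    if y: "0 < y" "y \<le> 1" for y :: real
  proof -
    show "summable (\<lambda>m. 1 / (1 + real m * y) ^ 2)"
      using sum_inverse_square_bound [OF y] by (intro summableI_nonneg_bounded) auto
    then show "(\<Sum>m. 1 / (1 + real m * y) ^ 2) \<le> 2 / y"
      by (rule suminf_le_const) (use sum_inverse_square_bound [OF y] in auto)
  qed
  have g_summable: "summable (\<lambda>m. g (of_nat m * t))" if t: "t \<in> csector c" "t \<noteq> 0" "norm t \<le> 1" for t
  proof (rule summable_comparison_test')
    show "summable (\<lambda>m. Cn 0 * (1 / (1 + real m * norm t) ^ 2))"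
      using t by (intro summable_mult sq_summable) auto
    show "norm (g (of_nat m * t)) \<le> Cn 0 * (1 / (1 + real m * norm t) ^ 2)" for m
      using \<psi>_bound [OF csector_scale [OF t(1), of "real m"], of 0] by (simp add: \<psi>_def norm_mult)
  qed
  define K where "K N = (\<Sum>j\<le>N. \<bar>bern_coeff j\<bar>) * Cn N * 2" for N
  have E_sum: "summable (E N t)" "norm (suminf (E N t)) \<le> K N * norm t ^ N"
    if t: "t \<in> csector c" "t \<noteq> 0" "norm t \<le> 1" and N: "N \<ge> 1" for N t
  proof -
    let ?A = "(\<Sum>j\<le>N. \<bar>bern_coeff j\<bar>) * Cn N * norm t ^ Suc N"
    have A: "?A \<ge> 0"
      using Cn by (intro mult_nonneg_nonneg sum_nonneg) auto
    have s: "summable (\<lambda>m. ?A * (1 / (1 + real m * norm t) ^ 2))"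
      using t by (intro summable_mult sq_summable) auto
    show "summable (E N t)"
      by (rule summable_comparison_test' [OF s]) (use E_bound [OF t(1) N] in auto)
    have "norm (suminf (E N t)) \<le> (\<Sum>m. ?A * (1 / (1 + real m * norm t) ^ 2))"
      by (rule norm_suminf_le [OF E_bound [OF t(1) N] s])
    also have "\<dots> = ?A * (\<Sum>m. 1 / (1 + real m * norm t) ^ 2)"
      using t by (intro suminf_mult sq_summable) auto
    \<comment> \<open>Here one power of |t| is lost.\<close>
    also have "\<dots> \<le> ?A * (2 / norm t)"
      using t A by (intro mult_left_mono sq_summable) auto
    also have "\<dots> = K N * norm t ^ N"
      using t by (simp add: K_def)
    finally show "norm (suminf (E N t)) \<le> K N * norm t ^ N" .
  qed
  have tele: "(\<lambda>M. em_sum N \<psi> t (of_nat M * t)) \<longlonglongrightarrow> em_sum N \<psi> t 0 + t * (\<Sum>m. g (of_nat m * t)) + suminf (E N t)"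
    if t: "t \<in> csector c" "t \<noteq> 0" "norm t \<le> 1" and N: "N \<ge> 1" for N t
  proof -
    have "em_sum N \<psi> t (of_nat M * t) = em_sum N \<psi> t 0 + t * (\<Sum>m<M. g (of_nat m * t)) + (\<Sum>m<M. E N t m)" for M
      by (induction M) (simp_all add: E_def algebra_simps)
    moreover have "(\<lambda>M. em_sum N \<psi> t 0 + t * (\<Sum>m<M. g (of_nat m * t)) + (\<Sum>m<M. E N t m))
       \<longlonglongrightarrow> em_sum N \<psi> t 0 + t * (\<Sum>m. g (of_nat m * t)) + suminf (E N t)"
      by (intro tendsto_intros summable_LIMSEQ g_summable [OF t] E_sum(1) [OF t N])
    ultimately show ?thesis
      by simp
  qed
  have em_split: "em_sum N \<psi> t z = \<Phi> z + (\<Sum>j=1..N. of_real (bern_coeff j) * t ^ j * \<psi> j z)" for N t z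
    by (simp add: em_sum_def \<psi>_def atMost_atLeast0 sum.atLeast_Suc_atMost)
  have rest_lim: "(\<lambda>M. \<Sum>j=1..N. of_real (bern_coeff j) * t ^ j * \<psi> j (of_nat M * t)) \<longlonglongrightarrow> 0"
    if t: "t \<in> csector c" "t \<noteq> 0" for N t
  proof (rule tendsto_null_sum)
    fix j assume "j \<in> {1..N}"
    then have "(\<lambda>M. \<psi> j (of_nat M * t)) \<longlonglongrightarrow> 0"
      using \<psi>_lim [OF t, of "j - 1"] by simp
    then show "(\<lambda>M. of_real (bern_coeff j) * t ^ j * \<psi> j (of_nat M * t)) \<longlonglongrightarrow> 0"
      by (rule tendsto_mult_right_zero)
  qed
  have lim_\<Phi>: "(\<lambda>M. \<Phi> (of_nat M * t)) \<longlonglongrightarrow> em_sum N \<psi> t 0 + t * (\<Sum>m. g (of_nat m * t)) + suminf (E N t)"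
    if t: "t \<in> csector c" "t \<noteq> 0" "norm t \<le> 1" and N: "N \<ge> 1" for N t
    using tendsto_diff [OF tele [OF t N] rest_lim [OF t(1,2), of N]] by (simp add: em_split)
  have one: "(1::complex) \<in> csector c"
    using c by (simp add: csector_def)
  \<comment> \<open>The ray t = 1 with N = 1 shows that the primitive has a limit along the
    integers; \<open>primitive_limit_ray\<close> transfers this limit to all other rays.\<close>
  define L where "L = em_sum 1 \<psi> 1 0 + 1 * (\<Sum>m. g (of_nat m * 1)) + suminf (E 1 1)"
  have L: "(\<lambda>m. \<Phi> (of_nat m)) \<longlonglongrightarrow> L"
    using lim_\<Phi> [OF one, of 1] by (simp add: L_def)
  have ray: "(\<lambda>m. \<Phi> (of_nat m * t)) \<longlonglongrightarrow> L" if t: "t \<in> csector c" "t \<noteq> 0" for t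
  proof (rule primitive_limit_ray [OF c C _ _ L t])
    fix z assume z: "z \<in> csector c"
    then show "(\<Phi> has_field_derivative g z) (at z within csector c)"
      using \<Phi> sub by (meson DERIV_subset subsetD)
    show "norm (g z) \<le> C / (1 + norm z) ^ 2"
      using bound z sub by blast
  qed
  have eq: "t * (\<Sum>m. g (of_nat m * t)) - (L - \<Phi> 0) + (\<Sum>j=1..N. of_real (bern_coeff j) * t ^ j * (deriv ^^ (j - 1)) g 0)
      = - suminf (E N t)"
    if t: "t \<in> csector c" "t \<noteq> 0" "norm t \<le> 1" and N: "N \<ge> 1" for N t
  proof -
    have "L = em_sum N \<psi> t 0 + t * (\<Sum>m. g (of_nat m * t)) + suminf (E N t)"
      using LIMSEQ_unique [OF ray [OF t(1,2)] lim_\<Phi> [OF t N]] .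
    moreover have "(\<Sum>j=1..N. of_real (bern_coeff j) * t ^ j * \<psi> j 0) =
        (\<Sum>j=1..N. of_real (bern_coeff j) * t ^ j * (deriv ^^ (j - 1)) g 0)"
      by (rule sum.cong) (auto simp: \<psi>_def split: nat.split)
    ultimately show ?thesis
      by (simp add: em_split)
  qed
  show ?thesis
  proof (intro exI [of _ "L - \<Phi> 0"] allI impI)
    fix N :: nat assume N: "N \<ge> 1"
    show "\<exists>K. \<forall>t\<in>csector c. t \<noteq> 0 \<longrightarrow> norm t \<le> 1 \<longrightarrow> summable (\<lambda>m. g (of_nat m * t)) \<and>
     norm (t * (\<Sum>m. g (of_nat m * t)) - (L - \<Phi> 0) + (\<Sum>j=1..N. of_real (bern_coeff j) * t ^ j * (deriv ^^ (j - 1)) g 0))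
        \<le> K * norm t ^ N"
      using g_summable eq [OF _ _ _ N] E_sum(2) [OF _ _ _ N] by (intro exI [of _ "K N"]) simp
  qed
qed

section \<open>The logarithm of the generating function near the positive axis\<close>

definition exq :: "complex \<Rightarrow> complex" where
  "exq w = (if w = 0 then 1 else (1 - exp (- w)) / w)"

lemma exq_0 [simp]: "exq 0 = 1"
  by (simp add: exq_def)

lemma exq_mult: "exq w * w = 1 - exp (- w)"
  by (simp add: exq_def)

lemma holomorphic_exq: "exq holomorphic_on UNIV"
proof -
  have "((\<lambda>w. - exp (- w)) has_field_derivative exp (- 0)) (at (0::complex))"
    by (auto intro!: derivative_eq_intros)
  then have d: "deriv (\<lambda>w. - exp (- w)) (0::complex) = 1"
    by (simp add: DERIV_imp_deriv)
  have "(\<lambda>z. if z = 0 then deriv (\<lambda>w. - exp (- w)) 0 else (- exp (- z) - - exp (- 0)) / (z - 0)) holomorphic_on (UNIV :: complex set)"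
    by (rule pole_lemma) (auto intro!: holomorphic_intros)
  also have "(\<lambda>z. if z = 0 then deriv (\<lambda>w. - exp (- w)) 0 else (- exp (- z) - - exp (- 0)) / (z - 0)) = exq"
    by (rule ext) (simp add: exq_def d)
  finally show ?thesis .
qed

lemma exq_compose_power [holomorphic_intros]: "(\<lambda>z. exq (z ^ k)) holomorphic_on A"
proof -
  have "(exq \<circ> (\<lambda>z. z ^ k)) holomorphic_on A"
    by (rule holomorphic_on_compose_gen [OF _ holomorphic_exq]) (auto intro!: holomorphic_intros)
  then show ?thesis
    by (simp add: o_def)
qed

lemma Re_exq_pos:
  assumes "norm w \<le> 1 / 2"
  shows "Re (exq w) > 0"
proof (cases "w = 0")
  case False
  have "norm (exp (- w) - (\<Sum>k\<le>1. (- w) ^ k / fact k)) \<le> exp \<bar>Re (- w)\<bar> * norm (- w) ^ Suc 1 / fact 1"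
    by (rule Taylor_exp)
  then have "norm (exp (- w) - 1 + w) \<le> exp \<bar>Re w\<bar> * norm w ^ 2"
    by (simp add: power2_eq_square algebra_simps)
  also have "\<dots> \<le> exp (1 / 2) * norm w ^ 2"
    using assms abs_Re_le_cmod [of w] by (intro mult_right_mono) auto
  \<comment> \<open>Any constant below 2 would do, as |w| is at most 1/2 and |\<open>exq\<close> w -
    1| < 1 is wanted; 9/5 works because its square 3.24 exceeds 3, a bound for e.\<close>
  also have "\<dots> \<le> (9 / 5) * norm w ^ 2"
  proof (intro mult_right_mono)
    have "exp (1 / 2 :: real) ^ 2 = exp 1"
      by (simp flip: exp_double)
    also have "\<dots> \<le> 3"
      by (rule exp_le)
    also have "\<dots> \<le> (9 / 5) ^ 2"
      by (simp add: power2_eq_square)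
    finally show "exp (1 / 2 :: real) \<le> 9 / 5"
      by (rule power2_le_imp_le) simp
  qed simp
  finally have n: "norm (exp (- w) - 1 + w) \<le> (9 / 5) * norm w ^ 2" .
  have "exq w - 1 = - (exp (- w) - 1 + w) / w"
    using False by (simp add: exq_def field_simps)
  then have "norm (exq w - 1) = norm (exp (- w) - 1 + w) / norm w"
    by (simp only: norm_divide norm_minus_cancel)
  also have "\<dots> \<le> (9 / 5) * norm w ^ 2 / norm w"
    using n by (intro divide_right_mono) auto
  also have "\<dots> < 1"
    using False assms by (simp add: power2_eq_square)
  finally have "norm (exq w - 1) < 1" .
  then show ?thesis
    using abs_Re_le_cmod [of "exq w - 1"] by simp
qed simp

text \<open>If \<open>exq w\<close> were a real number a at most 0, then 1 - Re(exp(-w)) = a Re w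
  would be at most 0, contradicting |exp(-w)| < 1.\<close>

lemma exq_nonpos_Reals:
  assumes "Re w > 0"
  shows "exq w \<notin> \<real>\<^sub>\<le>\<^sub>0"
proof
  assume "exq w \<in> \<real>\<^sub>\<le>\<^sub>0"
  then obtain a where a: "exq w = of_real a" "a \<le> 0"
    by (auto elim: nonpos_Reals_cases)
  have "1 - exp (- w) = of_real a * w"
    using exq_mult [of w] a by simp
  then have "Re (1 - exp (- w)) = Re (of_real a * w)"
    by (simp only:)
  then have "1 - Re (exp (- w)) = a * Re w"
    by simp
  moreover have "Re (exp (- w)) < 1"
  proof -
    have "Re (exp (- w)) \<le> exp (- Re w)"
      using complex_Re_le_cmod [of "exp (- w)"] by simp
    then show ?thesis
      using assms by (simp add: less_le_trans le_less_trans)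
  qed
  moreover have "a * Re w \<le> 0"
    using a assms by (simp add: mult_nonpos_nonneg)
  ultimately show False
    by linarith
qed

lemma Im_Ln_less_pi_half: "Re z > 0 \<Longrightarrow> \<bar>Im (Ln z)\<bar> < pi / 2"
  using Re_Ln_pos_lt [of z] by (metis less_numeral_extra(3) zero_complex.simps(1))

lemma Re_one_minus_exp_pos:
  assumes "Re w > 0"
  shows "Re (1 - exp (- w)) > 0"
proof -
  have "Re (exp (- w)) \<le> exp (- Re w)"
    using complex_Re_le_cmod [of "exp (- w)"] by simp
  also have "\<dots> < 1"
    using assms by simp
  finally show ?thesis
    by simp
qed

text \<open>Both arguments lie in the right half-plane, so the imaginary parts of the two logarithms
  are below pi/2 and their difference is still principal.\<close>

lemma Ln_exq:
  assumes "Re w > 0"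
  shows "Ln (exq w) = Ln (1 - exp (- w)) - Ln w"
proof (rule Ln_unique)
  have w: "w \<noteq> 0"
    using assms by auto
  have "1 - exp (- w) \<noteq> 0"
    using Re_one_minus_exp_pos [OF assms] by auto
  then show "exp (Ln (1 - exp (- w)) - Ln w) = exq w"
    using w by (simp add: exp_diff exq_def)
  have "\<bar>Im (Ln (1 - exp (- w)))\<bar> < pi / 2" "\<bar>Im (Ln w)\<bar> < pi / 2"
    using assms Re_one_minus_exp_pos [OF assms] Im_Ln_less_pi_half by blast+
  then show "- pi < Im (Ln (1 - exp (- w)) - Ln w)" "Im (Ln (1 - exp (- w)) - Ln w) \<le> pi"
    by (auto simp: abs_less_iff)
qed

lemma norm_Ln_1p_le:
  assumes "Re w \<ge> 0"
  shows "norm (Ln (1 + w)) \<le> norm w"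
proof -
  have "norm (Ln (1 + w) - Ln (1 + 0)) \<le> 1 * norm (w - 0)"
  proof (rule field_differentiable_bound [where S = "{z. Re z \<ge> 0}" and f' = "\<lambda>z. 1 / (1 + z)"])
    show "convex {z. 0 \<le> Re z}"
      by (rule convex_halfspace_Re_ge)
    fix z :: complex assume z: "z \<in> {z. 0 \<le> Re z}"
    then have "1 + z \<notin> \<real>\<^sub>\<le>\<^sub>0"
      by (auto simp: complex_nonpos_Reals_iff)
    then show "((\<lambda>z. Ln (1 + z)) has_field_derivative 1 / (1 + z)) (at z within {z. 0 \<le> Re z})"
      by (auto intro!: derivative_eq_intros simp: field_simps)
    have "1 \<le> norm (1 + z)"
      using z complex_Re_le_cmod [of "1 + z"] by simp
    then show "norm (1 / (1 + z)) \<le> 1"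
      by (simp add: norm_divide divide_le_eq)
  qed (use assms in auto)
  then show ?thesis
    by simp
qed

lemma abs_arctan_le: "\<bar>arctan x\<bar> \<le> \<bar>x\<bar>"
  using arctan_le_self [of "\<bar>x\<bar>"] by (cases "x \<ge> 0") (auto simp: arctan_minus)

text \<open>The argument of z is at most 1/(3k), hence that of z^k at most 1/3 < pi/3: no branch is
  crossed and the cosine is at least 1/2.\<close>

lemma narrow_cone_power:
  assumes k: "k \<ge> 1" and z: "Re z > 0" "\<bar>Im z\<bar> \<le> Re z / (3 * real k)"
  shows "\<bar>Im (Ln z)\<bar> \<le> 1 / (3 * real k)" "Ln (z ^ k) = of_nat k * Ln z" "Re (z ^ k) \<ge> norm z ^ k / 2"
proof -
  have z0: "z \<noteq> 0"
    using z by auto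
  have "Im (Ln z) = arctan (Im z / Re z)"
    using z z0 by (metis Arg_eq_Im_Ln arg_conv_arctan)
  then have "\<bar>Im (Ln z)\<bar> \<le> \<bar>Im z / Re z\<bar>"
    by (simp only: abs_arctan_le)
  also have "\<dots> \<le> 1 / (3 * real k)"
    using z k by (simp add: abs_divide field_simps)
  finally show 1: "\<bar>Im (Ln z)\<bar> \<le> 1 / (3 * real k)" .
  have im: "\<bar>Im (of_nat k * Ln z)\<bar> \<le> 1 / 3"
    using 1 k by (simp add: abs_mult field_simps)
  have e: "exp (of_nat k * Ln z) = z ^ k"
    using z0 by (simp add: exp_of_nat_mult)
  show "Ln (z ^ k) = of_nat k * Ln z"
    using pi_gt3 im by (intro Ln_unique e) (auto simp: abs_le_iff)
  have "Re (z ^ k) = exp (Re (of_nat k * Ln z)) * cos (Im (of_nat k * Ln z))"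
    by (simp flip: e add: Re_exp)
  moreover have "exp (Re (of_nat k * Ln z)) = norm z ^ k"
    using z0 by (simp add: exp_of_nat_mult)
  moreover have "cos (Im (of_nat k * Ln z)) \<ge> 1 / 2"
  proof -
    have "cos (pi / 3) \<le> cos \<bar>Im (of_nat k * Ln z)\<bar>"
      using im pi_gt3 by (intro cos_monotone_0_pi_le) auto
    then show ?thesis
      by (simp add: cos_60)
  qed
  ultimately show "Re (z ^ k) \<ge> norm z ^ k / 2"
    using mult_left_mono [of "1 / 2" "cos (Im (of_nat k * Ln z))" "norm z ^ k"] by simp
qed

lemma Re_one_over_pos:
  assumes "Re z > 0"
  shows "Re (1 / z) > 0"
proof -
  have "0 < (Re z) ^ 2 + (Im z) ^ 2"
    using assms by (intro add_pos_nonneg) auto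
  then show ?thesis
    using assms by (simp add: Re_divide)
qed

lemma Re_square_pos:
  assumes "Re z > 0" "\<bar>Im z\<bar> < Re z"
  shows "Re (z ^ 2) > 0"
  using assms power_strict_mono [of "\<bar>Im z\<bar>" "Re z" 2] by (simp add: power2_eq_square Re_power2)

text \<open>The principal logarithms of \<open>1 - exp (- z\<^sup>k)\<close> and \<open>1 + z\<^sup>-\<^sup>2\<close> are regrouped here so that the function is
  visibly holomorphic at \<open>0\<close>.\<close>

definition em_fun :: "nat \<Rightarrow> complex \<Rightarrow> complex" where
  "em_fun k z = - Ln (exq (z ^ k)) - of_real (real k / 2) * Ln (1 + z ^ 2)"

lemma em_fun_0 [simp]: "k \<ge> 1 \<Longrightarrow> em_fun k 0 = 0"
  by (simp add: em_fun_def power_0_left)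

lemma em_fun_regular:
  assumes k: "k \<ge> 2" and z: "norm z ^ 2 < 1 / 2 \<or> Re z > 0 \<and> \<bar>Im z\<bar> \<le> Re z / (3 * real k)"
  shows "exq (z ^ k) \<notin> \<real>\<^sub>\<le>\<^sub>0" "1 + z ^ 2 \<notin> \<real>\<^sub>\<le>\<^sub>0"
proof -
  have "exq (z ^ k) \<notin> \<real>\<^sub>\<le>\<^sub>0 \<and> Re (1 + z ^ 2) > 0"
  proof (cases "norm z ^ 2 < 1 / 2")
    case True
    have "norm z \<le> 1"
      using True by (intro power2_le_imp_le [of "norm z" 1]) auto
    then have "norm z ^ k \<le> norm z ^ 2"
      using k by (intro power_decreasing) auto
    then have "norm (z ^ k) \<le> 1 / 2"
      using True by (simp add: norm_power)
    then have "Re (exq (z ^ k)) > 0"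
      by (rule Re_exq_pos)
    moreover have "\<bar>Re (z ^ 2)\<bar> < 1 / 2"
      using abs_Re_le_cmod [of "z ^ 2"] True by (simp add: norm_power)
    ultimately show ?thesis
      by (auto simp: complex_nonpos_Reals_iff)
  next
    case False
    then have z': "Re z > 0" "\<bar>Im z\<bar> \<le> Re z / (3 * real k)"
      using z by auto
    have "norm z ^ k > 0"
      using z' by (metis less_irrefl zero_complex.sel(1) zero_less_norm_iff zero_less_power)
    then have "Re (z ^ k) > 0"
      using narrow_cone_power(3) [of k z] z' k by auto
    moreover have "Re z / (3 * real k) < Re z / 1"
      using k z' by (intro divide_strict_left_mono) auto
    then have "Re (z ^ 2) > 0"
      using z' by (intro Re_square_pos) auto
    ultimately show ?thesis
      using exq_nonpos_Reals by simp
  qed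
  then show "exq (z ^ k) \<notin> \<real>\<^sub>\<le>\<^sub>0" "1 + z ^ 2 \<notin> \<real>\<^sub>\<le>\<^sub>0"
    by (auto simp: complex_nonpos_Reals_iff)
qed

lemma holomorphic_em_fun:
  assumes "k \<ge> 2" "\<And>z. z \<in> A \<Longrightarrow> norm z ^ 2 < 1 / 2 \<or> Re z > 0 \<and> \<bar>Im z\<bar> \<le> Re z / (3 * real k)"
  shows "em_fun k holomorphic_on A"
  unfolding em_fun_def [abs_def]
  by (intro holomorphic_intros) (use em_fun_regular [OF assms(1) assms(2)] in auto)

text \<open>Away from 0 the regrouping is undone: both \<open>Ln (exq (z ^ k))\<close> and (k/2)
  Ln(1 + z^2) release a term k Ln z, and these cancel.\<close>

lemma em_fun_eq:
  assumes k: "k \<ge> 2" and z: "Re z > 0" "\<bar>Im z\<bar> \<le> Re z / (3 * real k)"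
  shows "em_fun k z = - Ln (1 - exp (- (z ^ k))) - of_real (real k / 2) * Ln (1 + 1 / z ^ 2)"
    and "Re (1 / z ^ 2) > 0"
proof -
  have z0: "z \<noteq> 0"
    using z by auto
  have k1: "k \<ge> 1"
    using k by simp
  note nc = narrow_cone_power [OF k1 z]
  have "Re (z ^ k) > 0"
    using nc(3) z0 by (smt (verit) zero_less_norm_iff zero_less_power half_gt_zero)
  then have 1: "Ln (exq (z ^ k)) = Ln (1 - exp (- (z ^ k))) - of_nat k * Ln z"
    by (simp add: Ln_exq nc(2))
  have "Re z / (3 * real k) < Re z / 1"
    using k z by (intro divide_strict_left_mono) auto
  then have "Re (z ^ 2) > 0"
    using z by (intro Re_square_pos) auto
  then show R: "Re (1 / z ^ 2) > 0"
    by (rule Re_one_over_pos)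
  have "1 / (3 * real k) \<le> 1 / 6"
    using k by (simp add: field_simps)
  then have i1: "\<bar>Im (Ln z)\<bar> \<le> 1 / 6"
    using nc(1) by linarith
  have "Re (1 + 1 / z ^ 2) > 0"
    using R by simp
  then have i2: "\<bar>Im (Ln (1 + 1 / z ^ 2))\<bar> < pi / 2" "1 + 1 / z ^ 2 \<noteq> 0"
    using Im_Ln_less_pi_half by (blast, metis less_irrefl zero_complex.sel(1))
  have 2: "Ln (1 + z ^ 2) = Ln (1 + 1 / z ^ 2) + 2 * Ln z"
  proof (rule Ln_unique)
    have "exp (Ln (1 + 1 / z ^ 2) + 2 * Ln z) = (1 + 1 / z ^ 2) * z ^ 2"
      using i2(2) z0 by (simp add: exp_add exp_double)
    also have "\<dots> = 1 + z ^ 2"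
      using z0 by (simp add: field_simps)
    finally show "exp (Ln (1 + 1 / z ^ 2) + 2 * Ln z) = 1 + z ^ 2" .
    have "\<bar>Im (Ln (1 + 1 / z ^ 2) + 2 * Ln z)\<bar> < pi"
      using i1 i2(1) pi_gt3 by auto
    then show "- pi < Im (Ln (1 + 1 / z ^ 2) + 2 * Ln z)" "Im (Ln (1 + 1 / z ^ 2) + 2 * Ln z) \<le> pi"
      by linarith+
  qed
  show "em_fun k z = - Ln (1 - exp (- (z ^ k))) - of_real (real k / 2) * Ln (1 + 1 / z ^ 2)"
    unfolding em_fun_def 1 2 by (simp add: algebra_simps)
qed

text \<open>A sector with its vertex moved to -1/8. It is open and convex, so holomorphic functions
  have primitives on it, and it contains a disc of fixed radius about every point of the sector of
  aperture 1/(8k), its vertex 0 included, as Cauchy's inequality demands.\<close>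

definition em_dom :: "nat \<Rightarrow> complex set" where
  "em_dom k = {z. \<bar>Im z\<bar> < (Re z + 1 / 8) / (4 * real k)}"

text \<open>For Re z at least 1/2 the shift by 1/8 enlarges the aperture by a factor of at most 4/3,
  from 1/(4k) to 1/(3k). Otherwise |z|^2 is at most 1/4 + 1/16.\<close>

lemma em_dom_cases:
  assumes k: "k \<ge> 2" and z: "\<bar>Im z\<bar> \<le> (Re z + 1 / 8) / (4 * real k)"
  shows "norm z ^ 2 < 1 / 2 \<or> Re z > 0 \<and> \<bar>Im z\<bar> \<le> Re z / (3 * real k)"
proof (cases "Re z \<ge> 1 / 2")
  case True
  have "(Re z + 1 / 8) / (4 * real k) \<le> (Re z * (4 / 3)) / (4 * real k)"
    using True by (intro divide_right_mono) auto
  also have "\<dots> = Re z / (3 * real k)"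
    by simp
  finally show ?thesis
    using z True by auto
next
  case False
  have "0 \<le> (Re z + 1 / 8) / (4 * real k)"
    using z by linarith
  then have "Re z + 1 / 8 \<ge> 0"
    using k by (simp add: zero_le_divide_iff)
  then have "\<bar>Re z\<bar> \<le> 1 / 2"
    using False by linarith
  have "(Re z + 1 / 8) / (4 * real k) \<le> (1 / 2 + 1 / 8) / (4 * 2)"
    using False k \<open>Re z + 1 / 8 \<ge> 0\<close> by (intro frac_le) auto
  then have "\<bar>Im z\<bar> \<le> 1 / 4"
    using z by argo
  have "norm z ^ 2 = \<bar>Re z\<bar> ^ 2 + \<bar>Im z\<bar> ^ 2"
    by (simp add: cmod_power2)
  also have "\<dots> \<le> (1 / 2) ^ 2 + (1 / 4) ^ 2"
    using \<open>\<bar>Re z\<bar> \<le> 1 / 2\<close> \<open>\<bar>Im z\<bar> \<le> 1 / 4\<close> by (intro add_mono power_mono) auto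
  also have "\<dots> < 1 / 2"
    by (simp add: power2_eq_square)
  finally show ?thesis
    by simp
qed

lemma em_dom_open_convex:
  assumes "k \<ge> 1"
  shows "open (em_dom k)" "convex (em_dom k)"
proof -
  have e: "em_dom k = {z. inner (Complex (- 1) (4 * real k)) z < 1 / 8} \<inter> {z. inner (Complex (- 1) (- 4 * real k)) z < 1 / 8}"
    using assms by (auto simp: em_dom_def inner_complex_def field_simps abs_less_iff)
  show "open (em_dom k)"
    unfolding e by (intro open_Int open_halfspace_lt)
  show "convex (em_dom k)"
    unfolding e by (intro convex_Int convex_halfspace_lt)
qed

lemma cball_subset_em_dom:
  assumes k: "k \<ge> 2" and z: "z \<in> csector (1 / (8 * real k))"
  shows "cball z (1 / (64 * real k)) \<subseteq> em_dom k"
proof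
  fix w assume w: "w \<in> cball z (1 / (64 * real k))"
  \<comment> \<open>In terms of r the sector has aperture 8r and the domain 16r.\<close>
  define r where "r = 1 / (64 * real k)"
  have r: "0 < r" "r \<le> 1 / 128"
    using k by (auto simp: r_def field_simps)
  have d: "\<bar>Im w - Im z\<bar> \<le> r" "\<bar>Re w - Re z\<bar> \<le> r"
    using w abs_Im_le_cmod [of "w - z"] abs_Re_le_cmod [of "w - z"]
    by (auto simp: dist_norm norm_minus_commute r_def)
  have Rz: "Re z \<ge> 0"
    by (rule csector_Re_nonneg [OF z]) (use k in auto)
  have "\<bar>Im z\<bar> \<le> Re z / (8 * real k)"
    using z by (simp add: csector_def)
  then have "\<bar>Im z\<bar> \<le> 8 * r * Re z"
    by (simp add: r_def)
  then have 1: "\<bar>Im w\<bar> \<le> 8 * r * Re z + r"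
    using d by linarith
  have "16 * r * (Re z - r + 1 / 8) \<le> 16 * r * (Re w + 1 / 8)"
    using d r by (intro mult_left_mono) auto
  moreover have "8 * r * Re z + r < 16 * r * (Re z - r + 1 / 8)"
  proof -
    have "0 < r * (8 * Re z + 1 - 16 * r)"
      using r Rz by (intro mult_pos_pos) auto
    then show ?thesis
      by (simp add: algebra_simps)
  qed
  ultimately have "\<bar>Im w\<bar> < 16 * r * (Re w + 1 / 8)"
    using 1 by linarith
  then show "w \<in> em_dom k"
    by (simp add: em_dom_def r_def)
qed

text \<open>On the compact part the function is bounded by continuity. Far out it is described by
  \<open>em_fun_eq\<close>, where exp(-z^k) is negligible and Ln(1 + z^-2) has quadratic
  decay.\<close>

lemma em_fun_bound:
  assumes k: "k \<ge> 2"
  shows "\<exists>C. \<forall>z\<in>em_dom k. norm (em_fun k z) \<le> C / (1 + norm z) ^ 2"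
proof -
  define D where "D = {z. \<bar>Im z\<bar> \<le> (Re z + 1 / 8) / (4 * real k)} \<inter> cball 0 2"
  have "closed {z. \<bar>Im z\<bar> \<le> (Re z + 1 / 8) / (4 * real k)}"
    by (intro closed_Collect_le continuous_intros) (use k in auto)
  then have "compact D"
    by (auto simp: D_def intro: closed_Int_compact)
  moreover have "continuous_on D (em_fun k)"
    by (intro holomorphic_on_imp_continuous_on holomorphic_em_fun [OF k] em_dom_cases [OF k]) (auto simp: D_def)
  ultimately have "bounded (em_fun k ` D)"
    by (intro compact_imp_bounded compact_continuous_image)
  then obtain B where B: "\<And>z. z \<in> D \<Longrightarrow> norm (em_fun k z) \<le> B"
    unfolding bounded_iff by auto
  have B0: "B \<ge> 0"
    using order_trans [OF norm_ge_zero B [of 0]] by (simp add: D_def)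
  \<comment> \<open>The 9 is (1 + |z|)^2 at |z| = 2; the 9/4 comes from |z| being at least (2/3)(1 +
    |z|) for |z| > 2.\<close>
  define C where "C = max (9 * B) (9 / 4 * (4 + real k))"
  show ?thesis
  proof (intro exI [of _ C] ballI)
    fix z assume z: "z \<in> em_dom k"
    have p: "(1 + norm z) ^ 2 > 0"
      by (intro zero_less_power add_pos_nonneg) auto
    show "norm (em_fun k z) \<le> C / (1 + norm z) ^ 2"
    proof (cases "norm z \<le> 2")
      case True
      then have "norm (em_fun k z) \<le> B"
        using z by (intro B) (auto simp: D_def em_dom_def)
      moreover have "(1 + norm z) ^ 2 \<le> 3 ^ 2"
        using True by (intro power_mono) auto
      then have "B * (1 + norm z) ^ 2 \<le> B * 3 ^ 2"
        using B0 by (intro mult_left_mono) auto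
      then have "B \<le> C / (1 + norm z) ^ 2"
        using p by (simp add: C_def pos_le_divide_eq)
      ultimately show ?thesis
        by linarith
    next
      case False
      then have nz: "norm z > 2"
        by simp
      then have "norm z ^ 2 > 2 ^ 2"
        by (intro power_strict_mono) auto
      then have z': "Re z > 0" "\<bar>Im z\<bar> \<le> Re z / (3 * real k)"
        using em_dom_cases [OF k, of z] z by (auto simp: em_dom_def)
      have "norm z ^ 2 \<le> norm z ^ k"
        using k nz by (intro power_increasing) auto
      then have Rk: "Re (z ^ k) \<ge> norm z ^ 2 / 2"
        using narrow_cone_power(3) [of k z] z' k by auto
      have ex: "norm (exp (- (z ^ k))) \<le> 2 / norm z ^ 2"
      proof -
        have "norm (exp (- (z ^ k))) \<le> exp (- (norm z ^ 2 / 2))"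
          using Rk by simp
        also have "\<dots> = 1 / exp (norm z ^ 2 / 2)"
          by (simp only: exp_minus inverse_eq_divide)
        also have "\<dots> \<le> 1 / (norm z ^ 2 / 2)"
        proof (rule divide_left_mono)
          show "norm z ^ 2 / 2 \<le> exp (norm z ^ 2 / 2)"
            using exp_ge_add_one_self [of "norm z ^ 2 / 2"] by linarith
          have "norm z \<noteq> 0"
            using nz by linarith
          then show "0 < exp (norm z ^ 2 / 2) * (norm z ^ 2 / 2)"
            by simp
        qed simp
        finally show ?thesis
          by simp
      qed
      also have "2 / norm z ^ 2 < 1 / 2"
        using \<open>norm z ^ 2 > 2 ^ 2\<close> by (simp add: divide_less_eq)
      finally have ex2: "norm (- exp (- (z ^ k))) < 1 / 2"
        by simp
      have "norm (em_fun k z) \<le> norm (Ln (1 - exp (- (z ^ k)))) + norm (of_real (real k / 2) * Ln (1 + 1 / z ^ 2))"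
        unfolding em_fun_eq(1) [OF k z'] using norm_triangle_ineq4 [of "- Ln (1 - exp (- (z ^ k)))"]
        by (metis norm_minus_cancel)
      also have "\<dots> = norm (Ln (1 + - exp (- (z ^ k)))) + real k / 2 * norm (Ln (1 + 1 / z ^ 2))"
        by (simp add: norm_mult norm_divide)
      also have "\<dots> \<le> 2 * (2 / norm z ^ 2) + real k / 2 * norm (1 / z ^ 2)"
        using norm_Ln_le [OF ex2] ex norm_Ln_1p_le [of "1 / z ^ 2"] em_fun_eq(2) [OF k z']
        by (intro add_mono mult_left_mono) auto
      also have "\<dots> = (4 + real k / 2) / norm z ^ 2"
        by (simp add: norm_divide norm_power add_divide_distrib)
      also have "\<dots> \<le> (4 + real k) / norm z ^ 2"
        by (intro divide_right_mono) auto
      also have "\<dots> \<le> (4 + real k) / (2 / 3 * (1 + norm z)) ^ 2"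
        using nz by (intro divide_left_mono power_mono mult_pos_pos zero_less_power) (auto simp: add_pos_nonneg)
      also have "\<dots> = 9 / 4 * (4 + real k) / (1 + norm z) ^ 2"
      proof -
        have "(4 + real k) / (2 / 3 * s) ^ 2 = 9 / 4 * (4 + real k) / s ^ 2" for s :: real
          by (simp add: power_mult_distrib power2_eq_square)
        then show ?thesis .
      qed
      also have "\<dots> \<le> C / (1 + norm z) ^ 2"
        by (intro divide_right_mono) (auto simp: C_def)
      finally show ?thesis .
    qed
  qed
qed

text \<open>From \<open>exq\<close> (-w) = e^w \<open>exq\<close> w, the difference of the values at
  z and -z is z^k for odd k and 0 for even k. An odd derivative at 0 is half the corresponding
  derivative of this difference.\<close>

lemma em_fun_odd_deriv:
  assumes k: "k \<ge> 2" and n: "odd n"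
  shows "(deriv ^^ n) (em_fun k) 0 = (if n = k then fact k / 2 else 0)"
proof -
  let ?B = "ball (0::complex) (1 / 2)"
  have small: "norm z ^ 2 < 1 / 2" "norm (z ^ k) \<le> 1 / 2" if "z \<in> ?B" for z
  proof -
    have "norm z ^ 2 \<le> (1 / 2) ^ 2"
      using that by (intro power_mono) auto
    then show "norm z ^ 2 < 1 / 2"
      by (simp add: power2_eq_square)
    have "norm z ^ k \<le> norm z ^ 2"
      using that k by (intro power_decreasing) auto
    then show "norm (z ^ k) \<le> 1 / 2"
      using \<open>norm z ^ 2 < 1 / 2\<close> by (simp add: norm_power)
  qed
  have hol: "em_fun k holomorphic_on ?B"
    using small by (intro holomorphic_em_fun [OF k]) auto
  have hol': "(\<lambda>z. em_fun k (- 1 * z)) holomorphic_on ?B"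
  proof -
    have "(em_fun k \<circ> (\<lambda>z. - 1 * z)) holomorphic_on ?B"
      by (rule holomorphic_on_compose_gen [OF _ hol]) (auto intro!: holomorphic_intros)
    then show ?thesis
      by (simp add: o_def)
  qed
  have diff: "em_fun k z - em_fun k (- 1 * z) = (if odd k then z ^ k else 0)" if z: "z \<in> ?B" for z
  proof (cases "even k")
    case False
    define w where "w = z ^ k"
    have w: "norm w \<le> 1 / 2"
      using small [OF z] by (simp add: w_def)
    have 1: "(- 1 * z) ^ k = - w"
      using False by (simp add: w_def)
    have 2: "(- 1 * z) ^ 2 = z ^ 2"
      by simp
    have "exp (w + Ln (exq w)) = exq (- w)"
    proof -
      have "exq w \<noteq> 0"
        using Re_exq_pos [OF w] by auto
      then have "exp (w + Ln (exq w)) = exp w * exq w"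
        by (simp add: exp_add)
      also have "\<dots> = exq (- w)"
        by (simp add: exq_def exp_minus field_simps)
      finally show ?thesis .
    qed
    then have "Ln (exq (- w)) = w + Ln (exq w)"
    proof (rule Ln_unique)
      have "\<bar>Im w\<bar> \<le> 1 / 2"
        using w abs_Im_le_cmod [of w] by linarith
      moreover have "\<bar>Im (Ln (exq w))\<bar> < pi / 2"
        by (rule Im_Ln_less_pi_half [OF Re_exq_pos [OF w]])
      ultimately have "\<bar>Im (w + Ln (exq w))\<bar> < pi"
        using pi_gt3 by auto
      then show "- pi < Im (w + Ln (exq w))" "Im (w + Ln (exq w)) \<le> pi"
        by linarith+
    qed
    then show ?thesis
      using False unfolding em_fun_def 1 2 w_def [symmetric] by simp
  qed (simp add: em_fun_def)
  have "(deriv ^^ n) (\<lambda>z. em_fun k z - em_fun k (- 1 * z)) 0 = (deriv ^^ n) (\<lambda>z. if odd k then z ^ k else 0) 0"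
  proof (rule higher_deriv_cong_ev)
    have "eventually (\<lambda>z. z \<in> ?B) (nhds 0)"
      by (intro eventually_nhds_in_open) auto
    then show "\<forall>\<^sub>F z in nhds 0. em_fun k z - em_fun k (- 1 * z) = (if odd k then z ^ k else 0)"
      by (rule eventually_mono) (rule diff)
  qed simp
  moreover have "(deriv ^^ n) (\<lambda>z. em_fun k z - em_fun k (- 1 * z)) 0 = (deriv ^^ n) (em_fun k) 0 - (deriv ^^ n) (\<lambda>z. em_fun k (- 1 * z)) 0"
    by (rule higher_deriv_diff [OF hol hol']) auto
  moreover have "(deriv ^^ n) (\<lambda>z. em_fun k (- 1 * z)) 0 = (- 1) ^ n * (deriv ^^ n) (em_fun k) (- 1 * 0)"
    by (rule higher_deriv_compose_linear [OF hol, of ?B]) auto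
  moreover have "(deriv ^^ n) (\<lambda>z. if odd k then z ^ k else 0) 0 = (if n = k then fact k else 0 :: complex)"
  proof (cases "odd k")
    case True
    have "(deriv ^^ n) (\<lambda>z::complex. z ^ k) 0 = fps_nth (fps_X ^ k) n * fact n"
      by (subst fps_nth_fps_expansion [OF has_fps_expansion_fps_X_power]) simp
    then show ?thesis
      using True by (simp add: fps_X_power_nth)
  next
    case False
    then have "n \<noteq> k"
      using n by auto
    moreover have "(deriv ^^ n) (\<lambda>z::complex. 0) 0 = 0"
      by (simp add: higher_deriv_const)
    ultimately show ?thesis
      using False by simp
  qed
  ultimately show ?thesis
    using n by auto
qed

text \<open>The product of 1 + 1/(m t)^2 is that of the sine at the point i pi/t, so both sides have
  the same exponential. They differ by an integer multiple of 2 pi i, which is continuous along the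
  segment from t to 1 and therefore constant, and it is 0 at t = 1.\<close>

lemma sum_Ln_inverse_squares:
  assumes t: "Re t > 0" "\<bar>Im t\<bar> < Re t"
  shows "summable (\<lambda>m. Ln (1 + 1 / (of_nat (Suc m) * t) ^ 2))"
    and "(\<Sum>m. Ln (1 + 1 / (of_nat (Suc m) * t) ^ 2)) =
       of_real pi / t + Ln t - of_real (ln (2 * pi)) + Ln (1 - exp (- (of_real (2 * pi) / t)))"
proof -
  define W where "W = {t. Re t > 0 \<and> \<bar>Im t\<bar> < Re t}"
  have W0: "s \<noteq> 0" if "s \<in> W" for s
    using that by (auto simp: W_def)
  have Re_sq: "Re (1 / (of_nat (Suc m) * s) ^ 2) > 0" if "s \<in> W" for s m
  proof -
    have "Re (s ^ 2) > 0"
      using that by (intro Re_square_pos) (auto simp: W_def)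
    then have "0 < 1 / real (Suc m) ^ 2 * Re (1 / s ^ 2)"
      by (intro mult_pos_pos Re_one_over_pos) auto
    also have "\<dots> = Re (of_real (1 / real (Suc m) ^ 2) * (1 / s ^ 2))"
      by (simp only: Re_complex_of_real Im_complex_of_real times_complex.sel mult_zero_left diff_0_right)
    also have "of_real (1 / real (Suc m) ^ 2) * (1 / s ^ 2) = 1 / (of_nat (Suc m) * s) ^ 2"
      by (simp add: power_mult_distrib)
    finally show ?thesis .
  qed
  have term_bound: "norm (Ln (1 + 1 / (of_nat (Suc m) * s) ^ 2)) \<le> (1 / \<delta> ^ 2) * (1 / real (Suc m) ^ 2)"
    if "s \<in> W" "norm s \<ge> \<delta>" "\<delta> > 0" for s m \<delta>
  proof -
    have "norm (Ln (1 + 1 / (of_nat (Suc m) * s) ^ 2)) \<le> norm (1 / (of_nat (Suc m) * s) ^ 2)"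
      using Re_sq [OF that(1), of m] by (intro norm_Ln_1p_le) auto
    also have "\<dots> = (1 / norm s ^ 2) * (1 / real (Suc m) ^ 2)"
      by (simp add: norm_divide norm_power norm_mult power_mult_distrib del: of_nat_Suc)
    also have "\<dots> \<le> (1 / \<delta> ^ 2) * (1 / real (Suc m) ^ 2)"
      using that by (intro mult_right_mono divide_left_mono power_mono mult_pos_pos zero_less_power) auto
    finally show ?thesis .
  qed
  have sq: "summable (\<lambda>m. 1 / real (Suc m) ^ 2)"
    using inverse_power_summable [of 2, where 'a = real] by (subst summable_Suc_iff) (simp add: field_simps)
  have summ: "summable (\<lambda>m. Ln (1 + 1 / (of_nat (Suc m) * s) ^ 2))" if "s \<in> W" for s
  proof (rule summable_comparison_test')
    show "summable (\<lambda>m. (1 / norm s ^ 2) * (1 / real (Suc m) ^ 2))"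
      by (intro summable_mult sq)
    show "norm (Ln (1 + 1 / (of_nat (Suc m) * s) ^ 2)) \<le> (1 / norm s ^ 2) * (1 / real (Suc m) ^ 2)" for m
      using term_bound [OF that order_refl] W0 [OF that] by simp
  qed
  have tW: "t \<in> W"
    using t by (simp add: W_def)
  show "summable (\<lambda>m. Ln (1 + 1 / (of_nat (Suc m) * t) ^ 2))"
    by (rule summ [OF tW])
  define Q where "Q s = (\<Sum>m. Ln (1 + 1 / (of_nat (Suc m) * s) ^ 2))" for s :: complex
  define P where "P s = of_real pi / s + Ln s - of_real (ln (2 * pi)) + Ln (1 - exp (- (of_real (2 * pi) / s)))" for s :: complex
  have Re_inv: "Re (of_real (2 * pi) / s) > 0" if "s \<in> W" for s
  proof -
    have "0 < 2 * pi * Re (1 / s)"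
      using that by (intro mult_pos_pos Re_one_over_pos) (auto simp: W_def)
    also have "\<dots> = Re (of_real (2 * pi) * (1 / s))"
      by (simp only: Re_complex_of_real Im_complex_of_real times_complex.sel mult_zero_left diff_0_right)
    finally show ?thesis
      by simp
  qed
  have exp_QP: "exp (Q s) = exp (P s)" if s: "s \<in> W" for s
  proof -
    have s0: "s \<noteq> 0"
      by (rule W0 [OF s])
    have "(\<lambda>M. exp (\<Sum>m<M. Ln (1 + 1 / (of_nat (Suc m) * s) ^ 2))) \<longlonglongrightarrow> exp (Q s)"
      unfolding Q_def by (intro tendsto_intros summable_LIMSEQ summ s)
    also have "(\<lambda>M. exp (\<Sum>m<M. Ln (1 + 1 / (of_nat (Suc m) * s) ^ 2))) = (\<lambda>M. \<Prod>k=1..M. 1 - (\<i> / s) ^ 2 / of_nat k ^ 2)"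
    proof
      fix M
      have "exp (\<Sum>m<M. Ln (1 + 1 / (of_nat (Suc m) * s) ^ 2)) = (\<Prod>m<M. exp (Ln (1 + 1 / (of_nat (Suc m) * s) ^ 2)))"
        by (rule exp_sum) simp
      also have "\<dots> = (\<Prod>m<M. 1 + 1 / (of_nat (Suc m) * s) ^ 2)"
      proof (rule prod.cong)
        fix m
        have "Re (1 + 1 / (of_nat (Suc m) * s) ^ 2) > 0"
          using Re_sq [OF s, of m] by simp
        then have "1 + 1 / (of_nat (Suc m) * s) ^ 2 \<noteq> 0"
          by (metis less_irrefl zero_complex.sel(1))
        then show "exp (Ln (1 + 1 / (of_nat (Suc m) * s) ^ 2)) = 1 + 1 / (of_nat (Suc m) * s) ^ 2"
          by (rule exp_Ln)
      qed simp
      also have "\<dots> = (\<Prod>m<M. 1 - (\<i> / s) ^ 2 / of_nat (Suc m) ^ 2)"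
        by (simp add: power_divide power_mult_distrib mult.commute del: of_nat_Suc)
      also have "\<dots> = (\<Prod>k=1..M. 1 - (\<i> / s) ^ 2 / of_nat k ^ 2)"
        by (rule prod.reindex_bij_witness [of _ "\<lambda>k. k - 1" Suc]) auto
      finally show "exp (\<Sum>m<M. Ln (1 + 1 / (of_nat (Suc m) * s) ^ 2)) = (\<Prod>k=1..M. 1 - (\<i> / s) ^ 2 / of_nat k ^ 2)" .
    qed
    finally have l1: "(\<lambda>M. of_real pi * (\<i> / s) * (\<Prod>k=1..M. 1 - (\<i> / s) ^ 2 / of_nat k ^ 2)) \<longlonglongrightarrow> of_real pi * (\<i> / s) * exp (Q s)"
      by (intro tendsto_intros)
    have "of_real pi * (\<i> / s) * exp (Q s) = sin (of_real pi * (\<i> / s))"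
      by (rule LIMSEQ_unique [OF l1 sin_product_formula_complex])
    also have "\<dots> = (exp (- (of_real pi / s)) - exp (of_real pi / s)) / (2 * \<i>)"
    proof -
      have "\<i> * (of_real pi * (\<i> / s)) = - (of_real pi / s)"
        by (simp add: field_simps)
      then show ?thesis
        unfolding sin_exp_eq by simp
    qed
    finally have 1: "exp (Q s) = s / of_real (2 * pi) * (exp (of_real pi / s) - exp (- (of_real pi / s)))"
      using s0 by (simp add: field_simps)
    have "1 - exp (- (of_real (2 * pi) / s)) \<noteq> 0"
      using Re_one_minus_exp_pos [OF Re_inv [OF s]] by (metis less_irrefl zero_complex.sel(1))
    then have "exp (P s) = exp (of_real pi / s) * s / of_real (exp (ln (2 * pi))) * (1 - exp (- (of_real (2 * pi) / s)))"
      unfolding P_def using s0 by (simp add: exp_add exp_diff exp_of_real del: exp_ln)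
    also have "exp (ln (2 * pi)) = 2 * pi"
      by simp
    also have "exp (- (of_real (2 * pi) / s)) = exp (- (of_real pi / s)) * exp (- (of_real pi / s))"
      by (simp flip: exp_add)
    also have "exp (of_real pi / s) * s / of_real (2 * pi) * (1 - exp (- (of_real pi / s)) * exp (- (of_real pi / s))) = exp (Q s)"
    proof -
      have *: "a * s / c * (1 - b * b) = s / c * (a - b)" if "a * b = 1" for a b c :: complex
      proof -
        have "a * s / c * (1 - b * b) = s / c * (a - (a * b) * b)"
          by (simp add: field_simps)
        then show ?thesis
          using that by simp
      qed
      show ?thesis
        unfolding 1 by (rule *) (simp flip: exp_add)
    qed
    finally show ?thesis
      by simp
  qed
  let ?A = "closed_segment t 1"
  have oneW: "1 \<in> W"
    by (simp add: W_def)
  have "convex W"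
  proof -
    have "W = {z. 0 < Re z} \<inter> ({z. inner (Complex (- 1) 1) z < 0} \<inter> {z. inner (Complex (- 1) (- 1)) z < 0})"
      by (auto simp: W_def inner_complex_def abs_less_iff)
    then show ?thesis
      by (simp only:) (intro convex_Int convex_halfspace_lt convex_halfspace_Re_gt)
  qed
  then have A: "?A \<subseteq> W"
    using tW oneW by (metis convex_contains_segment)
  obtain \<delta> where \<delta>: "\<delta> > 0" "\<And>s. s \<in> ?A \<Longrightarrow> norm s \<ge> \<delta>"
  proof -
    have "continuous_on ?A norm"
      by (intro continuous_intros)
    then obtain x where x: "x \<in> ?A" "\<And>s. s \<in> ?A \<Longrightarrow> norm x \<le> norm s"
      using continuous_attains_inf [of ?A norm] by auto
    have "norm x > 0"
      using x(1) A W0 by auto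
    then show ?thesis
      using that x(2) by blast
  qed
  have "continuous_on ?A Q"
  proof (rule uniform_limit_theorem)
    show "uniform_limit ?A (\<lambda>M s. \<Sum>m<M. Ln (1 + 1 / (of_nat (Suc m) * s) ^ 2)) Q sequentially"
      unfolding Q_def
    proof (rule Weierstrass_m_test)
      show "norm (Ln (1 + 1 / (of_nat (Suc m) * s) ^ 2)) \<le> (1 / \<delta> ^ 2) * (1 / real (Suc m) ^ 2)" if "s \<in> ?A" for m s
        using that A \<delta> by (intro term_bound) auto
      show "summable (\<lambda>m. (1 / \<delta> ^ 2) * (1 / real (Suc m) ^ 2))"
        by (intro summable_mult sq)
    qed
    show "\<forall>\<^sub>F M in sequentially. continuous_on ?A (\<lambda>s. \<Sum>m<M. Ln (1 + 1 / (of_nat (Suc m) * s) ^ 2))"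
    proof -
      have "continuous_on ?A (\<lambda>s. Ln (1 + 1 / (of_nat (Suc m) * s) ^ 2))" for m
      proof (rule continuous_on_Ln')
      show "continuous_on ?A (\<lambda>s. 1 + 1 / (of_nat (Suc m) * s) ^ 2)"
        by (intro continuous_intros) (use A W0 in \<open>auto simp del: of_nat_Suc\<close>)
      fix s assume "s \<in> ?A"
      then have "Re (1 / (of_nat (Suc m) * s) ^ 2) > 0"
        using Re_sq A by blast
      then show "1 + 1 / (of_nat (Suc m) * s) ^ 2 \<notin> \<real>\<^sub>\<le>\<^sub>0"
        by (simp add: complex_nonpos_Reals_iff del: of_nat_Suc)
      qed
      then show ?thesis
        by (intro always_eventually allI continuous_on_sum)
    qed
  qed simp
  moreover have "continuous_on ?A P"
  proof -
    have nz: "\<forall>s\<in>?A. s \<noteq> 0"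
      using A W0 by blast
    have 1: "continuous_on ?A (\<lambda>s. of_real pi / s)"
      by (intro continuous_intros nz)
    have 2: "continuous_on ?A Ln"
      using A by (intro continuous_on_Ln) (auto simp: W_def complex_nonpos_Reals_iff)
    have 3: "continuous_on ?A (\<lambda>s. Ln (1 - exp (- (of_real (2 * pi) / s))))"
    proof (rule continuous_on_Ln')
      show "continuous_on ?A (\<lambda>s. 1 - exp (- (of_real (2 * pi) / s)))"
        by (intro continuous_intros nz)
      show "1 - exp (- (of_real (2 * pi) / s)) \<notin> \<real>\<^sub>\<le>\<^sub>0" if "s \<in> ?A" for s
        using Re_one_minus_exp_pos [OF Re_inv, of s] that A by (auto simp: complex_nonpos_Reals_iff)
    qed
    show ?thesis
      unfolding P_def by (intro continuous_on_add continuous_on_diff continuous_on_const 1 2 3)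
  qed
  ultimately have cont: "continuous_on ?A (\<lambda>s. Q s - P s)"
    by (intro continuous_intros)
  have lattice: "\<exists>n::int. Q s - P s = of_int n * (2 * of_real pi * \<i>)" if "s \<in> ?A" for s
  proof -
    have "exp (Q s) = exp (P s)"
      using exp_QP A that by blast
    then show ?thesis
      by (auto simp: exp_eq algebra_simps)
  qed
  \<comment> \<open>Distinct values of the difference are at least 2 pi apart, so continuity on a
    connected set forces constancy.\<close>
  have "(\<lambda>s. Q s - P s) constant_on ?A"
  proof (rule continuous_discrete_range_constant [OF connected_segment cont])
    fix x assume x: "x \<in> ?A"
    show "\<exists>e>0. \<forall>y. y \<in> ?A \<and> Q y - P y \<noteq> Q x - P x \<longrightarrow> e \<le> norm (Q y - P y - (Q x - P x))"
    proof (intro exI [of _ "2 * pi"] conjI allI impI)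
      fix y assume y: "y \<in> ?A \<and> Q y - P y \<noteq> Q x - P x"
      obtain m n :: int where mn: "Q x - P x = of_int m * (2 * of_real pi * \<i>)" "Q y - P y = of_int n * (2 * of_real pi * \<i>)"
        using lattice x y by meson
      then have "n \<noteq> m"
        using y by auto
      then have "1 \<le> \<bar>real_of_int (n - m)\<bar>"
        by linarith
      then have "2 * pi * 1 \<le> 2 * pi * \<bar>real_of_int (n - m)\<bar>"
        by (intro mult_left_mono) auto
      also have "\<dots> = norm (of_int (n - m) * (2 * of_real pi * \<i>))"
        by (simp only: norm_mult norm_of_int norm_of_real) simp
      also have "of_int (n - m) * (2 * of_real pi * \<i>) = Q y - P y - (Q x - P x)"
        unfolding mn by (simp add: algebra_simps)
      finally show "2 * pi \<le> norm (Q y - P y - (Q x - P x))"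
        by simp
    qed simp
  qed
  then have "Q t - P t = Q 1 - P 1"
    by (auto simp: constant_on_def)
  also have "Q 1 - P 1 = 0"
  proof -
    \<comment> \<open>At t = 1 all logarithms are real, so the integer multiple of 2 pi i must be
      0.\<close>
    have "Im (Q 1) = 0"
    proof -
      have "Im (Ln (1 + 1 / (of_nat (Suc m) * 1) ^ 2)) = 0" for m
      proof -
        have "1 + 1 / (of_nat (Suc m) * 1) ^ 2 = complex_of_real (1 + 1 / real (Suc m) ^ 2)"
          by simp
        moreover have "0 < 1 + 1 / real (Suc m) ^ 2"
          by (intro add_pos_nonneg) auto
        ultimately have "Ln (1 + 1 / (of_nat (Suc m) * 1) ^ 2) = complex_of_real (ln (1 + 1 / real (Suc m) ^ 2))"
          by (simp only: Ln_of_real)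
        then show ?thesis
          by (simp only: Im_complex_of_real)
      qed
      moreover have "(\<lambda>m. Im (Ln (1 + 1 / (of_nat (Suc m) * 1) ^ 2))) sums Im (Q 1)"
        unfolding Q_def by (intro sums_Im summable_sums summ oneW)
      ultimately show ?thesis
        by (metis (no_types, lifting) sums_unique2 sums_zero sums_cong)
    qed
    moreover have "Im (P 1) = 0"
    proof -
      have "1 - exp (- (of_real (2 * pi) / 1)) = complex_of_real (1 - exp (- (2 * pi)))"
        by (simp flip: exp_of_real)
      moreover have "0 < 1 - exp (- (2 * pi))"
        by simp
      ultimately have "Ln (1 - exp (- (of_real (2 * pi) / 1))) = complex_of_real (ln (1 - exp (- (2 * pi))))"
        by (simp only: Ln_of_real)
      then show ?thesis
        unfolding P_def by simp
    qed
    moreover obtain n :: int where "Q 1 - P 1 = of_int n * (2 * of_real pi * \<i>)"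
      using lattice by (metis ends_in_segment(2))
    ultimately show ?thesis
      by (simp add: field_simps)
  qed
  finally show "(\<Sum>m. Ln (1 + 1 / (of_nat (Suc m) * t) ^ 2)) =
       of_real pi / t + Ln t - of_real (ln (2 * pi)) + Ln (1 - exp (- (of_real (2 * pi) / t)))"
    by (simp add: Q_def P_def)
qed

section \<open>Expansion of the logarithm of the generating function\<close>

definition log_prod :: "nat \<Rightarrow> complex \<Rightarrow> complex" where
  "log_prod k \<tau> = (\<Sum>m. - Ln (1 - exp (- (of_nat (Suc m ^ k) * \<tau>))))"

lemma em_cone_narrow:
  assumes k: "k \<ge> 2" and t: "t \<in> csector (1 / (8 * real k))" "t \<noteq> 0"
  shows "Re t > 0" "\<bar>Im t\<bar> \<le> Re t / (3 * real k)" "\<bar>Im t\<bar> < Re t" "norm t \<le> 2 * Re t"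
proof -
  have R: "Re t \<ge> 0"
    by (rule csector_Re_nonneg [OF t(1)]) (use k in auto)
  have I: "\<bar>Im t\<bar> \<le> Re t / (8 * real k)"
    using t by (simp add: csector_def)
  show R': "Re t > 0"
  proof (rule ccontr)
    assume "\<not> Re t > 0"
    then have "Re t = 0"
      using R by simp
    then have "t = 0"
      using I by (simp add: complex_eq_iff)
    then show False
      using t by simp
  qed
  have "Re t / (8 * real k) \<le> Re t / (3 * real k)"
    using R k by (intro divide_left_mono) auto
  then show 3: "\<bar>Im t\<bar> \<le> Re t / (3 * real k)"
    using I by linarith
  have "Re t / (3 * real k) < Re t / 1"
    using R' k by (intro divide_strict_left_mono) auto
  then show "\<bar>Im t\<bar> < Re t"
    using 3 by simp
  show "norm t \<le> 2 * Re t"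
    by (rule csector_norm_le [OF t(1)]) (use k in auto)
qed

lemma exp_minus_le_power:
  fixes x :: real
  assumes "x > 0"
  shows "exp (- x) \<le> fact N / x ^ N"
proof -
  have "x ^ N / fact N \<le> exp x"
    using assms sum_le_suminf [of "\<lambda>n. x ^ n /\<^sub>R fact n" "{N}"] summable_exp_generic [of x]
    by (simp add: exp_def field_simps)
  then show ?thesis
    using assms by (simp add: exp_minus field_simps)
qed

text \<open>\<open>em_cone_sum\<close> for \<open>em_fun\<close>, plus k/2 times the logarithm of
  the sine product. The term pi/t of the latter becomes a constant after multiplication by t and
  joins the integral in A.\<close>

lemma log_prod_asymp:
  assumes k: "k \<ge> 2"
  shows "\<exists>A. \<forall>N\<ge>k + 1. \<exists>K. \<forall>t\<in>csector (1 / (8 * real k)). t \<noteq> 0 \<longrightarrow> norm t \<le> 1 \<longrightarrow>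
    summable (\<lambda>m. - Ln (1 - exp (- (of_nat (Suc m ^ k) * t ^ k)))) \<and>
    norm (t * log_prod k (t ^ k) - (A + t * (of_real (real k / 2) * (Ln t - of_real (ln (2 * pi)))
       - of_real (fact k * bern_coeff (Suc k) / 2) * t ^ k))) \<le> K * norm t ^ N"
proof -
  define c where "c = 1 / (8 * real k)"
  define \<rho> where "\<rho> = 1 / (64 * real k)"
  have c: "0 < c" "c \<le> 1" and \<rho>: "0 < \<rho>" "\<rho> \<le> 1 / 2"
    using k by (auto simp: c_def \<rho>_def field_simps)
  obtain C where C: "\<And>z. z \<in> em_dom k \<Longrightarrow> norm (em_fun k z) \<le> C / (1 + norm z) ^ 2"
    using em_fun_bound [OF k] by blast
  have hol: "em_fun k holomorphic_on em_dom k"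
    by (intro holomorphic_em_fun [OF k] em_dom_cases [OF k]) (auto simp: em_dom_def)
  have "open (em_dom k)" "convex (em_dom k)"
    using em_dom_open_convex k by auto
  from em_cone_sum [OF this hol c \<rho> _ C] obtain I where I:
    "\<And>N. N \<ge> 1 \<Longrightarrow> \<exists>K. \<forall>t\<in>csector c. t \<noteq> 0 \<longrightarrow> norm t \<le> 1 \<longrightarrow>
     summable (\<lambda>m. em_fun k (of_nat m * t)) \<and>
     norm (t * (\<Sum>m. em_fun k (of_nat m * t)) - I + (\<Sum>j=1..N. of_real (bern_coeff j) * t ^ j * (deriv ^^ (j - 1)) (em_fun k) 0))
        \<le> K * norm t ^ N"
    using cball_subset_em_dom [OF k] unfolding c_def \<rho>_def by auto
  \<comment> \<open>The term j = 1 vanishes because \<open>em_fun\<close> is 0 at 0, odd j > 1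
    because of the Bernoulli coefficient, and even j because the derivative of odd order j - 1 is 0
    unless j - 1 = k. The bound on N keeps j = k + 1 in range.\<close>
  have bsum: "(\<Sum>j=1..N. of_real (bern_coeff j) * t ^ j * (deriv ^^ (j - 1)) (em_fun k) 0) =
      of_real (fact k * bern_coeff (Suc k) / 2) * t ^ Suc k" if N: "N \<ge> k + 1" for N and t :: complex
  proof -
    have "of_real (bern_coeff j) * t ^ j * (deriv ^^ (j - 1)) (em_fun k) 0 =
        (if j = Suc k then of_real (fact k * bern_coeff (Suc k) / 2) * t ^ Suc k else 0)" if j: "j \<in> {1..N}" for j
    proof (cases "j = 1")
      case True
      then show ?thesis
        using k by simp
    next
      case j1: False
      show ?thesis
      proof (cases "odd j")
        case True
        then have "bern_coeff j = 0"
          using bern_coeff_odd j1 by blast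
        then show ?thesis
          by auto
      next
        case False
        then have "odd (j - 1)"
          using j by auto
        from em_fun_odd_deriv [OF k this] show ?thesis
          using j by auto
      qed
    qed
    then have "(\<Sum>j=1..N. of_real (bern_coeff j) * t ^ j * (deriv ^^ (j - 1)) (em_fun k) 0) =
        (\<Sum>j=1..N. if j = Suc k then of_real (fact k * bern_coeff (Suc k) / 2) * t ^ Suc k else 0)"
      by (intro sum.cong) auto
    also have "\<dots> = of_real (fact k * bern_coeff (Suc k) / 2) * t ^ Suc k"
      using N by (subst sum.delta) auto
    finally show ?thesis .
  qed
  show ?thesis
  proof (intro exI [of _ "I + of_real (real k / 2) * of_real pi"] allI impI)
    fix N assume N: "N \<ge> k + 1"
    obtain K where K: "\<And>t. t \<in> csector c \<Longrightarrow> t \<noteq> 0 \<Longrightarrow> norm t \<le> 1 \<Longrightarrow>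
     summable (\<lambda>m. em_fun k (of_nat m * t)) \<and>
     norm (t * (\<Sum>m. em_fun k (of_nat m * t)) - I + (\<Sum>j=1..N. of_real (bern_coeff j) * t ^ j * (deriv ^^ (j - 1)) (em_fun k) 0))
        \<le> K * norm t ^ N"
      using I [of N] N by fastforce
    define K' where "K' = K + real k / 2 * (2 * fact N)"
    have "summable (\<lambda>m. - Ln (1 - exp (- (of_nat (Suc m ^ k) * t ^ k)))) \<and>
     norm (t * log_prod k (t ^ k) - (I + of_real (real k / 2) * of_real pi + t * (of_real (real k / 2) * (Ln t - of_real (ln (2 * pi)))
       - of_real (fact k * bern_coeff (Suc k) / 2) * t ^ k))) \<le> K' * norm t ^ N"
      if t: "t \<in> csector c" "t \<noteq> 0" "norm t \<le> 1" for t
    proof -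
      note nt = em_cone_narrow [OF k t(1)[unfolded c_def] t(2)]
      have summand: "- Ln (1 - exp (- (of_nat (Suc m ^ k) * t ^ k))) =
          em_fun k (of_nat (Suc m) * t) + of_real (real k / 2) * Ln (1 + 1 / (of_nat (Suc m) * t) ^ 2)" for m
      proof -
        have "Re (of_nat (Suc m) * t) = real (Suc m) * Re t" "Im (of_nat (Suc m) * t) = real (Suc m) * Im t"
          by simp_all
        moreover have "real (Suc m) * \<bar>Im t\<bar> \<le> real (Suc m) * (Re t / (3 * real k))"
          using nt by (intro mult_left_mono) auto
        ultimately have "Re (of_nat (Suc m) * t) > 0" "\<bar>Im (of_nat (Suc m) * t)\<bar> \<le> Re (of_nat (Suc m) * t) / (3 * real k)"
          using nt by (simp_all only: abs_mult) auto
        from em_fun_eq(1) [OF k this] show ?thesis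
          by (simp add: power_mult_distrib del: of_nat_Suc)
      qed
      have s1: "summable (\<lambda>m. em_fun k (of_nat (Suc m) * t))"
        using K [OF t] by (subst summable_Suc_iff) auto
      have s2: "summable (\<lambda>m. Ln (1 + 1 / (of_nat (Suc m) * t) ^ 2))"
        by (rule sum_Ln_inverse_squares(1) [OF nt(1,3)])
      have sm: "summable (\<lambda>m. - Ln (1 - exp (- (of_nat (Suc m ^ k) * t ^ k))))"
        unfolding summand by (intro summable_add summable_mult s1 s2)
      \<comment> \<open>The sum over m starting at 0 and the one starting at 1 agree, as
        \<open>em_fun\<close> vanishes at 0.\<close>
      have e1: "(\<Sum>m. em_fun k (of_nat (Suc m) * t)) = (\<Sum>m. em_fun k (of_nat m * t))"
        using suminf_split_head [of "\<lambda>m. em_fun k (of_nat m * t)"] K [OF t] k by simp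
      \<comment> \<open>The exponentially small rest of the sine product: Re(2 pi/t) is at least
        1/|t|, so it is below every power of t.\<close>
      define \<epsilon> where "\<epsilon> = Ln (1 - exp (- (of_real (2 * pi) / t)))"
      define S where "S = t * (\<Sum>m. em_fun k (of_nat m * t)) - I + of_real (fact k * bern_coeff (Suc k) / 2) * t ^ Suc k"
      have S: "norm S \<le> K * norm t ^ N"
      proof -
        have "norm (t * (\<Sum>m. em_fun k (of_nat m * t)) - I + (\<Sum>j=1..N. of_real (bern_coeff j) * t ^ j * (deriv ^^ (j - 1)) (em_fun k) 0))
            \<le> K * norm t ^ N"
          using K [OF t] by blast
        then show ?thesis
          unfolding bsum [OF N] S_def .
      qed
      have *: "log_prod k (t ^ k) = (\<Sum>m. em_fun k (of_nat m * t)) + of_real (real k / 2) *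
          (of_real pi / t + Ln t - of_real (ln (2 * pi)) + \<epsilon>)"
        unfolding log_prod_def summand \<epsilon>_def
        by (subst suminf_add [symmetric, OF s1 summable_mult [OF s2]])
           (simp only: e1 suminf_mult [OF s2] sum_Ln_inverse_squares(2) [OF nt(1,3)])
      have **: "t * (a + h * (x + L - l + e)) - (I + h * (t * x) + t * (h * (L - l) - q * T))
          = (t * a - I + q * (t * T)) + h * (t * e)" for a h x L l e q T
        by (simp add: algebra_simps)
      have eq: "t * log_prod k (t ^ k) - (I + of_real (real k / 2) * of_real pi + t * (of_real (real k / 2) * (Ln t - of_real (ln (2 * pi)))
       - of_real (fact k * bern_coeff (Suc k) / 2) * t ^ k)) = S + of_real (real k / 2) * (t * \<epsilon>)"
      proof -
        have pt: "t * (of_real pi / t) = of_real pi"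
          using t(2) by simp
        have "t * log_prod k (t ^ k) - (I + of_real (real k / 2) * (t * (of_real pi / t)) + t * (of_real (real k / 2) * (Ln t - of_real (ln (2 * pi)))
           - of_real (fact k * bern_coeff (Suc k) / 2) * t ^ k)) = S + of_real (real k / 2) * (t * \<epsilon>)"
          unfolding * S_def power_Suc by (rule **)
        then show ?thesis
          by (simp only: pt)
      qed
      have "norm (t * \<epsilon>) \<le> 2 * fact N * norm t ^ N"
      proof -
        define y where "y = 2 * pi * Re (1 / t)"
        have "y \<ge> pi / norm t"
        proof -
          have "norm t * norm t \<le> 2 * Re t * norm t"
            using nt by (intro mult_right_mono) auto
          then have "1 / norm t \<le> 2 * (Re t / norm t ^ 2)"
            using t by (simp add: field_simps power2_eq_square)
          moreover have "Re (1 / t) = Re t / norm t ^ 2"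
            by (simp add: Re_divide cmod_power2)
          ultimately show ?thesis
            using mult_left_mono [of "1 / norm t" "2 * Re (1 / t)" pi] by (simp add: y_def mult_ac)
        qed
        have y0: "y \<ge> 1 / norm t" "1 / norm t \<ge> 1"
        proof -
          have "1 / norm t \<le> pi / norm t"
            using pi_gt3 by (intro divide_right_mono) auto
          then show "y \<ge> 1 / norm t"
            using \<open>y \<ge> pi / norm t\<close> by linarith
          show "1 / norm t \<ge> 1"
            using t by (simp add: field_simps)
        qed
        have y3: "y \<ge> 3"
        proof -
          have "3 * 1 \<le> pi * (1 / norm t)"
            using pi_gt3 y0 by (intro mult_mono) auto
          then show ?thesis
            using \<open>y \<ge> pi / norm t\<close> by simp
        qed
        have ne: "norm (- exp (- (of_real (2 * pi) / t))) = exp (- y)"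
          by (simp add: y_def Re_divide)
        have "exp (- y) \<le> exp (- 3)"
          using y3 by simp
        also have "exp (- 3 :: real) \<le> fact 1 / 3 ^ 1"
          by (rule exp_minus_le_power) simp
        finally have "norm (- exp (- (of_real (2 * pi) / t))) < 1 / 2"
          unfolding ne by simp
        from norm_Ln_le [OF this] have "norm \<epsilon> \<le> 2 * exp (- y)"
          unfolding ne by (simp add: \<epsilon>_def)
        also have "\<dots> \<le> 2 * exp (- (1 / norm t))"
          using y0 by simp
        also have "\<dots> \<le> 2 * (fact N / (1 / norm t) ^ N)"
          using t by (intro mult_left_mono exp_minus_le_power) auto
        also have "\<dots> = 2 * fact N * norm t ^ N"
          by (simp add: power_divide)
        finally have "norm \<epsilon> \<le> 2 * fact N * norm t ^ N" .
        moreover have "norm (t * \<epsilon>) \<le> 1 * norm \<epsilon>"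
          unfolding norm_mult using t by (intro mult_right_mono) auto
        ultimately show ?thesis
          by linarith
      qed
      have "norm (of_real (real k / 2) * (t * \<epsilon>)) \<le> real k / 2 * (2 * fact N * norm t ^ N)"
      proof -
        have "norm (of_real (real k / 2) * (t * \<epsilon>)) = real k / 2 * norm (t * \<epsilon>)"
          by (subst norm_mult) (simp add: norm_divide)
        then show ?thesis
          using mult_left_mono [OF \<open>norm (t * \<epsilon>) \<le> 2 * fact N * norm t ^ N\<close>, of "real k / 2"] by simp
      qed
      then have "norm (S + of_real (real k / 2) * (t * \<epsilon>)) \<le> K * norm t ^ N + real k / 2 * (2 * fact N * norm t ^ N)"
        using S norm_triangle_mono by blast
      also have "\<dots> = K' * norm t ^ N"
        by (simp add: K'_def algebra_simps)
      finally show ?thesis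
        using sm eq by simp
    qed
    then show "\<exists>K. \<forall>t\<in>csector (1 / (8 * real k)). t \<noteq> 0 \<longrightarrow> norm t \<le> 1 \<longrightarrow>
     summable (\<lambda>m. - Ln (1 - exp (- (of_nat (Suc m ^ k) * t ^ k)))) \<and>
     norm (t * log_prod k (t ^ k) - (I + of_real (real k / 2) * of_real pi + t * (of_real (real k / 2) * (Ln t - of_real (ln (2 * pi)))
       - of_real (fact k * bern_coeff (Suc k) / 2) * t ^ k))) \<le> K * norm t ^ N"
      unfolding c_def by blast
  qed
qed

section \<open>The leading constant\<close>

lemma Gamma_integral_limit:
  assumes x: "x > (1::real)" and X: "filterlim X at_top sequentially"
  shows "(\<lambda>n. integral {0..X n} (\<lambda>t. t powr (x - 1) * exp (- t))) \<longlonglongrightarrow> Gamma x"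
proof -
  let ?g = "\<lambda>t::real. t powr (x - 1) * exp (- t)"
  let ?f = "\<lambda>n t. if t \<in> {0..X n} then ?g t else 0"
  have g: "(?g has_integral Gamma x) {0..}"
    using Gamma_integral_real [of x] x by (simp add: exp_minus divide_inverse)
  have cont: "continuous_on {0..y} ?g" for y
    using x by (intro continuous_intros continuous_on_powr') auto
  have "(\<lambda>n. integral {0..} (?f n)) \<longlonglongrightarrow> integral {0..} ?g"
  proof (rule dominated_convergence)
    show "?f n integrable_on {0..}" for n
    proof -
      have "?g integrable_on ({0..X n} \<inter> {0..})"
        using integrable_continuous_real [OF cont [of "X n"]] by (simp add: Int_absorb2)
      then show ?thesis
        by (subst integrable_restrict_Int)
    qed
    show "?g integrable_on {0..}"
      using g by blast
    show "norm (?f n t) \<le> ?g t" for n t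
      by auto
    fix t :: real assume t: "t \<in> {0..}"
    have "eventually (\<lambda>n. t \<le> X n) sequentially"
      using X by (simp add: filterlim_at_top)
    then have "eventually (\<lambda>n. ?f n t = ?g t) sequentially"
      by eventually_elim (use t in auto)
    then show "(\<lambda>n. ?f n t) \<longlonglongrightarrow> ?g t"
      by (rule tendsto_eventually)
  qed
  moreover have "integral {0..} (?f n) = integral {0..X n} ?g" for n
    by (subst integral_restrict_Int) (simp add: Int_absorb2)
  moreover have "integral {0..} ?g = Gamma x"
    using g by blast
  ultimately show ?thesis
    by simp
qed

text \<open>Integration by parts and the substitution \<open>u = x\<^sup>k\<close> show that this is \<open>\<integral>\<^sub>0\<^sup>R exp (- x\<^sup>k) dx\<close>.\<close>

definition exp_power_int :: "nat \<Rightarrow> real \<Rightarrow> real" where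
  "exp_power_int k R = R * exp (- (R ^ k)) + integral {0..R ^ k} (\<lambda>u. u powr (1 / real k) * exp (- u))"

lemma exp_power_int_0 [simp]: "k \<ge> 1 \<Longrightarrow> exp_power_int k 0 = 0"
  by (simp add: exp_power_int_def power_0_left)

lemma exp_power_int_deriv:
  assumes k: "k \<ge> 1" and R: "0 \<le> x" "x \<le> b"
  shows "(exp_power_int k has_real_derivative exp (- (x ^ k))) (at x within {0..b})"
proof -
  let ?g = "\<lambda>u::real. u powr (1 / real k) * exp (- u)"
  have cont: "continuous_on {0..b ^ k} ?g"
    using k by (intro continuous_intros continuous_on_powr') auto
  have xk: "x ^ k \<in> {0..b ^ k}"
    using R by (auto intro: power_mono)
  have img: "(\<lambda>x. x ^ k) ` {0..b} \<subseteq> {0..b ^ k}"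
    by (auto intro: power_mono)
  have 1: "((\<lambda>x. x ^ k) has_real_derivative real k * x ^ (k - 1)) (at x within {0..b})"
    by (auto intro!: derivative_eq_intros)
  have "((\<lambda>y. integral {0..y} ?g) has_real_derivative ?g (x ^ k)) (at (x ^ k) within {0..b ^ k})"
    by (rule integral_has_real_derivative [OF cont xk])
  then have "((\<lambda>y. integral {0..y} ?g) has_real_derivative ?g (x ^ k)) (at (x ^ k) within (\<lambda>x. x ^ k) ` {0..b})"
    using img by (rule DERIV_subset)
  from DERIV_image_chain [OF this 1]
  have 2: "((\<lambda>x. integral {0..x ^ k} ?g) has_real_derivative ?g (x ^ k) * (real k * x ^ (k - 1))) (at x within {0..b})"
    by (simp add: o_def)
  have 3: "((\<lambda>x. x * exp (- (x ^ k))) has_real_derivative exp (- (x ^ k)) - x * (exp (- (x ^ k)) * (real k * x ^ (k - 1)))) (at x within {0..b})"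
    by (rule derivative_eq_intros 1 refl | simp add: algebra_simps)+
  have "(x ^ k) powr (1 / real k) = x"
    using R k by (cases "x = 0") (auto simp: powr_powr power_0_left simp flip: powr_realpow)
  then have eq: "exp (- (x ^ k)) - x * (exp (- (x ^ k)) * (real k * x ^ (k - 1))) + ?g (x ^ k) * (real k * x ^ (k - 1)) = exp (- (x ^ k))"
    by simp
  show ?thesis
    using DERIV_add [OF 3 2] unfolding eq exp_power_int_def [abs_def] .
qed

lemma exp_power_int_diff:
  assumes k: "k \<ge> 1" and ab: "0 \<le> a" "a \<le> b"
  shows "exp_power_int k b - exp_power_int k a \<le> (b - a) * exp (- (a ^ k))"
    and "(b - a) * exp (- (b ^ k)) \<le> exp_power_int k b - exp_power_int k a"
proof -
  have "exp_power_int k b - exp_power_int k a \<le> (b - a) * exp (- (a ^ k)) \<and>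
      (b - a) * exp (- (b ^ k)) \<le> exp_power_int k b - exp_power_int k a"
  proof (cases "a = b")
    case False
    then have "a < b"
      using ab by simp
    have "continuous_on {0..b} (exp_power_int k)"
      using exp_power_int_deriv [OF k] by (intro DERIV_continuous_on) auto
    then have "continuous_on {a..b} (exp_power_int k)"
      by (rule continuous_on_subset) (use ab in auto)
    moreover have "(exp_power_int k has_derivative (\<lambda>h. exp (- (x ^ k)) * h)) (at x)" if "a < x" "x < b" for x
    proof -
      have "(exp_power_int k has_real_derivative exp (- (x ^ k))) (at x within {0..b})"
        using that ab by (intro exp_power_int_deriv [OF k]) auto
      moreover have "at x within {0..b} = at x"
        using that ab by (intro at_within_interior) auto
      ultimately show ?thesis
        by (simp add: has_field_derivative_def)
    qed
    ultimately obtain \<xi> where \<xi>: "a < \<xi>" "\<xi> < b" "exp_power_int k b - exp_power_int k a = exp (- (\<xi> ^ k)) * (b - a)"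
      using mvt [OF \<open>a < b\<close>, of "exp_power_int k" "\<lambda>x h. exp (- (x ^ k)) * h"] by blast
    have "a ^ k \<le> \<xi> ^ k" "\<xi> ^ k \<le> b ^ k"
      using \<xi> ab by (auto intro: power_mono)
    then show ?thesis
      unfolding \<xi>(3) using ab by (auto simp: mult.commute intro!: mult_left_mono)
  qed simp
  then show "exp_power_int k b - exp_power_int k a \<le> (b - a) * exp (- (a ^ k))"
    and "(b - a) * exp (- (b ^ k)) \<le> exp_power_int k b - exp_power_int k a"
    by blast+
qed

lemma exp_power_int_limit:
  assumes k: "k \<ge> 1" and s: "s > 0"
  shows "(\<lambda>n. exp_power_int k (real n * s)) \<longlonglongrightarrow> Gamma (1 + 1 / real k)"
proof -
  have X: "filterlim (\<lambda>n. real n * s) at_top sequentially"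
    using s by (intro filterlim_at_top_mult_tendsto_pos [OF tendsto_const] filterlim_real_sequentially) auto
  have Xk: "filterlim (\<lambda>n. (real n * s) ^ k) at_top sequentially"
    using k X by (intro filterlim_pow_at_top) auto
  have 1: "(\<lambda>n. integral {0..(real n * s) ^ k} (\<lambda>u. u powr (1 / real k) * exp (- u))) \<longlonglongrightarrow> Gamma (1 + 1 / real k)"
    using Gamma_integral_limit [OF _ Xk, of "1 + 1 / real k"] k by simp
  have "((\<lambda>y::real. y ^ 1 / exp y) \<longlongrightarrow> 0) at_top"
    by (rule tendsto_power_div_exp_0)
  from filterlim_compose [OF this X] have 2: "(\<lambda>n. (real n * s) / exp (real n * s)) \<longlonglongrightarrow> 0"
    by simp
  have "(\<lambda>n. (real n * s) * exp (- ((real n * s) ^ k))) \<longlonglongrightarrow> 0"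
  proof (rule Lim_null_comparison [OF _ 2])
    have "eventually (\<lambda>n. real n * s \<ge> 1) sequentially"
      using X by (simp add: filterlim_at_top)
    then show "eventually (\<lambda>n. norm ((real n * s) * exp (- ((real n * s) ^ k))) \<le> (real n * s) / exp (real n * s)) sequentially"
    proof eventually_elim
      case (elim n)
      have "real n * s \<le> (real n * s) ^ k"
        using elim k by (intro self_le_power) auto
      then have "exp (- ((real n * s) ^ k)) \<le> exp (- (real n * s))"
        by simp
      then have "(real n * s) * exp (- ((real n * s) ^ k)) \<le> (real n * s) * exp (- (real n * s))"
        using elim by (intro mult_left_mono) auto
      then show ?case
        using elim s by (simp add: exp_minus divide_inverse abs_mult)
    qed
  qed
  from tendsto_add [OF this 1] show ?thesis
    by (simp add: exp_power_int_def)
qed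

text \<open>Right-hand Riemann sums of the decreasing function exp(-x^k) with mesh s lie below its
  integral over the half-line and miss it by at most the first cell.\<close>

lemma exp_power_sum_bounds:
  assumes k: "k \<ge> 1" and s: "s > 0"
  shows "summable (\<lambda>m. exp (- ((real (Suc m) * s) ^ k)))"
    and "s * (\<Sum>m. exp (- ((real (Suc m) * s) ^ k))) \<le> Gamma (1 + 1 / real k)"
    and "s * (\<Sum>m. exp (- ((real (Suc m) * s) ^ k))) \<ge> Gamma (1 + 1 / real k) - s"
proof -
  let ?e = "\<lambda>m. exp (- ((real (Suc m) * s) ^ k))"
  let ?H = "exp_power_int k"
  have up: "s * (\<Sum>m<M. ?e m) \<le> ?H (real M * s)" for M
  proof (induction M)
    case (Suc M)
    have "s * ?e M \<le> ?H (real (Suc M) * s) - ?H (real M * s)"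
      using exp_power_int_diff(2) [OF k, of "real M * s" "real (Suc M) * s"] s by (simp add: algebra_simps)
    then show ?case
      using Suc.IH by (simp add: distrib_left)
  qed (use k in simp)
  have lo: "s * (\<Sum>m<M. ?e m) \<ge> ?H (real (Suc M) * s) - s" for M
  proof (induction M)
    case 0
    show ?case
      using exp_power_int_diff(1) [OF k, of 0 s] s k by (simp add: power_0_left)
  next
    case (Suc M)
    have "s * ?e M \<ge> ?H (real (Suc (Suc M)) * s) - ?H (real (Suc M) * s)"
      using exp_power_int_diff(1) [OF k, of "real (Suc M) * s" "real (Suc (Suc M)) * s"] s by (simp add: algebra_simps)
    then show ?case
      using Suc.IH by (simp add: distrib_left)
  qed
  have H_le: "?H (real M * s) \<le> Gamma (1 + 1 / real k)" for M
  proof (rule incseq_le [OF _ exp_power_int_limit [OF k s]])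
    show "incseq (\<lambda>n. ?H (real n * s))"
    proof (rule incseq_SucI)
      fix n
      have "0 \<le> (real (Suc n) * s - real n * s) * exp (- ((real (Suc n) * s) ^ k))"
        using s by (intro mult_nonneg_nonneg) (auto simp: algebra_simps)
      also have "\<dots> \<le> ?H (real (Suc n) * s) - ?H (real n * s)"
        using s by (intro exp_power_int_diff(2) [OF k]) (auto simp: algebra_simps)
      finally show "?H (real n * s) \<le> ?H (real (Suc n) * s)"
        by simp
    qed
  qed
  have bd: "(\<Sum>m<M. ?e m) \<le> Gamma (1 + 1 / real k) / s" for M
    using order_trans [OF up H_le] s by (simp add: field_simps)
  show sm: "summable ?e"
    by (rule summableI_nonneg_bounded [OF _ bd]) simp
  have lim: "(\<lambda>M. s * (\<Sum>m<M. ?e m)) \<longlonglongrightarrow> s * (\<Sum>m. ?e m)"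
    by (intro tendsto_intros summable_LIMSEQ sm)
  show "s * (\<Sum>m. ?e m) \<le> Gamma (1 + 1 / real k)"
    by (rule LIMSEQ_le_const2 [OF lim]) (use order_trans [OF up H_le] in auto)
  have "(\<lambda>M. ?H (real (Suc M) * s) - s) \<longlonglongrightarrow> Gamma (1 + 1 / real k) - s"
    by (intro tendsto_intros filterlim_compose [OF exp_power_int_limit [OF k s] filterlim_Suc])
  then show "s * (\<Sum>m. ?e m) \<ge> Gamma (1 + 1 / real k) - s"
    by (rule LIMSEQ_le [OF _ lim]) (use lo in auto)
qed

text \<open>Expand -ln(1 - q) as the series of q^n/n. The n-th powers are exponentials on a grid of
  mesh t n^(1/k), so their sum times t is close to Gamma(1 + 1/k) n^(-1/k), and summation over n
  produces zeta(1 + 1/k). The lower bound stops at N terms because the mesh errors t/n form a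
  divergent series.\<close>

lemma log_sum_bounds:
  fixes t :: real
  assumes k: "k \<ge> 1" and t: "t > 0" and sm: "summable (\<lambda>m. - ln (1 - exp (- ((real (Suc m) * t) ^ k))))"
  defines "\<zeta> \<equiv> (\<lambda>N. \<Sum>n<N. 1 / real (Suc n) powr (1 + 1 / real k))"
  shows "t * (\<Sum>m. - ln (1 - exp (- ((real (Suc m) * t) ^ k)))) \<le> Gamma (1 + 1 / real k) * zeta_real (1 + 1 / real k)"
    and "t * (\<Sum>m. - ln (1 - exp (- ((real (Suc m) * t) ^ k)))) \<ge> Gamma (1 + 1 / real k) * \<zeta> N - t * (\<Sum>n<N. 1 / real (Suc n))"
proof -
  define q where "q m = exp (- ((real (Suc m) * t) ^ k))" for m
  have q: "0 < q m" "q m < 1" for m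
    using t by (auto simp: q_def)
  define \<Gamma> where "\<Gamma> = Gamma (1 + 1 / real k)"
  have ser: "(\<lambda>n. q m ^ Suc n / real (Suc n)) sums - ln (1 - q m)" for m
  proof -
    have "(\<lambda>n. - ((- (- q m)) ^ n) / real n) sums ln (1 + (- q m))"
      using q [of m] by (intro ln_series') auto
    from sums_minus [OF this] have "(\<lambda>n. q m ^ n / real n) sums - ln (1 - q m)"
      by simp
    then show ?thesis
      using sums_Suc_iff [of "\<lambda>n. q m ^ n / real n" "- ln (1 - q m)"] by (simp del: of_nat_Suc power_Suc)
  qed
  have qpow: "q m ^ Suc n = exp (- ((real (Suc m) * (t * real (Suc n) powr (1 / real k))) ^ k))" for m n
  proof -
    have "(real (Suc n) powr (1 / real k)) ^ k = real (Suc n)"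
      using k by (simp add: powr_powr flip: powr_realpow)
    then have "(real (Suc m) * (t * real (Suc n) powr (1 / real k))) ^ k = real (Suc n) * (real (Suc m) * t) ^ k"
      by (simp add: power_mult_distrib mult_ac)
    then show ?thesis
      unfolding q_def by (simp only: exp_of_nat_mult [symmetric] mult_minus_right)
  qed
  define w where "w n = real (Suc n) powr (1 / real k)" for n
  have w: "w n > 0" for n
    by (simp add: w_def)
  have tw: "t * w n > 0" for n
    using t w by simp
  have sq: "summable (\<lambda>m. q m ^ Suc n)" for n
    unfolding qpow by (rule exp_power_sum_bounds(1) [OF k]) (use tw in \<open>simp add: w_def\<close>)
  have up: "t * (\<Sum>m. q m ^ Suc n) \<le> \<Gamma> / w n" for n
    using exp_power_sum_bounds(2) [OF k tw [of n]] w [of n]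
    unfolding qpow \<Gamma>_def w_def [symmetric] by (simp add: field_simps)
  have lo: "t * (\<Sum>m. q m ^ Suc n) \<ge> \<Gamma> / w n - t" for n
    using exp_power_sum_bounds(3) [OF k tw [of n]] w [of n]
    unfolding qpow \<Gamma>_def w_def [symmetric] by (simp add: field_simps)
  have wz: "1 / w n / real (Suc n) = 1 / real (Suc n) powr (1 + 1 / real k)" for n
    by (simp add: w_def powr_add del: of_nat_Suc)
  have sm': "summable (\<lambda>m. - ln (1 - q m))"
    using sm by (simp add: q_def)
  have \<Gamma>: "\<Gamma> \<ge> 0"
    unfolding \<Gamma>_def by (intro less_imp_le Gamma_real_pos add_pos_nonneg) (use k in auto)
  have zs: "(\<lambda>n. 1 / real (Suc n) powr (1 + 1 / real k)) sums zeta_real (1 + 1 / real k)"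
    using k by (intro zeta_real_sums) auto
  have part: "t * (\<Sum>m<M. - ln (1 - q m)) \<le> \<Gamma> * zeta_real (1 + 1 / real k)" for M
  proof -
    have "(\<lambda>n. \<Sum>m<M. q m ^ Suc n / real (Suc n)) sums (\<Sum>m<M. - ln (1 - q m))"
      by (intro sums_sum ser)
    then have 1: "(\<lambda>n. t * (\<Sum>m<M. q m ^ Suc n / real (Suc n))) sums (t * (\<Sum>m<M. - ln (1 - q m)))"
      by (rule sums_mult)
    have 2: "(\<lambda>n. \<Gamma> * (1 / real (Suc n) powr (1 + 1 / real k))) sums (\<Gamma> * zeta_real (1 + 1 / real k))"
      by (intro sums_mult zs)
    show ?thesis
    proof (rule sums_le [OF _ 1 2])
      fix n
      have "t * (\<Sum>m<M. q m ^ Suc n) \<le> t * (\<Sum>m. q m ^ Suc n)"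
        using t q by (intro mult_left_mono sum_le_suminf sq) (auto intro: less_imp_le)
      then have "t * (\<Sum>m<M. q m ^ Suc n) / real (Suc n) \<le> \<Gamma> / w n / real (Suc n)"
        using up [of n] by (intro divide_right_mono) auto
      also have "\<dots> = \<Gamma> * (1 / real (Suc n) powr (1 + 1 / real k))"
        unfolding wz [symmetric] by simp
      finally show "t * (\<Sum>m<M. q m ^ Suc n / real (Suc n)) \<le> \<Gamma> * (1 / real (Suc n) powr (1 + 1 / real k))"
        by (simp only: sum_divide_distrib [symmetric] times_divide_eq_right)
    qed
  qed
  have "(\<lambda>M. t * (\<Sum>m<M. - ln (1 - q m))) \<longlonglongrightarrow> t * (\<Sum>m. - ln (1 - q m))"
    by (intro tendsto_intros summable_LIMSEQ sm')
  then have "t * (\<Sum>m. - ln (1 - q m)) \<le> \<Gamma> * zeta_real (1 + 1 / real k)"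
    by (rule LIMSEQ_le_const2) (use part in auto)
  then show "t * (\<Sum>m. - ln (1 - exp (- ((real (Suc m) * t) ^ k)))) \<le> Gamma (1 + 1 / real k) * zeta_real (1 + 1 / real k)"
    by (simp add: q_def \<Gamma>_def)
  have "(\<Sum>n<N. (\<Sum>m. q m ^ Suc n) / real (Suc n)) = (\<Sum>n<N. \<Sum>m. q m ^ Suc n / real (Suc n))"
    by (intro sum.cong refl suminf_divide [symmetric] sq)
  also have "\<dots> = (\<Sum>m. \<Sum>n<N. q m ^ Suc n / real (Suc n))"
    by (intro suminf_sum [symmetric] summable_divide sq)
  also have "\<dots> \<le> (\<Sum>m. - ln (1 - q m))"
  proof (rule suminf_le [OF _ _ sm'])
    show "(\<Sum>n<N. q m ^ Suc n / real (Suc n)) \<le> - ln (1 - q m)" for m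
      unfolding sums_unique [OF ser [of m]]
      using q [of m] by (intro sum_le_suminf sums_summable [OF ser]) (auto intro!: divide_nonneg_nonneg less_imp_le)
    show "summable (\<lambda>m. \<Sum>n<N. q m ^ Suc n / real (Suc n))"
      by (intro summable_sum summable_divide sq)
  qed
  finally have "t * (\<Sum>n<N. (\<Sum>m. q m ^ Suc n) / real (Suc n)) \<le> t * (\<Sum>m. - ln (1 - q m))"
    using t by (intro mult_left_mono) auto
  moreover have "\<Gamma> * \<zeta> N - t * (\<Sum>n<N. 1 / real (Suc n)) \<le> t * (\<Sum>n<N. (\<Sum>m. q m ^ Suc n) / real (Suc n))"
  proof -
    have "\<Gamma> * \<zeta> N - t * (\<Sum>n<N. 1 / real (Suc n)) = (\<Sum>n<N. (\<Gamma> / w n - t) / real (Suc n))"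
      unfolding \<zeta>_def wz [symmetric] by (simp add: sum_distrib_left diff_divide_distrib flip: sum_subtractf)
    also have "\<dots> \<le> (\<Sum>n<N. t * (\<Sum>m. q m ^ Suc n) / real (Suc n))"
      by (intro sum_mono divide_right_mono lo) auto
    also have "\<dots> = t * (\<Sum>n<N. (\<Sum>m. q m ^ Suc n) / real (Suc n))"
      by (simp add: sum_distrib_left)
    finally show ?thesis .
  qed
  ultimately show "t * (\<Sum>m. - ln (1 - exp (- ((real (Suc m) * t) ^ k)))) \<ge> Gamma (1 + 1 / real k) * \<zeta> N - t * (\<Sum>n<N. 1 / real (Suc n))"
    by (simp add: q_def \<Gamma>_def)
qed

lemma log_prod_of_real:
  fixes t :: real
  assumes k: "k \<ge> 1" and t: "t > 0"
    and sm: "summable (\<lambda>m. - Ln (1 - exp (- (of_nat (Suc m ^ k) * of_real t ^ k))))"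
  shows "summable (\<lambda>m. - ln (1 - exp (- ((real (Suc m) * t) ^ k))))"
    and "log_prod k (of_real t ^ k) = of_real (\<Sum>m. - ln (1 - exp (- ((real (Suc m) * t) ^ k))))"
proof -
  have summand: "- Ln (1 - exp (- (of_nat (Suc m ^ k) * of_real t ^ k))) =
      complex_of_real (- ln (1 - exp (- ((real (Suc m) * t) ^ k))))" for m
  proof -
    have "of_nat (Suc m ^ k) * of_real t ^ k = complex_of_real ((real (Suc m) * t) ^ k)"
      by (simp add: power_mult_distrib)
    then have "1 - exp (- (of_nat (Suc m ^ k) * of_real t ^ k)) = complex_of_real (1 - exp (- ((real (Suc m) * t) ^ k)))"
      by (simp only: exp_of_real of_real_minus [symmetric] of_real_diff of_real_1)
    moreover have "0 < 1 - exp (- ((real (Suc m) * t) ^ k))"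
      using t by simp
    ultimately show ?thesis
      by (simp only: Ln_of_real of_real_minus)
  qed
  have s: "summable (\<lambda>m. complex_of_real (- ln (1 - exp (- ((real (Suc m) * t) ^ k)))))"
    using sm unfolding summand .
  then show "summable (\<lambda>m. - ln (1 - exp (- ((real (Suc m) * t) ^ k))))"
    by (simp only: summable_of_real_iff)
  then show "log_prod k (of_real t ^ k) = of_real (\<Sum>m. - ln (1 - exp (- ((real (Suc m) * t) ^ k))))"
    unfolding log_prod_def summand by (rule suminf_of_real [symmetric])
qed

definition lead_const :: "nat \<Rightarrow> real" where
  "lead_const k = Gamma (1 + 1 / real k) * zeta_real (1 + 1 / real k)"

text \<open>The constant A is the limit of t \<open>log_prod\<close> k (t^k) along t = 1/(j + 1);
  there the logarithms are real and \<open>log_sum_bounds\<close> applies.\<close>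

lemma log_prod_asymp':
  assumes k: "k \<ge> 2" and N: "N \<ge> k + 1"
  shows "\<exists>K. \<forall>t\<in>csector (1 / (8 * real k)). t \<noteq> 0 \<longrightarrow> norm t \<le> 1 \<longrightarrow>
    summable (\<lambda>m. - Ln (1 - exp (- (of_nat (Suc m ^ k) * t ^ k)))) \<and>
    norm (t * log_prod k (t ^ k) - (of_real (lead_const k) + t * (of_real (real k / 2) * (Ln t - of_real (ln (2 * pi)))
       - of_real (fact k * bern_coeff (Suc k) / 2) * t ^ k))) \<le> K * norm t ^ N"
proof -
  obtain A where A: "\<And>N. N \<ge> k + 1 \<Longrightarrow> \<exists>K. \<forall>t\<in>csector (1 / (8 * real k)). t \<noteq> 0 \<longrightarrow> norm t \<le> 1 \<longrightarrow>
    summable (\<lambda>m. - Ln (1 - exp (- (of_nat (Suc m ^ k) * t ^ k)))) \<and>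
    norm (t * log_prod k (t ^ k) - (A + t * (of_real (real k / 2) * (Ln t - of_real (ln (2 * pi)))
       - of_real (fact k * bern_coeff (Suc k) / 2) * t ^ k))) \<le> K * norm t ^ N"
    using log_prod_asymp [OF k] by blast
  have k1: "k \<ge> 1"
    using k by simp
  obtain K where K: "\<And>t. t \<in> csector (1 / (8 * real k)) \<Longrightarrow> t \<noteq> 0 \<Longrightarrow> norm t \<le> 1 \<Longrightarrow>
    summable (\<lambda>m. - Ln (1 - exp (- (of_nat (Suc m ^ k) * t ^ k)))) \<and>
    norm (t * log_prod k (t ^ k) - (A + t * (of_real (real k / 2) * (Ln t - of_real (ln (2 * pi)))
       - of_real (fact k * bern_coeff (Suc k) / 2) * t ^ k))) \<le> K * norm t ^ (k + 1)"
    using A [of "k + 1"] by fastforce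
  define \<tau> where "\<tau> j = 1 / real (Suc j)" for j :: nat
  have \<tau>: "0 < \<tau> j" "\<tau> j \<le> 1" for j
    by (auto simp: \<tau>_def)
  have \<tau>0: "\<tau> \<longlonglongrightarrow> 0"
    unfolding \<tau>_def by real_asymp
  have \<tau>sec: "of_real (\<tau> j) \<in> csector (1 / (8 * real k))" for j
    using \<tau> [of j] by (auto simp: csector_def)
  define L where "L t = (\<Sum>m. - ln (1 - exp (- ((real (Suc m) * t) ^ k))))" for t :: real
  define y where "y j = \<tau> j * (real k / 2 * (ln (\<tau> j) - ln (2 * pi)) - fact k * bern_coeff (Suc k) / 2 * \<tau> j ^ k)" for j
  have sm: "summable (\<lambda>m. - Ln (1 - exp (- (of_nat (Suc m ^ k) * of_real (\<tau> j) ^ k))))" for j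
    using K [OF \<tau>sec] \<tau> [of j] by auto
  have LL: "log_prod k (of_real (\<tau> j) ^ k) = of_real (L (\<tau> j))" for j
    unfolding L_def by (rule log_prod_of_real(2) [OF k1 \<tau>(1) sm])
  have bd: "norm (of_real (\<tau> j * L (\<tau> j)) - (A + of_real (y j))) \<le> K * \<tau> j ^ (k + 1)" for j
  proof -
    have "Ln (of_real (\<tau> j)) = of_real (ln (\<tau> j))"
      by (rule Ln_of_real) (rule \<tau>)
    then show ?thesis
      using K [OF \<tau>sec [of j]] \<tau> [of j] LL [of j] by (auto simp: y_def)
  qed
  have y0: "y \<longlonglongrightarrow> 0"
  proof -
    have 1: "(\<lambda>j. \<tau> j * ln (\<tau> j)) \<longlonglongrightarrow> 0"
      unfolding \<tau>_def by real_asymp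
    have "(\<lambda>j. real k / 2 * (\<tau> j * ln (\<tau> j)) - real k / 2 * ln (2 * pi) * \<tau> j - fact k * bern_coeff (Suc k) / 2 * (\<tau> j * \<tau> j ^ k))
      \<longlonglongrightarrow> real k / 2 * 0 - real k / 2 * ln (2 * pi) * 0 - fact k * bern_coeff (Suc k) / 2 * (0 * 0 ^ k)"
      by (intro tendsto_intros 1 \<tau>0)
    then show ?thesis
      by (simp add: y_def [abs_def] algebra_simps)
  qed
  have "(\<lambda>j. of_real (\<tau> j * L (\<tau> j)) - (A + of_real (y j))) \<longlonglongrightarrow> 0"
  proof (rule Lim_null_comparison [OF always_eventually])
    show "\<forall>j. norm (of_real (\<tau> j * L (\<tau> j)) - (A + of_real (y j))) \<le> K * \<tau> j ^ (k + 1)"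
      using bd by blast
    have "(\<lambda>j. K * \<tau> j ^ (k + 1)) \<longlonglongrightarrow> K * 0 ^ (k + 1)"
      by (intro tendsto_intros \<tau>0)
    then show "(\<lambda>j. K * \<tau> j ^ (k + 1)) \<longlonglongrightarrow> 0"
      by simp
  qed
  moreover have "(\<lambda>j. complex_of_real (y j)) \<longlonglongrightarrow> of_real 0"
    by (intro tendsto_of_real y0)
  ultimately have "(\<lambda>j. of_real (\<tau> j * L (\<tau> j)) - (A + of_real (y j)) + (A + of_real (y j))) \<longlonglongrightarrow> 0 + (A + of_real 0)"
    by (intro tendsto_add tendsto_const)
  then have limA: "(\<lambda>j. complex_of_real (\<tau> j * L (\<tau> j))) \<longlonglongrightarrow> A"
    by simp
  from tendsto_Re [OF this] have limR: "(\<lambda>j. \<tau> j * L (\<tau> j)) \<longlonglongrightarrow> Re A"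
    by simp
  from tendsto_Im [OF limA] have ImA: "Im A = 0"
    by (simp add: LIMSEQ_const_iff)
  note bounds = log_sum_bounds [OF k1 \<tau>(1) log_prod_of_real(1) [OF k1 \<tau>(1) sm], folded L_def]
  have "Re A \<le> lead_const k"
    by (rule LIMSEQ_le_const2 [OF limR]) (use bounds(1) in \<open>auto simp: lead_const_def\<close>)
  \<comment> \<open>First t tends to 0 for fixed N, which removes the harmonic sum, and only then N
    tends to infinity.\<close>
  moreover have "lead_const k \<le> Re A"
  proof -
    have part: "Gamma (1 + 1 / real k) * (\<Sum>n<N. 1 / real (Suc n) powr (1 + 1 / real k)) \<le> Re A" for N
    proof (rule LIMSEQ_le [OF _ limR])
      have "(\<lambda>j. Gamma (1 + 1 / real k) * (\<Sum>n<N. 1 / real (Suc n) powr (1 + 1 / real k)) - \<tau> j * (\<Sum>n<N. 1 / real (Suc n)))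
        \<longlonglongrightarrow> Gamma (1 + 1 / real k) * (\<Sum>n<N. 1 / real (Suc n) powr (1 + 1 / real k)) - 0 * (\<Sum>n<N. 1 / real (Suc n))"
        by (intro tendsto_intros \<tau>0)
      then show "(\<lambda>j. Gamma (1 + 1 / real k) * (\<Sum>n<N. 1 / real (Suc n) powr (1 + 1 / real k)) - \<tau> j * (\<Sum>n<N. 1 / real (Suc n)))
        \<longlonglongrightarrow> Gamma (1 + 1 / real k) * (\<Sum>n<N. 1 / real (Suc n) powr (1 + 1 / real k))"
        by simp
    qed (use bounds(2) in auto)
    have "(\<lambda>N. Gamma (1 + 1 / real k) * (\<Sum>n<N. 1 / real (Suc n) powr (1 + 1 / real k))) \<longlonglongrightarrow> lead_const k"
      unfolding lead_const_def using zeta_real_sums [of "1 + 1 / real k"] k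
      by (intro tendsto_mult tendsto_const) (auto simp: sums_def)
    then show ?thesis
      by (rule LIMSEQ_le_const2) (use part in auto)
  qed
  ultimately have "A = of_real (lead_const k)"
    using ImA by (simp add: complex_eq_iff)
  then show ?thesis
    using A [OF N] by simp
qed

section \<open>Return from the root t to tau = t^k\<close>

definition main_log :: "nat \<Rightarrow> complex \<Rightarrow> complex" where
  "main_log k \<tau> = of_real (lead_const k) * exp (- (Ln \<tau> / of_nat k)) + Ln \<tau> / 2
     - of_real (real k / 2 * ln (2 * pi)) + of_real (zeta_real (- real k) / 2) * \<tau>"

text \<open>The argument of tau is at most 1/16, so that of t is at most 1/(16k); with the cosine at
  least 1/2 this gives slope at most 1/(8k).\<close>

lemma root_in_csector:
  assumes k: "k \<ge> 2" and \<tau>: "Re \<tau> > 0" "\<bar>Im \<tau>\<bar> \<le> Re \<tau> / 16" "norm \<tau> \<le> 1"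
  defines "t \<equiv> exp (Ln \<tau> / of_nat k)"
  shows "t \<in> csector (1 / (8 * real k))" "t ^ k = \<tau>" "Ln t = Ln \<tau> / of_nat k" "norm t \<le> 1"
proof -
  have \<tau>0: "\<tau> \<noteq> 0"
    using \<tau> by auto
  have k0: "real k > 0"
    using k by simp
  define \<theta> where "\<theta> = Im (Ln \<tau>)"
  have "\<bar>\<theta>\<bar> \<le> 1 / (3 * real 1)" and "\<bar>\<theta>\<bar> \<le> 1 / 16"
  proof -
    have "\<theta> = arctan (Im \<tau> / Re \<tau>)"
      unfolding \<theta>_def using \<tau> \<tau>0 by (metis Arg_eq_Im_Ln arg_conv_arctan)
    then have "\<bar>\<theta>\<bar> \<le> \<bar>Im \<tau> / Re \<tau>\<bar>"
      by (simp only: abs_arctan_le)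
    also have "\<dots> \<le> 1 / 16"
      using \<tau> by (simp add: abs_divide field_simps)
    finally show "\<bar>\<theta>\<bar> \<le> 1 / 16" .
    then show "\<bar>\<theta>\<bar> \<le> 1 / (3 * real 1)"
      by simp
  qed
  define \<phi> where "\<phi> = \<theta> / real k"
  have \<phi>: "\<bar>\<phi>\<bar> \<le> 1 / (16 * real k)"
    using \<open>\<bar>\<theta>\<bar> \<le> 1 / 16\<close> k0 by (simp add: \<phi>_def abs_divide field_simps)
  have \<phi>1: "\<bar>\<phi>\<bar> \<le> 1"
  proof -
    have "1 / (16 * real k) \<le> 1"
      using k by (simp add: field_simps)
    then show ?thesis
      using \<phi> by linarith
  qed
  have im: "Im (Ln \<tau> / of_nat k) = \<phi>"
    by (simp add: \<phi>_def \<theta>_def)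
  have re: "Re (Ln \<tau> / of_nat k) = ln (norm \<tau>) / real k"
    using \<tau>0 by simp
  show "t ^ k = \<tau>"
    unfolding t_def using k \<tau>0 by (simp flip: exp_of_nat_mult)
  show "Ln t = Ln \<tau> / of_nat k"
    unfolding t_def using im \<phi>1 pi_gt3 by (intro Ln_exp) auto
  have "ln (norm \<tau>) \<le> 0"
    using \<tau> \<tau>0 by simp
  then show "norm t \<le> 1"
    unfolding t_def norm_exp_eq_Re re using k0 by (simp add: divide_nonpos_pos)
  have cos: "cos \<phi> \<ge> 1 / 2"
  proof -
    have "cos (pi / 3) \<le> cos \<bar>\<phi>\<bar>"
      using \<phi>1 pi_gt3 by (intro cos_monotone_0_pi_le) auto
    then show ?thesis
      by (simp add: cos_60)
  qed
  have "\<bar>sin \<phi>\<bar> \<le> 1 / (16 * real k)"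
    using abs_sin_x_le_abs_x [of \<phi>] \<phi> by linarith
  also have "\<dots> = 1 / (8 * real k) * (1 / 2)"
    by simp
  also have "\<dots> \<le> 1 / (8 * real k) * cos \<phi>"
    using cos by (intro mult_left_mono) auto
  finally have "\<bar>sin \<phi>\<bar> \<le> 1 / (8 * real k) * cos \<phi>" .
  then have "exp (Re (Ln \<tau> / of_nat k)) * \<bar>sin \<phi>\<bar> \<le> exp (Re (Ln \<tau> / of_nat k)) * (1 / (8 * real k) * cos \<phi>)"
    by (rule mult_left_mono) simp
  then show "t \<in> csector (1 / (8 * real k))"
    by (simp only: t_def csector_def mem_Collect_eq Re_exp Im_exp im abs_mult abs_exp_cancel) (simp only: mult_ac)
qed

lemma log_prod_expansion:
  assumes k: "k \<ge> 2"
  shows "\<exists>K. \<forall>\<tau>. Re \<tau> > 0 \<longrightarrow> \<bar>Im \<tau>\<bar> \<le> Re \<tau> / 16 \<longrightarrow> norm \<tau> \<le> 1 \<longrightarrow>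
    norm (log_prod k \<tau> - main_log k \<tau>) \<le> K * norm \<tau> ^ M"
proof -
  \<comment> \<open>One factor t is divided out, and |t|^k = |tau| turns the remaining exponent k(M
    + 1) into M + 1.\<close>
  define N where "N = k * (M + 1) + 1"
  have N: "N \<ge> k + 1"
    by (simp add: N_def)
  obtain K where K: "\<And>t. t \<in> csector (1 / (8 * real k)) \<Longrightarrow> t \<noteq> 0 \<Longrightarrow> norm t \<le> 1 \<Longrightarrow>
    norm (t * log_prod k (t ^ k) - (of_real (lead_const k) + t * (of_real (real k / 2) * (Ln t - of_real (ln (2 * pi)))
       - of_real (fact k * bern_coeff (Suc k) / 2) * t ^ k))) \<le> K * norm t ^ N"
    using log_prod_asymp' [OF k N] by blast
  have "norm (log_prod k \<tau> - main_log k \<tau>) \<le> \<bar>K\<bar> * norm \<tau> ^ M"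
    if \<tau>: "Re \<tau> > 0" "\<bar>Im \<tau>\<bar> \<le> Re \<tau> / 16" "norm \<tau> \<le> 1" for \<tau>
  proof -
    define t where "t = exp (Ln \<tau> / of_nat k)"
    note t = root_in_csector [OF k \<tau>, folded t_def]
    have t0: "t \<noteq> 0"
      by (simp add: t_def)
    have z: "zeta_real (- real k) / 2 = - (fact k * bern_coeff (Suc k) / 2)"
      using zeta_real_neg [of k] k by simp
    have inv: "exp (- (Ln \<tau> / of_nat k)) = 1 / t"
      by (simp add: t_def exp_minus divide_inverse)
    have hk: "of_real (real k / 2) * (Ln \<tau> / of_nat k) = Ln \<tau> / 2"
      using k by simp
    have "t * main_log k \<tau> = of_real (lead_const k) + t * (of_real (real k / 2) * (Ln t - of_real (ln (2 * pi)))
       - of_real (fact k * bern_coeff (Suc k) / 2) * t ^ k)"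
      unfolding main_log_def z inv t(2,3) right_diff_distrib [of "of_real (real k / 2)"] hk
      using t0 by (simp add: algebra_simps)
    then have "norm (t * (log_prod k \<tau> - main_log k \<tau>)) \<le> K * norm t ^ N"
      using K [OF t(1) t0 t(4)] by (simp add: t(2) right_diff_distrib)
    then have "norm t * norm (log_prod k \<tau> - main_log k \<tau>) \<le> norm t * (K * norm t ^ (k * (M + 1)))"
      by (simp add: norm_mult N_def mult_ac)
    then have "norm (log_prod k \<tau> - main_log k \<tau>) \<le> K * norm t ^ (k * (M + 1))"
      using t0 by simp
    also have "norm t ^ (k * (M + 1)) = norm \<tau> ^ (M + 1)"
      by (simp only: power_mult norm_power [symmetric] t(2))
    also have "K * norm \<tau> ^ (M + 1) \<le> \<bar>K\<bar> * norm \<tau> ^ M"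
      using \<tau>(3) by (intro mult_mono power_decreasing) auto
    finally show ?thesis .
  qed
  then show ?thesis
    by blast
qed

section \<open>Powers far from the integers\<close>

definition far_from_ints :: "real \<Rightarrow> real \<Rightarrow> bool" where
  "far_from_ints \<eta> x \<longleftrightarrow> (\<forall>b::int. \<eta> \<le> \<bar>x - of_int b\<bar>)"

text \<open>Multiplying by 2^k enlarges the error from \<open>\<eta>\<close> to at most 1/4. The
  multiple of the old integer and the new nearby integer are then less than 1 apart, hence equal,
  and the error is below \<open>\<eta>\<close> again.\<close>

lemma doubling_chain:
  fixes x \<eta> :: real and a :: int
  assumes \<eta>: "0 < \<eta>" "2 ^ (k + 2) * \<eta> \<le> 1"
    and near: "\<And>j. j \<le> i \<Longrightarrow> \<not> far_from_ints \<eta> (2 ^ (k * j) * x)"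
    and a: "\<bar>x - of_int a\<bar> < \<eta>"
  shows "\<bar>2 ^ (k * i) * x - 2 ^ (k * i) * of_int a\<bar> < \<eta>"
  using near
proof (induction i)
  case 0
  then show ?case using a by simp
next
  case (Suc i)
  then have IH: "\<bar>2 ^ (k * i) * x - 2 ^ (k * i) * of_int a\<bar> < \<eta>"
    by simp
  have "\<not> far_from_ints \<eta> (2 ^ (k * Suc i) * x)"
    using Suc.prems by blast
  then obtain b :: int where b: "\<bar>2 ^ (k * Suc i) * x - of_int b\<bar> < \<eta>"
    by (auto simp: far_from_ints_def not_le)
  have e: "(2::real) ^ (k * Suc i) = 2 ^ k * 2 ^ (k * i)"
    by (simp add: power_add)
  have "\<bar>2 ^ (k * Suc i) * x - 2 ^ (k * Suc i) * of_int a\<bar>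
      = 2 ^ k * \<bar>2 ^ (k * i) * x - 2 ^ (k * i) * of_int a\<bar>"
    unfolding e by (simp add: abs_mult flip: right_diff_distrib)
  also have "\<dots> < 2 ^ k * \<eta>"
    using IH by simp
  finally have c: "\<bar>2 ^ (k * Suc i) * x - 2 ^ (k * Suc i) * of_int a\<bar> < 2 ^ k * \<eta>" .
  have "2 ^ k * \<eta> \<le> 1 / 4"
    using \<eta> by (simp add: power_add)
  moreover have "\<eta> \<le> 2 ^ k * \<eta>"
    using \<eta> by simp
  ultimately have "\<bar>real_of_int b - 2 ^ (k * Suc i) * of_int a\<bar> < 1"
    using b c by linarith
  then have "\<bar>real_of_int (b - 2 ^ (k * Suc i) * a)\<bar> < 1"
    by simp
  then have "b = 2 ^ (k * Suc i) * a"
    by linarith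
  then show ?case
    using b by simp
qed

text \<open>If no member of the chain is far from the integers, \<open>doubling_chain\<close> bounds
  the error by \<open>\<eta>\<close> at the last admissible member, whose k-th power exceeds X/2^k;
  dividing by it gives the approximation to theta.\<close>

lemma chain_dichotomy:
  fixes \<theta> \<eta> X :: real and r :: nat
  assumes \<eta>: "0 < \<eta>" "2 ^ (k + 2) * \<eta> \<le> 1" and k: "k \<ge> 1" and r: "r \<ge> 1" "real r ^ k \<le> X"
  shows "(\<exists>i. real (r * 2 ^ i) ^ k \<le> X \<and> far_from_ints \<eta> (real (r * 2 ^ i) ^ k * \<theta>))
       \<or> (\<exists>a::int. \<bar>\<theta> - of_int a / real r ^ k\<bar> < 2 ^ k * \<eta> / X)"
proof (rule disjCI)
  assume nfar: "\<nexists>a::int. \<bar>\<theta> - of_int a / real r ^ k\<bar> < 2 ^ k * \<eta> / X"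
  show "\<exists>i. real (r * 2 ^ i) ^ k \<le> X \<and> far_from_ints \<eta> (real (r * 2 ^ i) ^ k * \<theta>)"
  proof (rule ccontr)
    assume "\<not> ?thesis"
    then have near: "\<not> far_from_ints \<eta> (real (r * 2 ^ i) ^ k * \<theta>)" if "real (r * 2 ^ i) ^ k \<le> X" for i
      using that by blast
    define P where "P i \<longleftrightarrow> real (r * 2 ^ i) ^ k \<le> X" for i
    have bnd: "i \<le> nat \<lfloor>X\<rfloor>" if "P i" for i
    proof -
      have "real i \<le> real (2 ^ i)"
        using of_nat_less_two_power [of i, where 'a = real] by simp
      also have "\<dots> \<le> real (r * 2 ^ i)"
        using r by simp
      also have "\<dots> \<le> real (r * 2 ^ i) ^ k"
      proof (rule self_le_power)
        have "1 \<le> r * 2 ^ i"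
          using r by simp
        then have "real 1 \<le> real (r * 2 ^ i)"
          by (rule of_nat_mono)
        then show "1 \<le> real (r * 2 ^ i)"
          by (simp only: of_nat_1)
      qed (use k in simp)
      also have "\<dots> \<le> X"
        using that by (simp add: P_def)
      finally show ?thesis by linarith
    qed
    \<comment> \<open>The last member of the chain whose k-th power is at most X; \<open>nPi\<close>
      supplies the lower bound X/2^k for that power.\<close>
    define i where "i = (GREATEST i. P i)"
    have P0: "P 0"
      using r by (simp add: P_def)
    have Pi: "P i"
      unfolding i_def by (rule GreatestI_nat [where P = P, OF P0]) (use bnd in blast)
    have nPi: "\<not> P (Suc i)"
    proof
      assume "P (Suc i)"
      then have "Suc i \<le> i"
        unfolding i_def by (rule Greatest_le_nat) (use bnd in blast)
      then show False by simp
    qed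
    have Pj: "P j" if "j \<le> i" for j
    proof -
      have "real (r * 2 ^ j) ^ k \<le> real (r * 2 ^ i) ^ k"
        using that by (intro power_mono) (auto intro!: mult_left_mono power_increasing)
      then show ?thesis
        using Pi by (simp add: P_def)
    qed
    have e: "real (r * 2 ^ j) ^ k * \<theta> = 2 ^ (k * j) * (real r ^ k * \<theta>)" for j
      by (simp add: power_mult_distrib mult_ac flip: power_mult)
    obtain a :: int where a: "\<bar>real r ^ k * \<theta> - of_int a\<bar> < \<eta>"
      using near [of 0] r by (auto simp: far_from_ints_def not_le)
    have "\<bar>2 ^ (k * i) * (real r ^ k * \<theta>) - 2 ^ (k * i) * of_int a\<bar> < \<eta>"
      by (rule doubling_chain [OF \<eta> _ a]) (use near Pj e in \<open>metis P_def\<close>)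
    then have "2 ^ (k * i) * \<bar>real r ^ k * \<theta> - of_int a\<bar> < \<eta>"
      by (simp add: abs_mult flip: right_diff_distrib)
    moreover have "\<bar>real r ^ k * \<theta> - of_int a\<bar> = real r ^ k * \<bar>\<theta> - of_int a / real r ^ k\<bar>"
    proof -
      have "real r ^ k * \<theta> - of_int a = real r ^ k * (\<theta> - of_int a / real r ^ k)"
        using r by (simp add: field_simps)
      then show ?thesis
        by (simp add: abs_mult)
    qed
    ultimately have l: "real (r * 2 ^ i) ^ k * \<bar>\<theta> - of_int a / real r ^ k\<bar> < \<eta>"
      by (simp add: power_mult_distrib mult_ac flip: power_mult)
    have X: "X < 2 ^ k * real (r * 2 ^ i) ^ k"
      using nPi by (simp add: P_def not_le power_mult_distrib mult_ac)
    have X0: "X > 0"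
    proof -
      have "0 < real r ^ k"
        using r by simp
      then show ?thesis
        using r(2) by linarith
    qed
    have "X * \<bar>\<theta> - of_int a / real r ^ k\<bar> \<le> (2 ^ k * real (r * 2 ^ i) ^ k) * \<bar>\<theta> - of_int a / real r ^ k\<bar>"
      using X by (intro mult_right_mono) auto
    also have "\<dots> < 2 ^ k * \<eta>"
      using l by (simp add: mult_ac)
    finally have "\<bar>\<theta> - of_int a / real r ^ k\<bar> < 2 ^ k * \<eta> / X"
      using X0 by (simp add: field_simps)
    then show False
      using nfar by blast
  qed
qed

lemma coprime_odd_succ: "coprime (4 * j + 1) (4 * j + 3 :: nat)"
proof -
  have "gcd (4 * j + 1) (4 * j + 3 :: nat) dvd (4 * j + 3) - (4 * j + 1)"
    by (intro dvd_diff_nat) auto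
  then have "gcd (4 * j + 1) (4 * j + 3 :: nat) dvd 2"
    by simp
  moreover have "odd (gcd (4 * j + 1) (4 * j + 3 :: nat))"
    by (metis even_add even_mult_iff even_numeral gcd_dvd1 dvd_trans odd_one)
  ultimately have "gcd (4 * j + 1) (4 * j + 3 :: nat) = 1"
    by (metis dvd_refl prime_nat_iff two_is_prime_nat)
  then show ?thesis
    by (simp add: coprime_iff_gcd_eq_1)
qed

text \<open>Otherwise theta is close to fractions with denominators r^k and s^k. Distinct such
  fractions are at least 1/(r^k s^k), hence 1/X, apart, more than the two errors allow. Equal ones
  are an integer by coprimality, and it is 0 because |theta| is at most 1/2; but theta is not that
  close to 0.\<close>

lemma two_consecutive_chains:
  fixes \<theta> \<eta> X :: real and j :: nat
  assumes \<eta>: "0 < \<eta>" "2 ^ (k + 2) * \<eta> \<le> 1" and k: "k \<ge> 1" and X: "X \<ge> 1"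
    and j: "real (4 * j + 3) ^ (2 * k) \<le> X"
    and \<theta>: "\<bar>\<theta>\<bar> \<le> 1 / 2" "\<bar>\<theta>\<bar> \<ge> 2 ^ k * \<eta> / X"
  shows "\<exists>r i. r \<in> {4 * j + 1, 4 * j + 3} \<and> real (r * 2 ^ i) ^ k \<le> X \<and> far_from_ints \<eta> (real (r * 2 ^ i) ^ k * \<theta>)"
proof (rule ccontr)
  assume no: "\<not> ?thesis"
  define r s where "r = 4 * j + 1" and "s = 4 * j + 3"
  have rs: "r \<ge> 1" "s \<ge> 1" "r \<le> s"
    by (auto simp: r_def s_def)
  have "real s ^ k \<le> real s ^ (2 * k)"
    using rs by (intro power_increasing) auto
  then have sX: "real s ^ k \<le> X"
    using j unfolding s_def by linarith
  have "real r ^ k \<le> real s ^ k"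
    using rs by (intro power_mono) auto
  then have rX: "real r ^ k \<le> X"
    using sX by linarith
  obtain a :: int where a: "\<bar>\<theta> - of_int a / real r ^ k\<bar> < 2 ^ k * \<eta> / X"
    using chain_dichotomy [OF \<eta> k rs(1) rX, of \<theta>] no unfolding r_def by blast
  obtain b :: int where b: "\<bar>\<theta> - of_int b / real s ^ k\<bar> < 2 ^ k * \<eta> / X"
    using chain_dichotomy [OF \<eta> k rs(2) sX, of \<theta>] no unfolding s_def by blast
  have \<eta>4: "2 ^ k * \<eta> \<le> 1 / 4"
    using \<eta> by (simp add: power_add)
  have "real r ^ k * real s ^ k \<le> real s ^ k * real s ^ k"
    using rs by (intro mult_right_mono power_mono) auto
  also have "\<dots> \<le> X"
    using j by (simp add: s_def mult_2 power_add)
  finally have rsX: "real r ^ k * real s ^ k \<le> X" .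
  have "\<bar>of_int a / real r ^ k - of_int b / real s ^ k\<bar> < 2 * (2 ^ k * \<eta> / X)"
    using a b by linarith
  moreover have "of_int a / real r ^ k - of_int b / real s ^ k
      = real_of_int (a * int s ^ k - b * int r ^ k) / (real r ^ k * real s ^ k)"
    using rs by (simp add: field_simps)
  ultimately have "\<bar>real_of_int (a * int s ^ k - b * int r ^ k)\<bar> / (real r ^ k * real s ^ k) < 2 * (2 ^ k * \<eta> / X)"
    by (simp add: abs_divide)
  then have "\<bar>real_of_int (a * int s ^ k - b * int r ^ k)\<bar> < 2 * (2 ^ k * \<eta> / X) * (real r ^ k * real s ^ k)"
    using rs by (simp add: pos_divide_less_eq)
  also have "\<dots> \<le> 2 * (2 ^ k * \<eta> / X) * X"
    using rsX \<eta> X by (intro mult_left_mono) auto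
  also have "\<dots> = 2 * (2 ^ k * \<eta>)"
    using X by simp
  also have "\<dots> < 1"
    using \<eta>4 by linarith
  finally have eq: "a * int s ^ k = b * int r ^ k"
    by linarith
  have "coprime (int r ^ k) (int s ^ k)"
  proof -
    have "coprime (int r) (int s)"
      using coprime_odd_succ [of j] unfolding r_def s_def by (simp only: coprime_int_iff)
    then show ?thesis
      by simp
  qed
  moreover have "int r ^ k dvd a * int s ^ k"
    by (simp add: eq)
  ultimately have "int r ^ k dvd a"
    by (simp add: coprime_dvd_mult_left_iff)
  then obtain c where c: "a = int r ^ k * c"
    by blast
  have "of_int a / real r ^ k = of_int c"
    using rs by (simp add: c)
  then have cc: "\<bar>\<theta> - of_int c\<bar> < 2 ^ k * \<eta> / X"
    using a by simp
  also have "2 ^ k * \<eta> / X \<le> 2 ^ k * \<eta> / 1"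
    using X \<eta> by (intro divide_left_mono) auto
  finally have "\<bar>real_of_int c\<bar> < 1"
    using \<theta>(1) \<eta>4 by linarith
  then have "c = 0"
    by linarith
  then show False
    using cc \<theta>(2) by simp
qed

text \<open>Each pair 4j + 1, 4j + 3 with 4j + 3 at most R = X^(1/(2k)) contributes one number;
  there are about R/4 pairs. The numbers are distinct, since the odd part of each determines
  j.\<close>

lemma many_far_powers:
  fixes \<theta> \<eta> X :: real
  assumes \<eta>: "0 < \<eta>" "2 ^ (k + 2) * \<eta> \<le> 1" and k: "k \<ge> 1" and X: "X \<ge> 1"
    and \<theta>: "\<bar>\<theta>\<bar> \<le> 1 / 2" "\<bar>\<theta>\<bar> \<ge> 2 ^ k * \<eta> / X"
  obtains B :: "nat set" where "finite B" "real (card B) \<ge> X powr (1 / (2 * real k)) / 4 - 1"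
    "\<And>m. m \<in> B \<Longrightarrow> m \<ge> 1 \<and> real m ^ k \<le> X \<and> far_from_ints \<eta> (real m ^ k * \<theta>)"
proof -
  define R where "R = X powr (1 / (2 * real k))"
  define J where "J = {j. real (4 * j + 3) \<le> R}"
  have R: "R ^ (2 * k) = X"
    using k X by (simp add: R_def powr_powr flip: powr_realpow)
  have R1: "R \<ge> 1"
    using X by (simp add: R_def ge_one_powr_ge_zero)
  have ex: "\<exists>r i. r \<in> {4 * j + 1, 4 * j + 3} \<and> real (r * 2 ^ i) ^ k \<le> X \<and>
      far_from_ints \<eta> (real (r * 2 ^ i) ^ k * \<theta>)" if "j \<in> J" for j
  proof (rule two_consecutive_chains [OF \<eta> k X _ \<theta>])
    have "real (4 * j + 3) ^ (2 * k) \<le> R ^ (2 * k)"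
      using that by (intro power_mono) (auto simp: J_def)
    then show "real (4 * j + 3) ^ (2 * k) \<le> X"
      by (simp only: R)
  qed
  then obtain r i where ri: "\<And>j. j \<in> J \<Longrightarrow> r j \<in> {4 * j + 1, 4 * j + 3} \<and> real (r j * 2 ^ i j) ^ k \<le> X \<and>
      far_from_ints \<eta> (real (r j * 2 ^ i j) ^ k * \<theta>)"
    by metis
  define m where "m j = r j * 2 ^ i j" for j
  have Jfin: "finite J"
  proof (rule finite_subset)
    show "J \<subseteq> {..nat \<lfloor>R\<rfloor>}"
    proof
      fix j assume "j \<in> J"
      then have "real j \<le> R" by (simp add: J_def)
      then show "j \<in> {..nat \<lfloor>R\<rfloor>}" by (simp add: le_nat_floor)
    qed
  qed simp
  have inj: "inj_on m J"
  proof
    fix x y assume xy: "x \<in> J" "y \<in> J" "m x = m y"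
    have odd: "odd (r x)" "odd (r y)"
      using ri [OF xy(1)] ri [OF xy(2)] by auto
    \<comment> \<open>Uniqueness of the exponent of 2: this power of two is coprime to the odd
      factor b.\<close>
    have le: "i' \<le> i''" if "a * 2 ^ i' = b * 2 ^ i''" "odd b" for a b i' i'' :: nat
    proof -
      have "(2::nat) ^ i' dvd b * 2 ^ i''"
        by (metis dvd_triv_right that(1))
      moreover have "coprime ((2::nat) ^ i') b"
        using that(2) by simp
      ultimately have "(2::nat) ^ i' dvd 2 ^ i''"
        by (simp add: coprime_dvd_mult_right_iff)
      then show ?thesis
        by (simp add: power_dvd_imp_le)
    qed
    have "i x = i y"
      using le [of "r x" "i x" "r y" "i y"] le [of "r y" "i y" "r x" "i x"] xy(3) odd by (simp add: m_def)
    then have "r x = r y"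
      using xy(3) by (simp add: m_def)
    then show "x = y"
      using ri [OF xy(1)] ri [OF xy(2)] by auto
  qed
  have "real (card J) \<ge> R / 4 - 1"
  proof (cases "R \<ge> 3")
    case True
    have "{..nat \<lfloor>(R - 3) / 4\<rfloor>} \<subseteq> J"
    proof
      fix j assume "j \<in> {..nat \<lfloor>(R - 3) / 4\<rfloor>}"
      then have "real j \<le> (R - 3) / 4"
        using True by (simp add: le_nat_iff le_floor_iff)
      then show "j \<in> J"
        by (simp add: J_def)
    qed
    then have "Suc (nat \<lfloor>(R - 3) / 4\<rfloor>) \<le> card J"
      using card_mono [OF Jfin, of "{..nat \<lfloor>(R - 3) / 4\<rfloor>}"] by (simp only: card_atMost)
    moreover have "real (Suc (nat \<lfloor>(R - 3) / 4\<rfloor>)) \<ge> (R - 3) / 4"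
      using True by linarith
    ultimately show ?thesis
      by auto
  qed simp
  then have c: "real (card (m ` J)) \<ge> R / 4 - 1"
    by (simp add: card_image inj)
  show ?thesis
  proof (rule that [of "m ` J"])
    show "finite (m ` J)" using Jfin by simp
    show "real (card (m ` J)) \<ge> X powr (1 / (2 * real k)) / 4 - 1"
      using c by (simp add: R_def)
    fix n assume "n \<in> m ` J"
    then obtain j where j: "j \<in> J" "n = m j" by blast
    then show "n \<ge> 1 \<and> real n ^ k \<le> X \<and> far_from_ints \<eta> (real n ^ k * \<theta>)"
      using ri [OF j(1)] by (auto simp: m_def)
  qed
qed

section \<open>The generating function\<close>

text \<open>An arbitrary set of admissible parts allows the product to be built one factor at a
  time, adding the largest part last.\<close>

definition parts_in :: "nat set \<Rightarrow> nat \<Rightarrow> nat list set" where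
  "parts_in A n = {xs. is_partition n xs \<and> set xs \<subseteq> A}"

lemma finite_parts_in: "finite (parts_in A n)"
proof (rule finite_subset)
  show "parts_in A n \<subseteq> {xs. set xs \<subseteq> {..n} \<and> length xs \<le> n}"
  proof
    fix xs assume "xs \<in> parts_in A n"
    then have pos: "\<forall>x\<in>set xs. x > 0" and s: "sum_list xs = n"
      by (auto simp: parts_in_def is_partition_def)
    have "length xs \<le> sum_list xs"
      using pos by (induction xs) auto
    then show "xs \<in> {xs. set xs \<subseteq> {..n} \<and> length xs \<le> n}"
      using member_le_sum_list s by auto
  qed
  show "finite {xs. set xs \<subseteq> {..n} \<and> length xs \<le> n}"
    by (rule finite_lists_length_le) simp
qed

text \<open>The lists are non-increasing, so the largest admissible part, if it occurs, stands at
  the head; removing one copy leaves a list of the same kind.\<close>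

lemma parts_in_insert:
  assumes a: "a > 0" and mx: "\<And>x. x \<in> A \<Longrightarrow> x < a"
  shows "parts_in (insert a A) n =
    parts_in A n \<union> (if a \<le> n then Cons a ` parts_in (insert a A) (n - a) else {})"
proof (intro equalityI subsetI)
  fix xs assume xs: "xs \<in> parts_in (insert a A) n"
  show "xs \<in> parts_in A n \<union> (if a \<le> n then Cons a ` parts_in (insert a A) (n - a) else {})"
  proof (cases "a \<in> set xs")
    case False
    then show ?thesis
      using xs by (auto simp: parts_in_def)
  next
    case True
    then obtain y ys where y: "xs = y # ys"
      by (cases xs) auto
    have "y \<ge> a" "y \<in> insert a A"
      using xs True by (auto simp: y parts_in_def is_partition_def)
    then have [simp]: "y = a"
      using mx [of y] by auto
    have "a \<le> n" "ys \<in> parts_in (insert a A) (n - a)"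
      using xs by (auto simp: y parts_in_def is_partition_def)
    then show ?thesis
      by (auto simp: y)
  qed
next
  fix xs assume xs: "xs \<in> parts_in A n \<union> (if a \<le> n then Cons a ` parts_in (insert a A) (n - a) else {})"
  show "xs \<in> parts_in (insert a A) n"
  proof (cases "xs \<in> parts_in A n")
    case True
    then show ?thesis
      by (auto simp: parts_in_def)
  next
    case False
    then obtain ys where "a \<le> n" "xs = a # ys" "ys \<in> parts_in (insert a A) (n - a)"
      using xs by (auto split: if_splits)
    then show ?thesis
      using a mx by (auto simp: parts_in_def is_partition_def intro: less_imp_le)
  qed
qed

lemma card_parts_in_insert:
  assumes a: "a > 0" and mx: "\<And>x. x \<in> A \<Longrightarrow> x < a"
  shows "card (parts_in (insert a A) n) =
    card (parts_in A n) + (if a \<le> n then card (parts_in (insert a A) (n - a)) else 0)"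
proof -
  have "a \<notin> A"
    using mx by blast
  then have "parts_in A n \<inter> Cons a ` parts_in (insert a A) (n - a) = {}"
    by (auto simp: parts_in_def)
  then show ?thesis
    by (subst parts_in_insert [OF assms])
       (auto simp: card_Un_disjoint finite_parts_in card_image)
qed

definition parts_fps :: "nat set \<Rightarrow> complex fps" where
  "parts_fps A = Abs_fps (\<lambda>n. of_nat (card (parts_in A n)))"

lemma parts_fps_insert:
  assumes a: "a > 0" and mx: "\<And>x. x \<in> A \<Longrightarrow> x < a"
  shows "parts_fps (insert a A) * (1 - fps_X ^ a) = parts_fps A"
proof (rule fps_ext)
  fix n
  show "fps_nth (parts_fps (insert a A) * (1 - fps_X ^ a)) n = fps_nth (parts_fps A) n"
    using card_parts_in_insert [OF assms, where n = n]
    by (auto simp: right_diff_distrib fps_X_power_mult_right_nth parts_fps_def)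
qed

lemma parts_fps_empty: "parts_fps {} = 1"
proof -
  have "parts_in {} n = (if n = 0 then {[]} else {})" for n
    by (auto simp: parts_in_def is_partition_def)
  then show ?thesis
    by (intro fps_ext) (simp add: parts_fps_def)
qed

lemma parts_fps_powers:
  assumes k: "k \<ge> 1"
  shows "parts_fps ((\<lambda>m. m ^ k) ` {1..M}) = (\<Prod>m=1..M. inverse (1 - fps_X ^ (m ^ k)))"
proof (induction M)
  case 0
  then show ?case by (simp add: parts_fps_empty)
next
  case (Suc M)
  let ?f = "1 - fps_X ^ (Suc M ^ k) :: complex fps"
  have "parts_fps (insert (Suc M ^ k) ((\<lambda>m. m ^ k) ` {1..M})) * ?f = parts_fps ((\<lambda>m. m ^ k) ` {1..M})"
    using k by (intro parts_fps_insert) (auto intro!: power_strict_mono)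
  moreover have "insert (Suc M ^ k) ((\<lambda>m. m ^ k) ` {1..M}) = (\<lambda>m. m ^ k) ` {1..Suc M}"
    by (simp add: atLeastAtMostSuc_conv)
  ultimately have *: "parts_fps ((\<lambda>m. m ^ k) ` {1..Suc M}) * ?f = parts_fps ((\<lambda>m. m ^ k) ` {1..M})"
    by simp
  have inv: "?f * inverse ?f = 1"
    by (rule inverse_mult_eq_1') (simp add: fps_X_power_nth)
  from * have "parts_fps ((\<lambda>m. m ^ k) ` {1..Suc M}) * (?f * inverse ?f) = parts_fps ((\<lambda>m. m ^ k) ` {1..M}) * inverse ?f"
    by (simp only: flip: mult.assoc)
  then have "parts_fps ((\<lambda>m. m ^ k) ` {1..Suc M}) = parts_fps ((\<lambda>m. m ^ k) ` {1..M}) * inverse ?f"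
    by (simp only: inv mult_1_right)
  then show ?case
    using Suc.IH by (simp add: atLeastAtMostSuc_conv mult.commute del: power_Suc)
qed

text \<open>A part m^k of a partition of n has m at most n. A finite product with M at least n
  therefore has the exact coefficient, and Cauchy's formula can be used before any limit in
  M.\<close>

lemma power_partitions_conv_parts_in:
  assumes k: "k \<ge> 1" and n: "n \<le> M"
  shows "power_partitions k n = parts_in ((\<lambda>m. m ^ k) ` {1..M}) n"
proof -
  have "m \<in> {1..M}" if "m ^ k \<in> set xs" "\<forall>x\<in>set xs. x > 0" "sum_list xs = n" for xs m
  proof -
    have "m > 0"
      using that k by (cases m) auto
    moreover have "m ^ k \<le> n"
      using that member_le_sum_list by fastforce
    moreover have "m \<le> m ^ k"
      using \<open>m > 0\<close> k by (intro self_le_power) auto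
    ultimately show ?thesis
      using n by simp
  qed
  then show ?thesis
    unfolding power_partitions_def parts_in_def is_partition_def by auto
qed

definition Fprod :: "nat \<Rightarrow> nat \<Rightarrow> complex \<Rightarrow> complex" where
  "Fprod k M \<tau> = (\<Prod>m=1..M. inverse (1 - exp (- (of_nat (m ^ k) * \<tau>))))"

lemma power_partition_count_deriv:
  assumes k: "k \<ge> 1" and n: "n \<le> M"
  shows "of_nat (power_partition_count k n) =
    (deriv ^^ n) (\<lambda>z. \<Prod>m=1..M. inverse (1 - z ^ (m ^ k))) 0 / (fact n :: complex)"
proof -
  have "(\<lambda>z::complex. \<Prod>m=1..M. inverse (1 - z ^ (m ^ k))) has_fps_expansion
      (\<Prod>m=1..M. inverse (1 - fps_X ^ (m ^ k)))"
    by (intro has_fps_expansion_prod has_fps_expansion_inverse has_fps_expansion_diff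
         has_fps_expansion_1 has_fps_expansion_fps_X_power) (auto simp: fps_X_power_nth)
  from fps_nth_fps_expansion [OF this, of n] show ?thesis
    unfolding parts_fps_powers [OF k, symmetric]
    by (simp add: parts_fps_def power_partition_count_def power_partitions_conv_parts_in [OF assms])
qed

lemma has_integral_periodic_shift:
  fixes h :: "real \<Rightarrow> complex"
  assumes per: "\<And>x. h (x + 2 * pi) = h x" and h: "(h has_integral I) {0..2 * pi}"
  shows "(h has_integral I) {-pi..pi}"
proof -
  have int: "h integrable_on {0..2 * pi}"
    using h by blast
  have 1: "(h has_integral integral {0..pi} h) {0..pi}"
    using integrable_subinterval_real [OF int, of 0 pi] by auto
  have 2: "(h has_integral integral {pi..2*pi} h) {pi..2 * pi}"
    using integrable_subinterval_real [OF int, of pi "2 * pi"] by auto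
  have "I = integral {0..pi} h + integral {pi..2*pi} h"
    using has_integral_combine [OF _ _ 1 2] h by (auto intro: has_integral_unique)
  moreover have "((\<lambda>x. h (x + 2 * pi)) has_integral integral {pi..2*pi} h) {pi - 2 * pi..2 * pi - 2 * pi}"
    using has_integral_shift_real_ivl [OF 2] .
  then have 3: "(h has_integral integral {pi..2*pi} h) {-pi..0}"
    by (simp add: per)
  have "(h has_integral integral {pi..2*pi} h + integral {0..pi} h) {-pi..pi}"
    using has_integral_combine [OF _ _ 3 1] by simp
  ultimately show ?thesis
    by (simp add: add.commute)
qed

text \<open>Cauchy's formula for the coefficient of order n on the circle of radius
  exp(-\<open>\<sigma>\<close>), where the finite product is holomorphic.\<close>

lemma power_partition_count_integral:
  assumes k: "k \<ge> 1" and n: "n \<le> M" and \<sigma>: "\<sigma> > 0"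
  shows "((\<lambda>v. Fprod k M (Complex \<sigma> v) * exp (of_nat n * Complex \<sigma> v))
            has_integral 2 * pi * of_nat (power_partition_count k n)) {-pi..pi}"
proof -
  define f where "f z = (\<Prod>m=1..M. inverse (1 - z ^ (m ^ k)))" for z :: complex
  define r where "r = exp (- \<sigma>)"
  have r: "0 < r" "r < 1"
    using \<sigma> by (auto simp: r_def)
  have ne: "z ^ (m ^ k) \<noteq> 1" if "norm z < 1" "m \<ge> 1" for z :: complex and m
  proof
    assume "z ^ (m ^ k) = 1"
    then have "norm z ^ (m ^ k) = 1"
      by (metis norm_one norm_power)
    moreover have "norm z ^ (m ^ k) < 1"
      using that by (intro power_Suc_less_one [of "norm z" "m ^ k - 1", simplified] | simp add: power_less_one_iff)+
    ultimately show False by simp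
  qed
  have hol: "f holomorphic_on ball 0 1"
    unfolding f_def by (intro holomorphic_intros) (use ne in auto)
  have contf: "continuous_on (cball 0 r) f" and holf: "f holomorphic_on ball 0 r"
    using r by (auto intro!: holomorphic_on_imp_continuous_on holomorphic_on_subset [OF hol])
  have "((\<lambda>u. f u / (u - 0) ^ Suc n) has_contour_integral (2 * pi * \<i>) / fact n * (deriv ^^ n) f 0) (circlepath 0 r)"
    using r by (intro Cauchy_has_contour_integral_higher_derivative_circlepath contf holf) auto
  also have "(2 * pi * \<i>) / fact n * (deriv ^^ n) f 0 = 2 * pi * \<i> * of_nat (power_partition_count k n)"
    by (simp add: power_partition_count_deriv [OF k n] f_def [abs_def])
  finally have "((\<lambda>t. f (r * cis t) / (r * cis t) ^ Suc n * r * \<i> * cis t) has_integral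
      2 * pi * \<i> * of_nat (power_partition_count k n)) {0..2 * pi}"
    unfolding circlepath_def by (subst (asm) has_contour_integral_part_circlepath_iff) auto
  from has_integral_mult_right [OF this, of "- \<i>"]
  have "((\<lambda>t. f (r * cis t) / (r * cis t) ^ n) has_integral
      2 * pi * of_nat (power_partition_count k n)) {0..2 * pi}"
    using r by (simp add: mult_ac)
  from has_integral_periodic_shift [OF _ this]
  have "((\<lambda>t. f (r * cis t) / (r * cis t) ^ n) has_integral
      2 * pi * of_nat (power_partition_count k n)) {-pi..pi}"
    by (simp flip: cis_mult)
  \<comment> \<open>The point exp(-(\<open>\<sigma>\<close> + i v)) runs through the circle
    clockwise, hence the reflection.\<close>
  then have "((\<lambda>t. f (r * cis (- t)) / (r * cis (- t)) ^ n) has_integral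
      2 * pi * of_nat (power_partition_count k n)) {-pi..pi}"
    by (subst has_integral_reflect_real [symmetric]) simp
  also have "(\<lambda>t. f (r * cis (- t)) / (r * cis (- t)) ^ n) =
      (\<lambda>v. Fprod k M (Complex \<sigma> v) * exp (of_nat n * Complex \<sigma> v))"
  proof
    fix v
    have e: "of_real r * cis (- v) = exp (- Complex \<sigma> v)"
      by (simp add: exp_eq_polar r_def)
    show "f (r * cis (- v)) / (r * cis (- v)) ^ n = Fprod k M (Complex \<sigma> v) * exp (of_nat n * Complex \<sigma> v)"
      unfolding e f_def Fprod_def by (simp flip: exp_of_nat_mult add: exp_minus field_simps)
  qed
  finally show ?thesis .
qed

section \<open>Minor arcs\<close>

lemma summable_log_prod_terms:
  assumes k: "k \<ge> 1" and \<tau>: "Re \<tau> > 0"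
  shows "summable (\<lambda>m. - Ln (1 - exp (- (of_nat (Suc m ^ k) * \<tau>))))"
proof -
  let ?q = "\<lambda>m. exp (- (of_nat (Suc m ^ k) * \<tau>))"
  have q: "norm (?q m) \<le> exp (- Re \<tau>) ^ m" for m
  proof -
    have "m \<le> Suc m ^ k"
      using k self_le_power [of "Suc m" k] by simp
    then have "real m \<le> real (Suc m ^ k)"
      by (rule of_nat_mono)
    then have "real m * Re \<tau> \<le> real (Suc m ^ k) * Re \<tau>"
      using \<tau> by (intro mult_right_mono) auto
    moreover have "norm (?q m) = exp (- (real (Suc m ^ k) * Re \<tau>))"
      by (simp only: norm_exp_eq_Re uminus_complex.sel times_complex.sel complex_Re_of_nat complex_Im_of_nat) simp
    ultimately have "norm (?q m) \<le> exp (real m * (- Re \<tau>))"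
      by simp
    then show ?thesis
      by (simp only: exp_of_nat_mult)
  qed
  have geo: "summable (\<lambda>m. exp (- Re \<tau>) ^ m)"
    using \<tau> by (intro summable_geometric) simp
  have "(\<lambda>m. exp (- Re \<tau>) ^ m) \<longlonglongrightarrow> 0"
    using \<tau> by (intro LIMSEQ_power_zero) simp
  then have "eventually (\<lambda>m. exp (- Re \<tau>) ^ m < 1 / 2) sequentially"
    by (rule order_tendstoD) simp
  then have "eventually (\<lambda>m. norm (- Ln (1 - ?q m)) \<le> 2 * exp (- Re \<tau>) ^ m) sequentially"
  proof eventually_elim
    case (elim m)
    then have "norm (- ?q m) < 1 / 2"
      using q [of m] by simp
    from norm_Ln_le [OF this] show ?case
      using q [of m] by simp
  qed
  then show ?thesis
    by (rule summable_comparison_test_ev) (intro summable_mult geo)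
qed

lemma norm_exp_less_1:
  assumes "Re \<tau> > 0" "m \<ge> 1"
  shows "norm (exp (- (of_nat m * \<tau>))) = exp (- (real m * Re \<tau>))" "exp (- (real m * Re \<tau>)) < 1"
  using assms by auto

lemma Fprod_limit:
  assumes k: "k \<ge> 1" and \<tau>: "Re \<tau> > 0"
  shows "(\<lambda>M. Fprod k M \<tau>) \<longlonglongrightarrow> exp (log_prod k \<tau>)"
proof -
  have "(\<lambda>M. exp (\<Sum>m<M. - Ln (1 - exp (- (of_nat (Suc m ^ k) * \<tau>))))) \<longlonglongrightarrow> exp (log_prod k \<tau>)"
    unfolding log_prod_def by (intro tendsto_intros summable_LIMSEQ summable_log_prod_terms assms)
  moreover have "exp (\<Sum>m<M. - Ln (1 - exp (- (of_nat (Suc m ^ k) * \<tau>)))) = Fprod k M \<tau>" for M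
  proof -
    have "exp (\<Sum>m<M. - Ln (1 - exp (- (of_nat (Suc m ^ k) * \<tau>)))) = (\<Prod>m<M. exp (- Ln (1 - exp (- (of_nat (Suc m ^ k) * \<tau>)))))"
      by (rule exp_sum) simp
    also have "\<dots> = (\<Prod>m<M. inverse (1 - exp (- (of_nat (Suc m ^ k) * \<tau>))))"
    proof (rule prod.cong)
      fix m
      have "norm (exp (- (of_nat (Suc m ^ k) * \<tau>))) < 1"
        using norm_exp_less_1 [OF \<tau>, of "Suc m ^ k"] by simp
      then have "1 - exp (- (of_nat (Suc m ^ k) * \<tau>)) \<noteq> 0"
        by (metis eq_iff_diff_eq_0 less_irrefl norm_one)
      then show "exp (- Ln (1 - exp (- (of_nat (Suc m ^ k) * \<tau>)))) = inverse (1 - exp (- (of_nat (Suc m ^ k) * \<tau>)))"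
        by (simp only: exp_minus exp_Ln not_False_eq_True)
    qed simp
    also have "\<dots> = Fprod k M \<tau>"
      unfolding Fprod_def by (rule prod.reindex_bij_witness [of _ "\<lambda>k. k - 1" Suc]) auto
    finally show ?thesis .
  qed
  ultimately show ?thesis
    by simp
qed

lemma norm_one_minus_exp:
  assumes "\<sigma> > 0"
  shows "norm (1 - exp (- (of_nat m * Complex \<sigma> v))) ^ 2 =
     (1 - exp (- (real m * \<sigma>))) ^ 2 + 2 * exp (- (real m * \<sigma>)) * (1 - cos (real m * v))"
proof -
  define r x where "r = exp (- (real m * \<sigma>))" and "x = real m * v"
  have "Re (exp (- (of_nat m * Complex \<sigma> v))) = r * cos x" "Im (exp (- (of_nat m * Complex \<sigma> v))) = - (r * sin x)"
    by (simp_all add: Re_exp Im_exp r_def x_def)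
  then have "norm (1 - exp (- (of_nat m * Complex \<sigma> v))) ^ 2 = (1 - r * cos x) ^ 2 + (r * sin x) ^ 2"
    by (simp add: cmod_power2)
  also have "\<dots> = (1 - r * cos x) ^ 2 + r ^ 2 * (1 - (cos x) ^ 2)"
    by (simp add: power_mult_distrib sin_squared_eq)
  also have "\<dots> = (1 - r) ^ 2 + 2 * r * (1 - cos x)"
    by (simp add: power2_eq_square algebra_simps)
  finally show ?thesis
    by (simp add: r_def x_def)
qed

lemma norm_one_minus_exp_ge:
  assumes "\<sigma> > 0"
  shows "norm (1 - exp (- (of_nat m * Complex \<sigma> v))) \<ge> 1 - exp (- (real m * \<sigma>))"
proof (rule power2_le_imp_le)
  have "0 \<le> 2 * exp (- (real m * \<sigma>)) * (1 - cos (real m * v))"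
    by (intro mult_nonneg_nonneg) auto
  then show "(1 - exp (- (real m * \<sigma>))) ^ 2 \<le> norm (1 - exp (- (of_nat m * Complex \<sigma> v))) ^ 2"
    unfolding norm_one_minus_exp [OF assms] by linarith
qed simp

lemma cos_far_from_ints:
  assumes \<eta>: "0 < \<eta>" and x: "far_from_ints \<eta> x"
  shows "cos (2 * pi * x) \<le> cos (2 * pi * \<eta>)"
proof -
  define b where "b = round x"
  define y where "y = x - of_int b"
  have y: "\<eta> \<le> \<bar>y\<bar>" "\<bar>y\<bar> \<le> 1 / 2"
    using x of_int_round_abs_le [of x] by (auto simp: far_from_ints_def y_def b_def abs_minus_commute)
  have "2 * pi * x = 2 * pi * y + 2 * pi * of_int b"
    by (simp add: y_def algebra_simps)
  then have "cos (2 * pi * x) = cos (2 * pi * y)"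
    by (simp only: cos_add cos_int_2pin sin_int_2pin mult_1_right mult_zero_right diff_zero)
  also have "\<dots> = cos (2 * pi * \<bar>y\<bar>)"
    by (cases "y \<ge> 0") auto
  also have "\<dots> \<le> cos (2 * pi * \<eta>)"
    using y \<eta> mult_left_mono [OF y(2), of "2 * pi"] by (intro cos_monotone_0_pi_le) auto
  finally show ?thesis .
qed

text \<open>Gain of one factor, from |1 - r e^(ix)|^2 = (1 - r)^2 + 2r(1 - cos x) with r = exp(-m/X)
  and m at most X: then r is at least exp(-1), and (1 - r)^2 at most 1 turns the additive gain into
  a factor.\<close>

definition minor_ratio :: "real \<Rightarrow> real" where
  "minor_ratio \<eta> = 1 / sqrt (1 + 2 * exp (- 1) * (1 - cos (2 * pi * \<eta>)))"

lemma minor_ratio_bounds: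
  assumes "0 < \<eta>" "\<eta> \<le> 1 / 4"
  shows "0 < minor_ratio \<eta>" "minor_ratio \<eta> < 1"
proof -
  have "cos (2 * pi * \<eta>) < cos 0"
    using assms mult_left_mono [OF assms(2), of "2 * pi"] pi_gt_zero by (intro cos_monotone_0_pi) auto
  then have "0 < 2 * exp (- 1) * (1 - cos (2 * pi * \<eta>))"
    by simp
  then have "1 < sqrt (1 + 2 * exp (- 1) * (1 - cos (2 * pi * \<eta>)))"
    by simp
  then show "0 < minor_ratio \<eta>" "minor_ratio \<eta> < 1"
    by (auto simp: minor_ratio_def)
qed

lemma norm_one_minus_exp_far:
  assumes X: "X > 0" and \<eta>: "0 < \<eta>" "\<eta> \<le> 1 / 4" and m: "real m \<le> X" "m \<ge> 1"
    and far: "far_from_ints \<eta> (real m * (v / (2 * pi)))"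
  shows "inverse (norm (1 - exp (- (of_nat m * Complex (1 / X) v)))) \<le> minor_ratio \<eta> * inverse (1 - exp (- (real m * (1 / X))))"
proof -
  define r where "r = exp (- (real m * (1 / X)))"
  define \<delta> where "\<delta> = 2 * exp (- 1) * (1 - cos (2 * pi * \<eta>))"
  have "real m * (1 / X) \<le> 1" "real m * (1 / X) > 0"
    using m X by (auto simp: field_simps)
  then have r: "exp (- 1) \<le> r" "r < 1" "0 \<le> r"
    by (auto simp: r_def)
  have "cos (2 * pi * (real m * (v / (2 * pi)))) \<le> cos (2 * pi * \<eta>)"
    by (rule cos_far_from_ints [OF \<eta>(1) far])
  then have c: "cos (real m * v) \<le> cos (2 * pi * \<eta>)"
    by simp
  have \<delta>: "\<delta> \<ge> 0"
    by (simp add: \<delta>_def)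
  have r1: "(1 - r) ^ 2 \<le> 1"
    using r by (intro power_le_one) (auto intro: order_trans [of 0 "exp (- 1)"])
  have "(1 - r) ^ 2 * (1 + \<delta>) \<le> (1 - r) ^ 2 + \<delta>"
    using mult_right_mono [OF r1 \<delta>] by (simp add: algebra_simps)
  also have "\<delta> \<le> 2 * r * (1 - cos (real m * v))"
    unfolding \<delta>_def using r c by (intro mult_mono) auto
  finally have "(1 - r) ^ 2 * (1 + \<delta>) \<le> norm (1 - exp (- (of_nat m * Complex (1 / X) v))) ^ 2"
    using norm_one_minus_exp [of "1 / X" m v] X by (simp add: r_def)
  then have "sqrt ((1 - r) ^ 2 * (1 + \<delta>)) \<le> norm (1 - exp (- (of_nat m * Complex (1 / X) v)))"
    by (intro real_le_lsqrt) auto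
  then have le: "(1 - r) * sqrt (1 + \<delta>) \<le> norm (1 - exp (- (of_nat m * Complex (1 / X) v)))"
    using r by (simp add: real_sqrt_mult)
  have "0 < (1 - r) * sqrt (1 + \<delta>)"
    using r \<delta> by (intro mult_pos_pos) auto
  from le_imp_inverse_le [OF le this] show ?thesis
    by (simp add: minor_ratio_def r_def \<delta>_def divide_inverse mult.commute)
qed

lemma norm_Fprod_le:
  assumes "\<sigma> > 0"
  shows "norm (Fprod k M (Complex \<sigma> v)) \<le> (\<Prod>m=1..M. inverse (1 - exp (- (real (m ^ k) * \<sigma>))))"
  unfolding Fprod_def prod_norm [symmetric] norm_inverse
proof (rule prod_mono, intro conjI)
  fix m assume m: "m \<in> {1..M}"
  have "0 < 1 - exp (- (real (m ^ k) * \<sigma>))"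
    using m assms by simp
  then show "inverse (norm (1 - exp (- (of_nat (m ^ k) * Complex \<sigma> v)))) \<le> inverse (1 - exp (- (real (m ^ k) * \<sigma>)))"
    by (intro le_imp_inverse_le norm_one_minus_exp_ge assms)
qed simp

lemma Fprod_of_real:
  "Fprod k M (of_real \<sigma>) = of_real (\<Prod>m=1..M. inverse (1 - exp (- (real (m ^ k) * \<sigma>))))"
  by (simp add: Fprod_def flip: exp_of_real)

lemma real_Fprod_limit:
  assumes "k \<ge> 1" "\<sigma> > 0"
  shows "(\<lambda>M. \<Prod>m=1..M. inverse (1 - exp (- (real (m ^ k) * \<sigma>)))) \<longlonglongrightarrow> norm (exp (log_prod k (of_real \<sigma>)))"
proof -
  have "(\<lambda>M. norm (Fprod k M (of_real \<sigma>))) \<longlonglongrightarrow> norm (exp (log_prod k (of_real \<sigma>)))"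
    by (intro tendsto_norm Fprod_limit) (use assms in auto)
  moreover have "norm (Fprod k M (of_real \<sigma>)) = (\<Prod>m=1..M. inverse (1 - exp (- (real (m ^ k) * \<sigma>))))" for M
    unfolding Fprod_of_real norm_of_real using assms by (intro abs_of_nonneg prod_nonneg) auto
  ultimately show ?thesis
    by simp
qed

text \<open>Factor by factor comparison with the real point 1/X: every m in the set from
  \<open>many_far_powers\<close>, taken for theta = v/(2 pi), gains \<open>minor_ratio\<close>, and
  the others are no larger than at the real point.\<close>

lemma minor_arc_bound:
  assumes k: "k \<ge> 1" and X: "X \<ge> 1" and \<eta>: "0 < \<eta>" "2 ^ (k + 2) * \<eta> \<le> 1"
    and v: "\<bar>v\<bar> \<le> pi" "\<bar>v\<bar> \<ge> 2 * pi * (2 ^ k * \<eta>) / X"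
  shows "norm (exp (log_prod k (Complex (1 / X) v))) \<le>
     minor_ratio \<eta> powr (X powr (1 / (2 * real k)) / 4 - 1) * norm (exp (log_prod k (of_real (1 / X))))"
proof -
  define \<theta> where "\<theta> = v / (2 * pi)"
  have "(4::real) * \<eta> \<le> 2 ^ (k + 2) * \<eta>"
    using \<eta>(1) by (intro mult_right_mono) (simp_all add: power_add)
  then have \<eta>4: "\<eta> \<le> 1 / 4"
    using \<eta> by linarith
  have "\<bar>\<theta>\<bar> \<le> 1 / 2" "\<bar>\<theta>\<bar> \<ge> 2 ^ k * \<eta> / X"
    using v X by (simp_all add: \<theta>_def abs_divide field_simps)
  from many_far_powers [OF \<eta> k X this] obtain B where B: "finite B"
    "real (card B) \<ge> X powr (1 / (2 * real k)) / 4 - 1"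
    "\<And>m. m \<in> B \<Longrightarrow> m \<ge> 1 \<and> real m ^ k \<le> X \<and> far_from_ints \<eta> (real m ^ k * \<theta>)"
    by metis
  let ?\<rho> = "minor_ratio \<eta>"
  let ?R = "\<lambda>M. \<Prod>m=1..M. inverse (1 - exp (- (real (m ^ k) * (1 / X))))"
  note \<rho> = minor_ratio_bounds [OF \<eta>(1) \<eta>4]
  have X0: "X > 0" "1 / X > 0"
    using X by auto
  have main: "norm (Fprod k M (Complex (1 / X) v)) \<le> ?\<rho> ^ card B * ?R M" if M: "B \<subseteq> {1..M}" for M
  proof -
    have "norm (Fprod k M (Complex (1 / X) v)) \<le> (\<Prod>m=1..M. (if m \<in> B then ?\<rho> else 1) * inverse (1 - exp (- (real (m ^ k) * (1 / X)))))"
      unfolding Fprod_def prod_norm [symmetric] norm_inverse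
    proof (rule prod_mono, intro conjI)
      fix m assume m: "m \<in> {1..M}"
      have p: "0 < 1 - exp (- (real (m ^ k) * (1 / X)))"
        using m X0 by simp
      show "inverse (norm (1 - exp (- (of_nat (m ^ k) * Complex (1 / X) v)))) \<le> (if m \<in> B then ?\<rho> else 1) * inverse (1 - exp (- (real (m ^ k) * (1 / X))))"
      proof (cases "m \<in> B")
        case True
        then have "inverse (norm (1 - exp (- (of_nat (m ^ k) * Complex (1 / X) v)))) \<le> ?\<rho> * inverse (1 - exp (- (real (m ^ k) * (1 / X))))"
          using B(3) [OF True] by (intro norm_one_minus_exp_far [OF X0(1) \<eta>(1) \<eta>4]) (auto simp: \<theta>_def)
        then show ?thesis
          using True by simp
      next
        case False
        have "inverse (norm (1 - exp (- (of_nat (m ^ k) * Complex (1 / X) v)))) \<le> inverse (1 - exp (- (real (m ^ k) * (1 / X))))"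
          by (intro le_imp_inverse_le norm_one_minus_exp_ge X0 p)
        then show ?thesis
          using False by simp
      qed
    qed simp
    also have "\<dots> = (\<Prod>m=1..M. if m \<in> B then ?\<rho> else 1) * ?R M"
      by (rule prod.distrib)
    also have "(\<Prod>m=1..M. if m \<in> B then ?\<rho> else 1) = ?\<rho> ^ card B"
      using M by (simp add: prod.If_cases Int_absorb1)
    finally show ?thesis .
  qed
  have "eventually (\<lambda>M. B \<subseteq> {1..M}) sequentially"
  proof -
    have "B \<subseteq> {1..M}" if "M \<ge> Max (insert 0 B)" for M
      using that B by (auto dest: Max_ge [of "insert 0 B", rotated] intro: order_trans)
    then show ?thesis
      unfolding eventually_sequentially by blast
  qed
  then have ev: "eventually (\<lambda>M. norm (Fprod k M (Complex (1 / X) v)) \<le> ?\<rho> ^ card B * ?R M) sequentially"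
    by (rule eventually_mono) (rule main)
  have l1: "(\<lambda>M. norm (Fprod k M (Complex (1 / X) v))) \<longlonglongrightarrow> norm (exp (log_prod k (Complex (1 / X) v)))"
    by (intro tendsto_norm Fprod_limit) (use X0 k in auto)
  have l2: "(\<lambda>M. ?\<rho> ^ card B * ?R M) \<longlonglongrightarrow> ?\<rho> ^ card B * norm (exp (log_prod k (of_real (1 / X))))"
    by (intro tendsto_mult tendsto_const real_Fprod_limit k X0)
  have "norm (exp (log_prod k (Complex (1 / X) v))) \<le> ?\<rho> ^ card B * norm (exp (log_prod k (of_real (1 / X))))"
    by (rule tendsto_le [OF _ l2 l1 ev]) simp
  also have "?\<rho> ^ card B = ?\<rho> powr real (card B)"
    using \<rho> by (simp add: powr_realpow)
  also have "\<dots> * norm (exp (log_prod k (of_real (1 / X)))) \<le> ?\<rho> powr (X powr (1 / (2 * real k)) / 4 - 1) * norm (exp (log_prod k (of_real (1 / X))))"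
    using \<rho> B(2) by (intro mult_right_mono powr_mono') auto
  finally show ?thesis .
qed

text \<open>The integrals of the finite products do not change once M reaches n, so dominated
  convergence hands their value to the infinite product.\<close>

lemma power_partition_count_integral_limit:
  assumes k: "k \<ge> 1" and \<sigma>: "\<sigma> > 0"
  shows "((\<lambda>v. exp (log_prod k (Complex \<sigma> v)) * exp (of_nat n * Complex \<sigma> v))
            has_integral 2 * pi * of_nat (power_partition_count k n)) {-pi..pi}"
proof -
  let ?f = "\<lambda>M v. Fprod k M (Complex \<sigma> v) * exp (of_nat n * Complex \<sigma> v)"
  let ?g = "\<lambda>v. exp (log_prod k (Complex \<sigma> v)) * exp (of_nat n * Complex \<sigma> v)"
  let ?R = "\<lambda>M. \<Prod>m=1..M. inverse (1 - exp (- (real (m ^ k) * \<sigma>)))"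
  have int: "(?f M has_integral 2 * pi * of_nat (power_partition_count k n)) {-pi..pi}" if "M \<ge> n" for M
    by (rule power_partition_count_integral [OF k that \<sigma>])
  \<comment> \<open>The products at the real point dominate those on the whole segment; as they
    converge, they supply a constant majorant.\<close>
  have "Bseq ?R"
    using real_Fprod_limit [OF k \<sigma>] by (intro convergent_imp_Bseq convergentI)
  then obtain C where C: "\<And>M. norm (?R M) \<le> C"
    by (auto simp: Bseq_def)
  have bound: "norm (?f (M + n) v) \<le> C * exp (real n * \<sigma>)" for M v
  proof -
    have "norm (Fprod k (M + n) (Complex \<sigma> v)) \<le> C"
      using norm_Fprod_le [OF \<sigma>, of k "M + n" v] C [of "M + n"] by simp
    then show ?thesis
      by (simp add: norm_mult mult_right_mono)
  qed
  have lim: "(\<lambda>M. ?f (M + n) v) \<longlonglongrightarrow> ?g v" for v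
    by (intro tendsto_mult tendsto_const LIMSEQ_ignore_initial_segment [OF Fprod_limit]) (use k \<sigma> in auto)
  have I: "?f (M + n) integrable_on {-pi..pi}" for M
    using int [of "M + n"] by auto
  have h: "(\<lambda>v. C * exp (real n * \<sigma>)) integrable_on {-pi..pi}"
    by (rule integrable_const_ivl)
  note dc = dominated_convergence [of "\<lambda>M. ?f (M + n)" "{-pi..pi}" "\<lambda>v. C * exp (real n * \<sigma>)" ?g, OF I h bound lim]
  have "(\<lambda>M. integral {-pi..pi} (?f (M + n))) = (\<lambda>M. 2 * pi * of_nat (power_partition_count k n))"
    using integral_unique [OF int] by (intro ext) simp
  then have "integral {-pi..pi} ?g = 2 * pi * of_nat (power_partition_count k n)"
    using dc(2) by (simp add: LIMSEQ_const_iff)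
  then show ?thesis
    using integrable_integral [OF dc(1)] by simp
qed

section \<open>Laplace expansion\<close>

text \<open>Dividing out z repeatedly, with removable singularities filled in, gives some
  coefficients and a holomorphic cofactor; comparing power series identifies the coefficients as
  Taylor's.\<close>

lemma holomorphic_Taylor:
  assumes f: "f holomorphic_on ball 0 r" and r: "r > 0"
  obtains h where "h holomorphic_on ball 0 r"
    "\<And>z. z \<in> ball 0 r \<Longrightarrow> f z = (\<Sum>n<T. (deriv ^^ n) f 0 / fact n * z ^ n) + z ^ T * h z"
proof -
  have "\<exists>\<alpha> h. h holomorphic_on ball 0 r \<and> (\<forall>z\<in>ball 0 r. f z = (\<Sum>n<T. \<alpha> n * z ^ n) + z ^ T * h z)"
  proof (induction T)
    case 0
    then show ?case
      using f by auto
  next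
    case (Suc T)
    then obtain \<alpha> h where h: "h holomorphic_on ball 0 r" "\<And>z. z \<in> ball 0 r \<Longrightarrow> f z = (\<Sum>n<T. \<alpha> n * z ^ n) + z ^ T * h z"
      by auto
    define h' where "h' = (\<lambda>z. if z = 0 then deriv h 0 else (h z - h 0) / (z - 0))"
    have h': "h' holomorphic_on ball 0 r"
      unfolding h'_def using r by (intro pole_lemma [OF h(1)]) auto
    have hh': "h z = h 0 + z * h' z" for z
      by (simp add: h'_def)
    have "f z = (\<Sum>n<Suc T. (\<alpha>(T := h 0)) n * z ^ n) + z ^ Suc T * h' z" if "z \<in> ball 0 r" for z
    proof -
      have "f z = (\<Sum>n<T. \<alpha> n * z ^ n) + z ^ T * (h 0 + z * h' z)"
        using h(2) [OF that] hh' [of z] by simp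
      also have "(\<Sum>n<T. \<alpha> n * z ^ n) = (\<Sum>n<T. (\<alpha>(T := h 0)) n * z ^ n)"
        by (intro sum.cong) auto
      finally show ?thesis
        by (simp add: algebra_simps)
    qed
    then show ?case
      using h' by blast
  qed
  then obtain \<alpha> h where h: "h holomorphic_on ball 0 r" "\<And>z. z \<in> ball 0 r \<Longrightarrow> f z = (\<Sum>n<T. \<alpha> n * z ^ n) + z ^ T * h z"
    by blast
  have \<alpha>: "(deriv ^^ m) f 0 / fact m = \<alpha> m" if m: "m < T" for m
  proof -
    have "h analytic_on {0}"
      using h(1) r by (auto simp: analytic_at intro!: exI [of _ "ball 0 r"])
    then have "h has_fps_expansion fps_expansion h 0"
      by (rule analytic_at_imp_has_fps_expansion_0)
    then have e: "(\<lambda>z. (\<Sum>n<T. \<alpha> n * z ^ n) + z ^ T * h z) has_fps_expansion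
        (\<Sum>n<T. fps_const (\<alpha> n) * fps_X ^ n) + fps_X ^ T * fps_expansion h 0"
      by (intro fps_expansion_intros)
    have "(deriv ^^ m) f 0 = (deriv ^^ m) (\<lambda>z. (\<Sum>n<T. \<alpha> n * z ^ n) + z ^ T * h z) 0"
    proof (rule higher_deriv_cong_ev)
      have "eventually (\<lambda>z. z \<in> ball 0 r) (nhds 0)"
        using r by (intro eventually_nhds_in_open) auto
      then show "\<forall>\<^sub>F z in nhds 0. f z = (\<Sum>n<T. \<alpha> n * z ^ n) + z ^ T * h z"
        by (rule eventually_mono) (rule h(2))
    qed simp
    also have "\<dots> / fact m = fps_nth ((\<Sum>n<T. fps_const (\<alpha> n) * fps_X ^ n) + fps_X ^ T * fps_expansion h 0) m"
      by (rule fps_nth_fps_expansion [OF e, symmetric])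
    also have "\<dots> = \<alpha> m"
      using m by (simp add: fps_sum_nth fps_X_power_mult_nth fps_X_power_nth if_distrib [of "\<lambda>x. _ * x"] cong: if_cong)
    finally show ?thesis .
  qed
  show ?thesis
    by (rule that [OF h(1)]) (simp add: h(2) \<alpha>)
qed

text \<open>This is Gamma(m + 1/2), the moment of order 2m of exp(-u^2) on the real line.\<close>

definition gauss_moment :: "nat \<Rightarrow> real" where
  "gauss_moment m = sqrt pi * fact (2 * m) / (2 ^ (2 * m) * fact m)"

lemma gauss_moment_0 [simp]: "gauss_moment 0 = sqrt pi"
  by (simp add: gauss_moment_def)

lemma gauss_moment_nonneg: "gauss_moment m \<ge> 0"
  by (simp add: gauss_moment_def)

lemma has_integral_gauss_moment:
  fixes Y :: real
  assumes Y: "Y > 0"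
  shows "((\<lambda>u. u ^ (2 * m) * exp (- (Y * u ^ 2))) has_integral gauss_moment m * Y powr (- (real m + 1 / 2))) UNIV"
proof -
  have "has_bochner_integral lborel (\<lambda>x::real. exp (- (x ^ 2)) * x ^ (2 * m))
      (2 *\<^sub>R (sqrt pi / 2 * (fact (2 * m) / (2 ^ (2 * m) * fact m))))"
    by (rule has_bochner_integral_even_function [OF gaussian_moment_even_pos]) simp
  then have "has_bochner_integral lborel (\<lambda>x::real. exp (- (x ^ 2)) * x ^ (2 * m)) (gauss_moment m)"
    by (simp add: gauss_moment_def)
  then have "has_bochner_integral lborel (\<lambda>x. exp (- ((0 + sqrt Y * x) ^ 2)) * (0 + sqrt Y * x) ^ (2 * m)) (gauss_moment m /\<^sub>R \<bar>sqrt Y\<bar>)"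
    using Y by (subst (asm) lborel_has_bochner_integral_real_affine_iff [of "sqrt Y" _ _ 0]) auto
  then have "((\<lambda>x. exp (- ((0 + sqrt Y * x) ^ 2)) * (0 + sqrt Y * x) ^ (2 * m)) has_integral (gauss_moment m /\<^sub>R \<bar>sqrt Y\<bar>)) UNIV"
    using has_integral_integral_lborel [of "\<lambda>x. exp (- ((0 + sqrt Y * x) ^ 2)) * (0 + sqrt Y * x) ^ (2 * m)"]
    unfolding has_bochner_integral_iff by simp
  then have "((\<lambda>x. Y powr (- real m) * (exp (- ((0 + sqrt Y * x) ^ 2)) * (0 + sqrt Y * x) ^ (2 * m))) has_integral Y powr (- real m) * (gauss_moment m /\<^sub>R \<bar>sqrt Y\<bar>)) UNIV"
    by (rule has_integral_mult_right)
  moreover have "Y powr (- real m) * (exp (- ((0 + sqrt Y * x) ^ 2)) * (0 + sqrt Y * x) ^ (2 * m)) = x ^ (2 * m) * exp (- (Y * x ^ 2))" for x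
  proof -
    have e1: "(sqrt Y * x) ^ (2 * m) = Y ^ m * x ^ (2 * m)"
      using Y by (simp add: power_mult_distrib power_mult)
    have e2: "Y powr (- real m) * Y ^ m = 1"
      using Y by (simp add: powr_minus powr_realpow)
    have e3: "(sqrt Y * x) ^ 2 = Y * x ^ 2"
      using Y by (simp add: power_mult_distrib)
    have "Y powr (- real m) * (exp (- ((0 + sqrt Y * x) ^ 2)) * (0 + sqrt Y * x) ^ (2 * m)) =
        (Y powr (- real m) * Y ^ m) * (x ^ (2 * m) * exp (- (Y * x ^ 2)))"
      by (simp only: add_0 e1 e3) (simp only: mult_ac)
    then show ?thesis
      by (simp only: e2 mult_1)
  qed
  moreover have "Y powr (- real m) * (gauss_moment m /\<^sub>R \<bar>sqrt Y\<bar>) = gauss_moment m * Y powr (- (real m + 1 / 2))"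
  proof -
    have "Y powr (- (real m + 1 / 2)) = Y powr (- real m) * Y powr (- (1 / 2))"
      by (simp flip: powr_add)
    moreover have "Y powr (- (1 / 2)) = inverse \<bar>sqrt Y\<bar>"
      using Y by (simp add: powr_minus powr_half_sqrt)
    ultimately show ?thesis
      by (simp add: mult_ac)
  qed
  ultimately show ?thesis
    by (simp only:)
qed

text \<open>Outside the interval 1 is at most (u/u0)^(2K), so the tail is bounded by a moment of
  order 2(m + K). As K is free, truncation costs less than any given power of 1/Y.\<close>

lemma truncated_gauss_moment:
  fixes Y u0 :: real
  assumes Y: "Y > 0" and u0: "u0 > 0"
  shows "\<bar>integral {-u0..u0} (\<lambda>u. u ^ (2 * m) * exp (- (Y * u ^ 2))) - gauss_moment m * Y powr (- (real m + 1 / 2))\<bar>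
     \<le> gauss_moment (m + K) / u0 ^ (2 * K) * Y powr (- (real (m + K) + 1 / 2))"
proof -
  let ?f = "\<lambda>u. u ^ (2 * m) * exp (- (Y * u ^ 2))"
  let ?I = "integral {-u0..u0} ?f"
  have "(?f has_integral ?I) {-u0..u0}"
    by (intro integrable_integral integrable_continuous_real continuous_intros)
  then have "((\<lambda>u. if u \<in> {-u0..u0} then ?f u else 0) has_integral ?I) UNIV"
    by (simp only: has_integral_restrict_UNIV)
  from has_integral_diff [OF has_integral_gauss_moment [OF Y, of m] this]
  have d: "((\<lambda>u. ?f u - (if u \<in> {-u0..u0} then ?f u else 0)) has_integral
      gauss_moment m * Y powr (- (real m + 1 / 2)) - ?I) UNIV" .
  have "((\<lambda>u. 1 / u0 ^ (2 * K) * (u ^ (2 * (m + K)) * exp (- (Y * u ^ 2)))) has_integral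
      1 / u0 ^ (2 * K) * (gauss_moment (m + K) * Y powr (- (real (m + K) + 1 / 2)))) UNIV"
    by (intro has_integral_mult_right has_integral_gauss_moment Y)
  then have "gauss_moment m * Y powr (- (real m + 1 / 2)) - ?I \<le>
      1 / u0 ^ (2 * K) * (gauss_moment (m + K) * Y powr (- (real (m + K) + 1 / 2)))"
  proof (rule has_integral_le [OF d])
    fix u :: real
    show "?f u - (if u \<in> {-u0..u0} then ?f u else 0) \<le> 1 / u0 ^ (2 * K) * (u ^ (2 * (m + K)) * exp (- (Y * u ^ 2)))"
    proof (cases "u \<in> {-u0..u0}")
      case True
      have "0 \<le> u ^ (2 * (m + K))"
        by (intro zero_le_even_power) simp
      then show ?thesis
        using True u0 by simp
    next
      case False
      then have "u0 \<le> \<bar>u\<bar>"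
        by auto
      then have "u0 ^ (2 * K) \<le> \<bar>u\<bar> ^ (2 * K)"
        using u0 by (intro power_mono) auto
      then have "1 \<le> 1 / u0 ^ (2 * K) * u ^ (2 * K)"
        using u0 by (simp add: power_mult)
      then have "?f u * 1 \<le> ?f u * (1 / u0 ^ (2 * K) * u ^ (2 * K))"
        by (intro mult_left_mono) (auto simp: power_mult)
      then have "?f u \<le> 1 / u0 ^ (2 * K) * (u ^ (2 * (m + K)) * exp (- (Y * u ^ 2)))"
        by (simp add: power_add algebra_simps)
      then show ?thesis
        by (simp only: False if_False diff_zero)
    qed
  qed
  moreover have "0 \<le> gauss_moment m * Y powr (- (real m + 1 / 2)) - ?I"
    by (rule has_integral_nonneg [OF d]) (simp add: power_mult)
  ultimately show ?thesis
    by simp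
qed

lemma truncated_even_moment_le:
  fixes Y u0 :: real
  assumes Y: "Y > 0"
  shows "integral {-u0..u0} (\<lambda>u. u ^ (2 * m) * exp (- (Y * u ^ 2))) \<le> gauss_moment m * Y powr (- (real m + 1 / 2))"
proof -
  have "((\<lambda>u. u ^ (2 * m) * exp (- (Y * u ^ 2))) has_integral integral {-u0..u0} (\<lambda>u. u ^ (2 * m) * exp (- (Y * u ^ 2)))) {-u0..u0}"
    by (intro integrable_integral integrable_continuous_real continuous_intros)
  from has_integral_subset_le [OF _ this has_integral_gauss_moment [OF Y]] show ?thesis
    by (simp add: power_mult)
qed

lemma truncated_odd_moment:
  fixes Y u0 :: real
  assumes "odd q"
  shows "integral {-u0..u0} (\<lambda>u. u ^ q * exp (- (Y * u ^ 2))) = 0"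
proof -
  have "integral {-u0..u0} (\<lambda>u. (- u) ^ q * exp (- (Y * (- u) ^ 2))) = integral {-u0..u0} (\<lambda>u. u ^ q * exp (- (Y * u ^ 2)))"
    using Henstock_Kurzweil_Integration.integral_reflect_real [of u0 "-u0" "\<lambda>u. u ^ q * exp (- (Y * u ^ 2))"] by simp
  moreover have "integral {-u0..u0} (\<lambda>u. (- u) ^ q * exp (- (Y * (- u) ^ 2))) = - integral {-u0..u0} (\<lambda>u. u ^ q * exp (- (Y * u ^ 2)))"
    using assms by simp
  ultimately show ?thesis
    by simp
qed

text \<open>Expansion in powers of 1/Y to order J, uniform for Y at least 1. Only the constant
  coefficient is recorded, since the others are merely claimed to exist; this makes the predicate
  stable under the operations below.\<close>

definition asym_exp :: "nat \<Rightarrow> complex \<Rightarrow> (real \<Rightarrow> complex) \<Rightarrow> bool" where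
  "asym_exp J a F \<longleftrightarrow> (\<exists>c C. c 0 = a \<and>
     (\<forall>Y\<ge>1. norm (F Y - (\<Sum>j\<le>J. c j * of_real (Y powr (- real j)))) \<le> C * Y powr (- (real J + 1))))"

lemma asym_exp_add:
  assumes "asym_exp J a F" "asym_exp J b G"
  shows "asym_exp J (a + b) (\<lambda>Y. F Y + G Y)"
proof -
  obtain c C where c: "c 0 = a" "\<And>Y. Y \<ge> 1 \<Longrightarrow> norm (F Y - (\<Sum>j\<le>J. c j * of_real (Y powr (- real j)))) \<le> C * Y powr (- (real J + 1))"
    using assms(1) unfolding asym_exp_def by blast
  obtain d D where d: "d 0 = b" "\<And>Y. Y \<ge> 1 \<Longrightarrow> norm (G Y - (\<Sum>j\<le>J. d j * of_real (Y powr (- real j)))) \<le> D * Y powr (- (real J + 1))"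
    using assms(2) unfolding asym_exp_def by blast
  show ?thesis
    unfolding asym_exp_def
  proof (intro exI [of _ "\<lambda>j. c j + d j"] exI [of _ "C + D"] conjI allI impI)
    fix Y :: real assume Y: "Y \<ge> 1"
    have "F Y + G Y - (\<Sum>j\<le>J. (c j + d j) * of_real (Y powr (- real j))) =
       (F Y - (\<Sum>j\<le>J. c j * of_real (Y powr (- real j)))) + (G Y - (\<Sum>j\<le>J. d j * of_real (Y powr (- real j))))"
      by (simp add: distrib_right sum.distrib)
    also have "norm \<dots> \<le> C * Y powr (- (real J + 1)) + D * Y powr (- (real J + 1))"
      using c(2) [OF Y] d(2) [OF Y] by (rule norm_triangle_mono)
    finally show "norm (F Y + G Y - (\<Sum>j\<le>J. (c j + d j) * of_real (Y powr (- real j)))) \<le> (C + D) * Y powr (- (real J + 1))"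
      by (simp add: distrib_right)
  qed (use c d in auto)
qed

lemma asym_exp_error:
  assumes "\<And>Y. Y \<ge> 1 \<Longrightarrow> norm (F Y) \<le> C * Y powr (- (real J + 1))"
  shows "asym_exp J 0 F"
  unfolding asym_exp_def using assms by (intro exI [of _ "\<lambda>j. 0"] exI [of _ C]) auto

lemma asym_exp_cmult:
  assumes "asym_exp J a F"
  shows "asym_exp J (z * a) (\<lambda>Y. z * F Y)"
proof -
  obtain c C where c: "c 0 = a" "\<And>Y. Y \<ge> 1 \<Longrightarrow> norm (F Y - (\<Sum>j\<le>J. c j * of_real (Y powr (- real j)))) \<le> C * Y powr (- (real J + 1))"
    using assms(1) unfolding asym_exp_def by blast
  show ?thesis
    unfolding asym_exp_def
  proof (intro exI [of _ "\<lambda>j. z * c j"] exI [of _ "norm z * C"] conjI allI impI)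
    fix Y :: real assume Y: "Y \<ge> 1"
    have "z * F Y - (\<Sum>j\<le>J. z * c j * of_real (Y powr (- real j))) = z * (F Y - (\<Sum>j\<le>J. c j * of_real (Y powr (- real j))))"
      by (simp add: right_diff_distrib sum_distrib_left mult.assoc)
    then show "norm (z * F Y - (\<Sum>j\<le>J. z * c j * of_real (Y powr (- real j)))) \<le> norm z * C * Y powr (- (real J + 1))"
      using c(2) [OF Y] by (simp add: norm_mult mult_left_mono mult.assoc)
  qed (use c in auto)
qed

lemma asym_exp_power: "asym_exp J (if j = 0 then 1 else 0) (\<lambda>Y. of_real (Y powr (- real j)))"
proof (cases "j \<le> J")
  case True
  then show ?thesis
    unfolding asym_exp_def
    by (intro exI [of _ "\<lambda>i. if i = j then 1 else 0"] exI [of _ 0])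
       (auto simp: if_distrib [of "\<lambda>x. x * _"] cong: if_cong)
next
  case False
  then have "asym_exp J 0 (\<lambda>Y. of_real (Y powr (- real j)))"
    by (intro asym_exp_error [where C = 1]) (auto intro!: powr_mono)
  then show ?thesis
    using False by auto
qed

lemma asym_exp_0: "asym_exp J 0 (\<lambda>Y. 0)"
  by (rule asym_exp_error [where C = 0]) simp

lemma asym_exp_sum:
  assumes "finite A" "\<And>x. x \<in> A \<Longrightarrow> asym_exp J (a x) (F x)"
  shows "asym_exp J (\<Sum>x\<in>A. a x) (\<lambda>Y. \<Sum>x\<in>A. F x Y)"
  using assms by (induction A rule: finite_induct) (auto intro: asym_exp_0 asym_exp_add)

lemma asym_exp_perturb:
  assumes "asym_exp J a F" "\<And>Y. Y \<ge> 1 \<Longrightarrow> norm (G Y - F Y) \<le> C * Y powr (- (real J + 1))"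
  shows "asym_exp J a G"
proof -
  have "asym_exp J (a + 0) (\<lambda>Y. F Y + (G Y - F Y))"
    by (intro asym_exp_add assms(1) asym_exp_error [where C = C] assms(2))
  then show ?thesis
    by simp
qed

text \<open>Odd moments vanish by symmetry. For p = 2m the full moment gives exactly the power
  Y^(-(m - l)), constant only for m = l, and truncation with K = J + 1 costs at most
  Y^(-J-1).\<close>

lemma asym_exp_moment:
  fixes u0 :: real
  assumes u0: "u0 > 0" and l: "2 * l \<le> p"
  shows "asym_exp J (if p = 2 * l then of_real (gauss_moment l) else 0)
     (\<lambda>Y. of_real (Y powr (real l + 1 / 2) * integral {-u0..u0} (\<lambda>u. u ^ p * exp (- (Y * u ^ 2)))))"
proof (cases "even p")
  case False
  then have "p \<noteq> 2 * l"
    by auto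
  then show ?thesis
    using asym_exp_0 by (simp add: truncated_odd_moment [OF False])
next
  case True
  then obtain m where m: "p = 2 * m"
    by (elim evenE)
  have ml: "m \<ge> l"
    using l m by simp
  have "asym_exp J (of_real (gauss_moment m) * (if m - l = 0 then 1 else 0)) (\<lambda>Y. of_real (gauss_moment m) * of_real (Y powr (- real (m - l))))"
    by (intro asym_exp_cmult asym_exp_power)
  then have "asym_exp J (of_real (gauss_moment m) * (if m - l = 0 then 1 else 0))
     (\<lambda>Y. of_real (Y powr (real l + 1 / 2) * integral {-u0..u0} (\<lambda>u. u ^ p * exp (- (Y * u ^ 2)))))"
  proof (rule asym_exp_perturb [where C = "gauss_moment (m + (J + 1)) / u0 ^ (2 * (J + 1))"])
    fix Y :: real assume Y: "Y \<ge> 1"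
    let ?I = "integral {-u0..u0} (\<lambda>u. u ^ (2 * m) * exp (- (Y * u ^ 2)))"
    have "Y powr (- real (m - l)) = Y powr (real l + 1 / 2) * Y powr (- (real m + 1 / 2))"
      using ml by (simp add: of_nat_diff flip: powr_add)
    then have "Y powr (real l + 1 / 2) * ?I - gauss_moment m * Y powr (- real (m - l)) =
        Y powr (real l + 1 / 2) * (?I - gauss_moment m * Y powr (- (real m + 1 / 2)))"
      by (simp add: algebra_simps)
    then have "\<bar>Y powr (real l + 1 / 2) * ?I - gauss_moment m * Y powr (- real (m - l))\<bar> =
       Y powr (real l + 1 / 2) * \<bar>?I - gauss_moment m * Y powr (- (real m + 1 / 2))\<bar>"
      by (simp add: abs_mult)
    also have "\<dots> \<le> Y powr (real l + 1 / 2) * (gauss_moment (m + (J + 1)) / u0 ^ (2 * (J + 1)) * Y powr (- (real (m + (J + 1)) + 1 / 2)))"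
      using Y u0 by (intro mult_left_mono truncated_gauss_moment) auto
    also have "\<dots> = gauss_moment (m + (J + 1)) / u0 ^ (2 * (J + 1)) * Y powr (real l - real m - real J - 1)"
    proof -
      have "Y powr (real l + 1 / 2) * Y powr (- (real (m + (J + 1)) + 1 / 2)) = Y powr (real l - real m - real J - 1)"
        by (simp add: algebra_simps flip: powr_add)
      then show ?thesis
        by (simp add: mult_ac)
    qed
    also have "\<dots> \<le> gauss_moment (m + (J + 1)) / u0 ^ (2 * (J + 1)) * Y powr (- (real J + 1))"
      using Y ml u0 gauss_moment_nonneg by (intro mult_left_mono powr_mono) auto
    finally have "\<bar>Y powr (real l + 1 / 2) * ?I - gauss_moment m * Y powr (- real (m - l))\<bar> \<le> \<dots>" .
    moreover have "complex_of_real (Y powr (real l + 1 / 2) * ?I) - of_real (gauss_moment m) * of_real (Y powr (- real (m - l)))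
        = of_real (Y powr (real l + 1 / 2) * ?I - gauss_moment m * Y powr (- real (m - l)))"
      by simp
    ultimately show "norm (complex_of_real (Y powr (real l + 1 / 2) * integral {-u0..u0} (\<lambda>u. u ^ p * exp (- (Y * u ^ 2)))) - of_real (gauss_moment m) * of_real (Y powr (- real (m - l))))
        \<le> gauss_moment (m + (J + 1)) / u0 ^ (2 * (J + 1)) * Y powr (- (real J + 1))"
      unfolding m by (simp only: norm_of_real)
  qed
  moreover have "of_real (gauss_moment m) * (if m - l = 0 then 1 else 0) = (if p = 2 * l then complex_of_real (gauss_moment l) else 0)"
    using m ml by auto
  ultimately show ?thesis
    by simp
qed

text \<open>Expanding A in its Taylor series reduces the integral to moments of order q + n. The
  condition on q keeps positive powers of Y away and allows a constant term only for q = l =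
  0.\<close>

lemma asym_exp_holomorphic_term:
  fixes u0 r :: real and A :: "complex \<Rightarrow> complex"
  assumes A: "A holomorphic_on ball 0 r" and u0: "0 < u0" "u0 < r" and q: "2 * l < q \<or> q = 0 \<and> l = 0"
  shows "asym_exp J (if q = 0 then of_real (sqrt pi) * A 0 else 0)
     (\<lambda>Y. of_real (Y powr (real l + 1 / 2)) * integral {-u0..u0} (\<lambda>u. (\<i> * of_real u) ^ q * A (\<i> * of_real u) * of_real (exp (- (Y * u ^ 2)))))"
proof -
  \<comment> \<open>Makes the remainder's exponent q + T = 2(q + J + 1) even, and large enough for
    an error of order Y^(-J-1).\<close>
  define T where "T = q + 2 * J + 2"
  define \<alpha> where "\<alpha> n = (deriv ^^ n) A 0 / fact n" for n
  have "r > 0"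
    using u0 by simp
  then obtain h where h: "h holomorphic_on ball 0 r" "\<And>z. z \<in> ball 0 r \<Longrightarrow> A z = (\<Sum>n<T. \<alpha> n * z ^ n) + z ^ T * h z"
    using holomorphic_Taylor [OF A] unfolding \<alpha>_def by auto
  have sub: "\<i> * of_real u \<in> ball 0 r" if "u \<in> {-u0..u0}" for u
    using that u0 by (auto simp: norm_mult)
  have comp_cont: "continuous_on {-u0..u0} (\<lambda>u. f (\<i> * of_real u))" if "f holomorphic_on ball 0 r" for f
    by (rule continuous_on_compose2 [OF holomorphic_on_imp_continuous_on [OF that]])
       (use sub in \<open>auto intro!: continuous_intros\<close>)
  have "bounded ((\<lambda>u. h (\<i> * of_real u)) ` {-u0..u0})"
    by (intro compact_imp_bounded compact_continuous_image comp_cont h) auto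
  then obtain B where B: "\<And>u. u \<in> {-u0..u0} \<Longrightarrow> norm (h (\<i> * of_real u)) \<le> B"
    unfolding bounded_iff by fastforce
  have B0: "B \<ge> 0"
    using order_trans [OF norm_ge_zero B [of 0]] u0 by simp
  let ?W = "\<lambda>p Y u. u ^ p * exp (- (Y * u ^ 2)) :: real"
  have "asym_exp J (\<Sum>n<T. \<alpha> n * \<i> ^ (q + n) * (if q + n = 2 * l then of_real (gauss_moment l) else 0))
     (\<lambda>Y. \<Sum>n<T. \<alpha> n * \<i> ^ (q + n) * of_real (Y powr (real l + 1 / 2) * integral {-u0..u0} (?W (q + n) Y)))"
    using q u0 by (intro asym_exp_sum asym_exp_cmult asym_exp_moment) auto
  also have "(\<Sum>n<T. \<alpha> n * \<i> ^ (q + n) * (if q + n = 2 * l then of_real (gauss_moment l) else 0)) = (if q = 0 then of_real (sqrt pi) * A 0 else 0)"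
  proof (cases "q = 0")
    case True
    then have l0: "l = 0"
      using q by simp
    have "(\<Sum>n<T. \<alpha> n * \<i> ^ (q + n) * (if q + n = 2 * l then of_real (gauss_moment l) else 0)) =
       (\<Sum>n<T. if n = 0 then A 0 * of_real (sqrt pi) else 0)"
      by (rule sum.cong) (auto simp: True l0 \<alpha>_def)
    also have "\<dots> = A 0 * of_real (sqrt pi)"
      by (simp add: T_def)
    finally show ?thesis
      using True by simp
  next
    case False
    then show ?thesis
      using q by (auto intro!: sum.neutral)
  qed
  finally show ?thesis
  proof (rule asym_exp_perturb [where C = "B * gauss_moment (q + J + 1)"])
    fix Y :: real assume Y: "Y \<ge> 1"
    have main: "((\<lambda>u. \<Sum>n<T. \<alpha> n * \<i> ^ (q + n) * of_real (?W (q + n) Y u)) has_integral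
        (\<Sum>n<T. \<alpha> n * \<i> ^ (q + n) * of_real (integral {-u0..u0} (?W (q + n) Y)))) {-u0..u0}"
    proof (intro has_integral_sum has_integral_mult_right)
      fix n
      have "(?W (q + n) Y has_integral integral {-u0..u0} (?W (q + n) Y)) {-u0..u0}"
        by (intro integrable_integral integrable_continuous_real continuous_intros)
      then show "((\<lambda>u. complex_of_real (?W (q + n) Y u)) has_integral of_real (integral {-u0..u0} (?W (q + n) Y))) {-u0..u0}"
        by (rule has_integral_of_real)
    qed auto
    have cont: "continuous_on {-u0..u0} (\<lambda>u. (\<i> * of_real u) ^ (q + T) * h (\<i> * of_real u) * of_real (exp (- (Y * u ^ 2))))"
      by (intro continuous_intros comp_cont h)
    then have err: "((\<lambda>u. (\<i> * of_real u) ^ (q + T) * h (\<i> * of_real u) * of_real (exp (- (Y * u ^ 2)))) has_integral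
       integral {-u0..u0} (\<lambda>u. (\<i> * of_real u) ^ (q + T) * h (\<i> * of_real u) * of_real (exp (- (Y * u ^ 2))))) {-u0..u0}"
      by (intro integrable_integral integrable_continuous_real)
    define Err where "Err = integral {-u0..u0} (\<lambda>u. (\<i> * of_real u) ^ (q + T) * h (\<i> * of_real u) * of_real (exp (- (Y * u ^ 2))))"
    have "integral {-u0..u0} (\<lambda>u. (\<i> * of_real u) ^ q * A (\<i> * of_real u) * of_real (exp (- (Y * u ^ 2)))) =
       (\<Sum>n<T. \<alpha> n * \<i> ^ (q + n) * of_real (integral {-u0..u0} (?W (q + n) Y))) + Err"
    proof (rule integral_unique, rule has_integral_eq [OF _ has_integral_add [OF main err, folded Err_def]])
      fix u assume u: "u \<in> {-u0..u0}"
      show "(\<Sum>n<T. \<alpha> n * \<i> ^ (q + n) * of_real (?W (q + n) Y u)) + (\<i> * of_real u) ^ (q + T) * h (\<i> * of_real u) * of_real (exp (- (Y * u ^ 2))) =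
        (\<i> * of_real u) ^ q * A (\<i> * of_real u) * of_real (exp (- (Y * u ^ 2)))"
        unfolding h(2) [OF sub [OF u]]
        by (simp add: sum_distrib_left sum_distrib_right power_add power_mult_distrib algebra_simps)
    qed
    then have eq: "of_real (Y powr (real l + 1 / 2)) * integral {-u0..u0} (\<lambda>u. (\<i> * of_real u) ^ q * A (\<i> * of_real u) * of_real (exp (- (Y * u ^ 2))))
       - (\<Sum>n<T. \<alpha> n * \<i> ^ (q + n) * of_real (Y powr (real l + 1 / 2) * integral {-u0..u0} (?W (q + n) Y)))
       = of_real (Y powr (real l + 1 / 2)) * Err"
      by (simp add: distrib_left sum_distrib_left mult_ac)
    have qT: "q + T = 2 * (q + J + 1)"
      by (simp add: T_def)
    have "norm Err \<le> integral {-u0..u0} (\<lambda>u. B * ?W (2 * (q + J + 1)) Y u)"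
      unfolding Err_def
    proof (rule integral_norm_bound_integral)
      show "(\<lambda>u. (\<i> * of_real u) ^ (q + T) * h (\<i> * of_real u) * of_real (exp (- (Y * u ^ 2)))) integrable_on {-u0..u0}"
        by (rule integrable_continuous_real [OF cont])
      show "(\<lambda>u. B * ?W (2 * (q + J + 1)) Y u) integrable_on {-u0..u0}"
        by (intro integrable_continuous_real continuous_intros)
      fix u assume u: "u \<in> {-u0..u0}"
      have "norm ((\<i> * of_real u) ^ (q + T) * h (\<i> * of_real u) * of_real (exp (- (Y * u ^ 2)))) = \<bar>u\<bar> ^ (2 * (q + J + 1)) * norm (h (\<i> * of_real u)) * exp (- (Y * u ^ 2))"
        by (simp only: qT norm_mult norm_power norm_of_real norm_ii mult_1 abs_exp_cancel)
      also have "\<dots> \<le> \<bar>u\<bar> ^ (2 * (q + J + 1)) * B * exp (- (Y * u ^ 2))"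
        using B [OF u] by (intro mult_right_mono mult_left_mono) auto
      also have "\<bar>u\<bar> ^ (2 * (q + J + 1)) = u ^ (2 * (q + J + 1))"
        by (simp only: power_mult power2_abs)
      finally show "norm ((\<i> * of_real u) ^ (q + T) * h (\<i> * of_real u) * of_real (exp (- (Y * u ^ 2)))) \<le> B * ?W (2 * (q + J + 1)) Y u"
        by (simp only: mult_ac)
    qed
    also have "\<dots> = B * integral {-u0..u0} (?W (2 * (q + J + 1)) Y)"
      by simp
    also have "\<dots> \<le> B * (gauss_moment (q + J + 1) * Y powr (- (real (q + J + 1) + 1 / 2)))"
      using Y B0 by (intro mult_left_mono truncated_even_moment_le) auto
    finally have "norm (of_real (Y powr (real l + 1 / 2)) * Err) \<le> Y powr (real l + 1 / 2) * (B * (gauss_moment (q + J + 1) * Y powr (- (real (q + J + 1) + 1 / 2))))"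
      by (simp add: norm_mult mult_left_mono)
    also have "\<dots> = B * gauss_moment (q + J + 1) * (Y powr (real l + 1 / 2) * Y powr (- (real (q + J + 1) + 1 / 2)))"
      by (simp only: mult_ac)
    also have "\<dots> \<le> B * gauss_moment (q + J + 1) * Y powr (- (real J + 1))"
      using Y B0 gauss_moment_nonneg [of "q + J + 1"] q
      by (intro mult_left_mono) (auto simp flip: powr_add intro!: powr_mono mult_nonneg_nonneg)
    finally show "norm (of_real (Y powr (real l + 1 / 2)) * integral {-u0..u0} (\<lambda>u. (\<i> * of_real u) ^ q * A (\<i> * of_real u) * of_real (exp (- (Y * u ^ 2))))
       - (\<Sum>n<T. \<alpha> n * \<i> ^ (q + n) * of_real (Y powr (real l + 1 / 2) * integral {-u0..u0} (?W (q + n) Y)))) \<le> B * gauss_moment (q + J + 1) * Y powr (- (real J + 1))"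
      unfolding eq .
  qed
qed

text \<open>At z = iu the integrand is exp(-Y u^2) times exp(x) a with x = Y z^3 L. The term x^l/l!
  carries Y^l u^(3l), which is of size Y^(-l/2) on the scale of the Gaussian, so expanding exp(x)
  gives an asymptotic series.\<close>

theorem laplace_expansion:
  fixes u0 r :: real and G L a :: "complex \<Rightarrow> complex"
  assumes L: "L holomorphic_on ball 0 r" and a: "a holomorphic_on ball 0 r" and u0: "0 < u0" "u0 < r"
    and G: "\<And>z. z \<in> ball 0 r \<Longrightarrow> G z = z ^ 2 + z ^ 3 * L z"
    and small: "\<And>u. u \<in> {-u0..u0} \<Longrightarrow> \<bar>u\<bar> * norm (L (\<i> * of_real u)) \<le> 1 / 2"
  shows "asym_exp J (of_real (sqrt pi) * a 0)
    (\<lambda>Y. of_real (sqrt Y) * integral {-u0..u0} (\<lambda>u. exp (of_real Y * G (\<i> * of_real u)) * a (\<i> * of_real u)))"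
proof -
  \<comment> \<open>The first omitted power x^(2J+3) has size Y^(-J-3/2), half a power to
    spare.\<close>
  define N where "N = 2 * J + 2"
  define A where "A l z = L z ^ l * a z / fact l" for l z
  have hA: "A l holomorphic_on ball 0 r" for l
    unfolding A_def by (intro holomorphic_intros L a) auto
  have sub: "\<i> * of_real u \<in> ball 0 r" if "u \<in> {-u0..u0}" for u
    using that u0 by (auto simp: norm_mult)
  have comp_cont: "continuous_on {-u0..u0} (\<lambda>u. f (\<i> * of_real u))" if "f holomorphic_on ball 0 r" for f
    by (rule continuous_on_compose2 [OF holomorphic_on_imp_continuous_on [OF that]])
       (use sub in \<open>auto intro!: continuous_intros\<close>)
  have bounded: "\<exists>B\<ge>0. \<forall>u\<in>{-u0..u0}. norm (f (\<i> * of_real u)) \<le> B" if "f holomorphic_on ball 0 r" for f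
  proof -
    have "bounded ((\<lambda>u. f (\<i> * of_real u)) ` {-u0..u0})"
      by (intro compact_imp_bounded compact_continuous_image comp_cont that) auto
    then obtain B where B: "\<And>u. u \<in> {-u0..u0} \<Longrightarrow> norm (f (\<i> * of_real u)) \<le> B"
      unfolding bounded_iff by fastforce
    moreover have "B \<ge> 0"
      using order_trans [OF norm_ge_zero B [of 0]] u0 by simp
    ultimately show ?thesis
      by blast
  qed
  obtain BL where BL: "BL \<ge> 0" "\<And>u. u \<in> {-u0..u0} \<Longrightarrow> norm (L (\<i> * of_real u)) \<le> BL"
    using bounded [OF L] by blast
  obtain Ba where Ba: "Ba \<ge> 0" "\<And>u. u \<in> {-u0..u0} \<Longrightarrow> norm (a (\<i> * of_real u)) \<le> Ba"
    using bounded [OF a] by blast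
  have "asym_exp J (\<Sum>l\<le>N. if 3 * l = 0 then of_real (sqrt pi) * A l 0 else 0)
     (\<lambda>Y. \<Sum>l\<le>N. of_real (Y powr (real l + 1 / 2)) * integral {-u0..u0} (\<lambda>u. (\<i> * of_real u) ^ (3 * l) * A l (\<i> * of_real u) * of_real (exp (- (Y * u ^ 2)))))"
    by (intro asym_exp_sum asym_exp_holomorphic_term [where r = r] hA u0) auto
  also have "(\<Sum>l\<le>N. if 3 * l = 0 then of_real (sqrt pi) * A l 0 else 0) = of_real (sqrt pi) * a 0"
    by (simp add: A_def)
  finally show ?thesis
  proof (rule asym_exp_perturb)
    fix Y :: real assume Y: "Y \<ge> 1"
    define x where "x u = of_real Y * (\<i> * of_real u) ^ 3 * L (\<i> * of_real u)" for u
    define F where "F u = (exp (x u) - (\<Sum>l\<le>N. x u ^ l / fact l)) * a (\<i> * of_real u) * of_real (exp (- (Y * u ^ 2)))" for u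
    let ?g = "\<lambda>l u. (\<i> * of_real u) ^ (3 * l) * A l (\<i> * of_real u) * of_real (exp (- (Y * u ^ 2)))"
    have xc: "continuous_on {-u0..u0} x"
      unfolding x_def by (intro continuous_intros comp_cont L)
    have Fc: "continuous_on {-u0..u0} F"
      unfolding F_def by (intro continuous_intros comp_cont a xc) auto
    have gc: "continuous_on {-u0..u0} (?g l)" for l
      by (intro continuous_intros comp_cont hA)
    have "((\<lambda>u. F u + (\<Sum>l\<le>N. of_real (Y ^ l) * ?g l u)) has_integral
        integral {-u0..u0} F + (\<Sum>l\<le>N. of_real (Y ^ l) * integral {-u0..u0} (?g l))) {-u0..u0}"
      by (intro has_integral_add has_integral_sum has_integral_mult_right integrable_integral integrable_continuous_real Fc gc) auto
    then have "((\<lambda>u. exp (of_real Y * G (\<i> * of_real u)) * a (\<i> * of_real u)) has_integral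
        integral {-u0..u0} F + (\<Sum>l\<le>N. of_real (Y ^ l) * integral {-u0..u0} (?g l))) {-u0..u0}"
    proof (rule has_integral_eq [rotated])
      fix u assume u: "u \<in> {-u0..u0}"
      have "of_real Y * G (\<i> * of_real u) = x u + of_real (- (Y * u ^ 2))"
        unfolding G [OF sub [OF u]] x_def by (simp add: algebra_simps power2_eq_square)
      then have "exp (of_real Y * G (\<i> * of_real u)) = exp (x u) * of_real (exp (- (Y * u ^ 2)))"
        by (simp only: exp_add exp_of_real)
      moreover have "(\<Sum>l\<le>N. of_real (Y ^ l) * ?g l u) = (\<Sum>l\<le>N. x u ^ l / fact l) * a (\<i> * of_real u) * of_real (exp (- (Y * u ^ 2)))"
        unfolding sum_distrib_right
        by (intro sum.cong refl) (simp add: x_def A_def power_mult_distrib mult_ac flip: power_mult)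
      ultimately show "F u + (\<Sum>l\<le>N. of_real (Y ^ l) * ?g l u) = exp (of_real Y * G (\<i> * of_real u)) * a (\<i> * of_real u)"
        by (simp add: F_def algebra_simps)
    qed
    then have int: "integral {-u0..u0} (\<lambda>u. exp (of_real Y * G (\<i> * of_real u)) * a (\<i> * of_real u)) =
       integral {-u0..u0} F + (\<Sum>l\<le>N. of_real (Y ^ l) * integral {-u0..u0} (?g l))"
      by (rule integral_unique)
    have pw: "complex_of_real (Y powr (real l + 1 / 2)) = of_real (sqrt Y) * of_real (Y ^ l)" for l
      using Y by (simp add: powr_add powr_realpow powr_half_sqrt)
    have eq: "of_real (sqrt Y) * integral {-u0..u0} (\<lambda>u. exp (of_real Y * G (\<i> * of_real u)) * a (\<i> * of_real u))
       - (\<Sum>l\<le>N. of_real (Y powr (real l + 1 / 2)) * integral {-u0..u0} (?g l)) = of_real (sqrt Y) * integral {-u0..u0} F"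
      unfolding int pw by (simp add: distrib_left sum_distrib_left mult.assoc)
    define n where "n = 3 * J + 4"
    define D where "D = u0 * BL ^ (2 * J + 3) * Ba"
    have D0: "D \<ge> 0"
      using BL Ba u0 by (simp add: D_def)
    let ?V = "\<lambda>u. u ^ (2 * n) * exp (- (Y / 2 * u ^ 2)) :: real"
    have "norm (integral {-u0..u0} F) \<le> integral {-u0..u0} (\<lambda>u. Y ^ Suc N * D * ?V u)"
    proof (rule integral_norm_bound_integral)
      show "F integrable_on {-u0..u0}"
        by (rule integrable_continuous_real [OF Fc])
      show "(\<lambda>u. Y ^ Suc N * D * ?V u) integrable_on {-u0..u0}"
        by (intro integrable_continuous_real continuous_intros)
      fix u assume u: "u \<in> {-u0..u0}"
      have nx: "norm (x u) = Y * \<bar>u\<bar> ^ 3 * norm (L (\<i> * of_real u))"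
        using Y by (simp add: x_def norm_mult norm_power)
      also have "\<dots> = Y * u ^ 2 * (\<bar>u\<bar> * norm (L (\<i> * of_real u)))"
        by (simp add: power3_eq_cube power2_eq_square)
      \<comment> \<open>The smallness condition keeps |x| below half the Gaussian exponent, so the
        remainder still decays like exp(-Y u^2/2).\<close>
      also have "\<dots> \<le> Y * u ^ 2 * (1 / 2)"
        using small [OF u] Y by (intro mult_left_mono) auto
      finally have "norm (x u) \<le> Y / 2 * u ^ 2"
        by simp
      then have Rex: "\<bar>Re (x u)\<bar> \<le> Y / 2 * u ^ 2"
        using abs_Re_le_cmod [of "x u"] by linarith
      have "norm (exp (x u) - (\<Sum>l\<le>N. x u ^ l / fact l)) \<le> exp \<bar>Re (x u)\<bar> * norm (x u) ^ Suc N / fact N"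
        by (rule Taylor_exp)
      also have "\<dots> \<le> exp \<bar>Re (x u)\<bar> * norm (x u) ^ Suc N / 1"
        by (intro divide_left_mono) auto
      also have "\<dots> \<le> exp (Y / 2 * u ^ 2) * norm (x u) ^ Suc N"
        using Rex by (simp add: mult_right_mono)
      also have "\<dots> \<le> exp (Y / 2 * u ^ 2) * (Y * \<bar>u\<bar> ^ 3 * BL) ^ Suc N"
        unfolding nx using BL(2) [OF u] Y by (intro mult_left_mono power_mono) auto
      finally have 1: "norm (exp (x u) - (\<Sum>l\<le>N. x u ^ l / fact l)) \<le> exp (Y / 2 * u ^ 2) * (Y * \<bar>u\<bar> ^ 3 * BL) ^ Suc N" .
      have "norm (F u) \<le> exp (Y / 2 * u ^ 2) * (Y * \<bar>u\<bar> ^ 3 * BL) ^ Suc N * Ba * exp (- (Y * u ^ 2))"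
        unfolding F_def norm_mult norm_of_real abs_exp_cancel
        using 1 Ba Y BL u by (intro mult_right_mono mult_mono mult_nonneg_nonneg zero_le_power) auto
      also have "\<dots> = Y ^ Suc N * BL ^ Suc N * Ba * (\<bar>u\<bar> ^ (3 * Suc N)) * (exp (Y / 2 * u ^ 2) * exp (- (Y * u ^ 2)))"
      proof -
        have "(\<bar>u\<bar> ^ 3) ^ Suc N = \<bar>u\<bar> ^ (3 * Suc N)"
          by (rule power_mult [symmetric])
        then show ?thesis
          by (simp only: power_mult_distrib mult_ac)
      qed
      also have "exp (Y / 2 * u ^ 2) * exp (- (Y * u ^ 2)) = exp (- (Y / 2 * u ^ 2))"
        by (simp flip: exp_add)
      also have "3 * Suc N = 2 * n + 1"
        by (simp add: N_def n_def)
      \<comment> \<open>The exponent 3(N + 1) is odd; bounding one factor |u| by u0 leaves an even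
        moment and uses up the spare half power of Y.\<close>
      also have "\<bar>u\<bar> ^ (2 * n + 1) = u ^ (2 * n) * \<bar>u\<bar>"
        by (simp add: power_mult)
      also have "Y ^ Suc N * BL ^ Suc N * Ba * (u ^ (2 * n) * \<bar>u\<bar>) * exp (- (Y / 2 * u ^ 2)) \<le>
         Y ^ Suc N * BL ^ Suc N * Ba * (u ^ (2 * n) * u0) * exp (- (Y / 2 * u ^ 2))"
        using u Y BL Ba by (intro mult_right_mono mult_left_mono mult_nonneg_nonneg) (auto simp: power_mult)
      also have "\<dots> = Y ^ Suc N * D * ?V u"
      proof -
        have "Suc N = 2 * J + 3"
          by (simp add: N_def)
        then show ?thesis
          by (simp only: D_def mult_ac)
      qed
      finally show "norm (F u) \<le> Y ^ Suc N * D * ?V u" .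
    qed
    also have "\<dots> = Y ^ Suc N * D * integral {-u0..u0} ?V"
      by simp
    also have "\<dots> \<le> Y ^ Suc N * D * (gauss_moment n * (Y / 2) powr (- (real n + 1 / 2)))"
      using Y D0 by (intro mult_left_mono truncated_even_moment_le) auto
    finally have "norm (of_real (sqrt Y) * integral {-u0..u0} F) \<le> sqrt Y * (Y ^ Suc N * D * (gauss_moment n * (Y / 2) powr (- (real n + 1 / 2))))"
      using Y by (simp add: norm_mult mult_left_mono)
    also have "\<dots> = D * gauss_moment n * (1 / 2) powr (- (real n + 1 / 2)) * (Y powr (1 / 2) * Y powr (real (Suc N)) * Y powr (- (real n + 1 / 2)))"
    proof -
      have "(Y / 2) powr (- (real n + 1 / 2)) = Y powr (- (real n + 1 / 2)) * (1 / 2) powr (- (real n + 1 / 2))"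
        using powr_mult [of Y "1 / 2" "- (real n + 1 / 2)"] Y by simp
      moreover have "sqrt Y = Y powr (1 / 2)" "Y ^ Suc N = Y powr (real (Suc N))"
        using Y by (simp_all only: powr_half_sqrt powr_realpow)
      ultimately show ?thesis
        by (simp only: mult_ac)
    qed
    also have "Y powr (1 / 2) * Y powr (real (Suc N)) * Y powr (- (real n + 1 / 2)) = Y powr (- (real J + 1))"
    proof -
      have "1 / 2 + real (Suc N) + - (real n + 1 / 2) = - (real J + 1)"
        by (simp add: N_def n_def)
      then show ?thesis
        by (simp only: powr_add [symmetric])
    qed
    finally show "norm (of_real (sqrt Y) * integral {-u0..u0} (\<lambda>u. exp (of_real Y * G (\<i> * of_real u)) * a (\<i> * of_real u))
       - (\<Sum>l\<le>N. of_real (Y powr (real l + 1 / 2)) * integral {-u0..u0} (?g l))) \<le>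
       u0 * BL ^ (2 * J + 3) * Ba * gauss_moment (3 * J + 4) * (1 / 2) powr (- (real (3 * J + 4) + 1 / 2)) * Y powr (- (real J + 1))"
      unfolding eq D_def n_def .
  qed
qed

section \<open>The saddle point\<close>

text \<open>The exponent (1 + z)^(-1/k) with its constant and linear Taylor terms removed, scaled so
  that the coefficient of z^2 is 1.\<close>

definition phase :: "nat \<Rightarrow> complex \<Rightarrow> complex" where
  "phase k z = of_real (2 * real k ^ 2 / (real k + 1)) * ((1 + z) powr of_real (- 1 / real k) - 1 + of_real (1 / real k) * z)"

text \<open>All of the exponent that does not grow with Y. The quadratic terms of
  \<open>phase k z / 4\<close> and of (Ln(1 + z) - z)/2 cancel, so it is exp(O(z^3)).\<close>

definition amplitude :: "nat \<Rightarrow> complex \<Rightarrow> complex" where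
  "amplitude k z = exp (phase k z / 4 + Ln (1 + z) / 2 - z / 2)"

lemma one_plus_nonpos_Reals: "norm (z :: complex) < 1 \<Longrightarrow> 1 + z \<notin> \<real>\<^sub>\<le>\<^sub>0"
  using abs_Re_le_cmod [of z] by (auto simp: complex_nonpos_Reals_iff)

lemma holomorphic_phase: "phase k holomorphic_on ball 0 1"
  unfolding phase_def by (intro holomorphic_intros) (use one_plus_nonpos_Reals in auto)

lemma holomorphic_amplitude: "amplitude k holomorphic_on ball 0 1"
  unfolding amplitude_def by (intro holomorphic_intros holomorphic_phase) (use one_plus_nonpos_Reals in auto)

lemma phase_0 [simp]: "phase k 0 = 0"
  by (simp add: phase_def)

lemma amplitude_0 [simp]: "amplitude k 0 = 1"
  by (simp add: amplitude_def)

lemma phase_expansion: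
  assumes k: "k \<ge> 1"
  obtains L where "L holomorphic_on ball 0 1" "\<And>z. z \<in> ball 0 1 \<Longrightarrow> phase k z = z ^ 2 + z ^ 3 * L z"
proof -
  obtain L where L: "L holomorphic_on ball 0 1"
    "\<And>z. z \<in> ball 0 1 \<Longrightarrow> phase k z = (\<Sum>n<3. (deriv ^^ n) (phase k) 0 / fact n * z ^ n) + z ^ 3 * L z"
    using holomorphic_Taylor [OF holomorphic_phase, where T = 3] by auto
  define a c :: complex where "a = of_real (- 1 / real k)" and "c = of_real (2 * real k ^ 2 / (real k + 1))"
  have e: "phase k has_fps_expansion (fps_const c * (fps_binomial a - 1 + fps_const (of_real (1 / real k)) * fps_X))"
    unfolding phase_def [abs_def] a_def c_def
    by (intro fps_expansion_intros)
  have "k \<noteq> 0"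
    using k by simp
  have "c * (a * (a - 1) / 2) = of_real (2 * real k ^ 2 / (real k + 1) * ((- 1 / real k) * (- 1 / real k - 1) / 2))"
    by (simp add: a_def c_def)
  also have "2 * real k ^ 2 / (real k + 1) * ((- 1 / real k) * (- 1 / real k - 1) / 2) = 1"
  proof -
    have "real k \<noteq> 0" "real k + 1 \<noteq> 0"
      using k by auto
    moreover from this have "(- 1 / real k) * (- 1 / real k - 1) / 2 = (real k + 1) / (2 * real k ^ 2)"
      by (simp add: field_simps power2_eq_square)
    ultimately show ?thesis
      by simp
  qed
  finally have c2: "c * (a * (a - 1) / 2) = 1"
    by simp
  have d: "(deriv ^^ n) (phase k) 0 / fact n = (if n = 2 then 1 else 0)" if "n < 3" for n
  proof -
    have "n = 0 \<or> n = 1 \<or> n = 2"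
      using that by auto
    moreover have "a gchoose 2 = a * (a - 1) / 2"
      by (simp add: gbinomial_prod_rev numeral_2_eq_2 lessThan_Suc)
    then have "c * (a gchoose 2) = 1"
      using c2 by (simp only:)
    moreover have "a + of_real (1 / real k) = 0"
      by (simp add: a_def)
    ultimately show ?thesis
      unfolding fps_nth_fps_expansion [OF e, symmetric]
      by (auto simp: fps_X_def)
  qed
  have "(\<Sum>n<3. (deriv ^^ n) (phase k) 0 / fact n * z ^ n) = z ^ 2" for z :: complex
    using d by (simp add: numeral_3_eq_3 numeral_2_eq_2)
  then show ?thesis
    using that L by simp
qed

lemma phase_small_radius:
  assumes k: "k \<ge> 1"
  obtains L u0 where "L holomorphic_on ball 0 1" "\<And>z. z \<in> ball 0 1 \<Longrightarrow> phase k z = z ^ 2 + z ^ 3 * L z"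
    "0 < u0" "u0 \<le> 1 / 16" "\<And>u. u \<in> {-u0..u0} \<Longrightarrow> \<bar>u\<bar> * norm (L (\<i> * of_real u)) \<le> 1 / 2"
proof -
  obtain L where L: "L holomorphic_on ball 0 1" "\<And>z. z \<in> ball 0 1 \<Longrightarrow> phase k z = z ^ 2 + z ^ 3 * L z"
    using phase_expansion [OF k] by blast
  have "bounded (L ` cball 0 (1 / 2))"
    by (intro compact_imp_bounded compact_continuous_image holomorphic_on_imp_continuous_on holomorphic_on_subset [OF L(1)]) auto
  then obtain B where B: "\<And>z. z \<in> cball 0 (1 / 2) \<Longrightarrow> norm (L z) \<le> B"
    unfolding bounded_iff by fastforce
  have B0: "B \<ge> 0"
    using order_trans [OF norm_ge_zero B [of 0]] by simp
  \<comment> \<open>The factor 16 also keeps tau in the sector |Im tau| at most Re tau/16 of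
    \<open>log_prod_expansion\<close>.\<close>
  define u0 where "u0 = 1 / (16 * (B + 1))"
  have u0: "0 < u0" "u0 \<le> 1 / 16"
    using B0 by (auto simp: u0_def field_simps)
  have "\<bar>u\<bar> * norm (L (\<i> * of_real u)) \<le> 1 / 2" if u: "u \<in> {-u0..u0}" for u
  proof -
    have "norm (L (\<i> * of_real u)) \<le> B"
      using u u0 by (intro B) (auto simp: norm_mult)
    then have "\<bar>u\<bar> * norm (L (\<i> * of_real u)) \<le> u0 * B"
      using u u0 by (intro mult_mono) auto
    also have "\<dots> \<le> 1 / 2"
      using B0 by (simp add: u0_def field_simps)
    finally show ?thesis .
  qed
  then show ?thesis
    using that L u0 by blast
qed

lemma Re_phase_nonpos:
  assumes "phase k (\<i> * of_real u) = (\<i> * of_real u) ^ 2 + (\<i> * of_real u) ^ 3 * L"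
    and "\<bar>u\<bar> * norm L \<le> 1 / 2"
  shows "Re (phase k (\<i> * of_real u)) \<le> 0"
proof -
  have "norm ((\<i> * of_real u) ^ 3 * L) = u ^ 2 * (\<bar>u\<bar> * norm L)"
    by (simp add: norm_mult norm_power power3_eq_cube power2_eq_square)
  also have "\<dots> \<le> u ^ 2 * (1 / 2)"
    using assms(2) by (intro mult_left_mono) auto
  finally have "Re ((\<i> * of_real u) ^ 3 * L) \<le> u ^ 2 / 2"
    using complex_Re_le_cmod [of "(\<i> * of_real u) ^ 3 * L"] by linarith
  moreover have "Re ((\<i> * of_real u) ^ 2) = - (u ^ 2)"
    by (simp add: power_mult_distrib)
  ultimately show ?thesis
    unfolding assms(1) plus_complex.sel using zero_le_power2 [of u] by linarith
qed

lemma lead_const_eq: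
  assumes "k \<ge> 1"
  shows "lead_const k = zeta_real ((real k + 1) / real k) * Gamma (1 / real k) / real k"
proof -
  have "1 / real k \<notin> \<int>\<^sub>\<le>\<^sub>0"
    using assms by (auto dest: nonpos_Ints_nonpos)
  then have "Gamma (1 / real k + 1) = 1 / real k * Gamma (1 / real k)"
    by (rule Gamma_plus1)
  moreover have "(real k + 1) / real k = 1 + 1 / real k"
    using assms by (simp add: field_simps)
  ultimately show ?thesis
    by (simp add: lead_const_def add.commute)
qed

lemma lead_const_pos:
  assumes "k \<ge> 1"
  shows "lead_const k > 0"
proof -
  have z: "(\<lambda>n. 1 / real (Suc n) powr (1 + 1 / real k)) sums zeta_real (1 + 1 / real k)"
    using assms by (intro zeta_real_sums) auto
  have "0 < (\<Sum>n. 1 / real (Suc n) powr (1 + 1 / real k))"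
    by (intro suminf_pos sums_summable [OF z]) auto
  moreover have "Gamma (1 + 1 / real k) > 0"
    using assms by (intro Gamma_real_pos add_pos_pos) auto
  ultimately show ?thesis
    using sums_unique [OF z] by (simp add: lead_const_def)
qed

text \<open>The value of exp(\<open>main_log\<close> + n tau) at tau = 1/X, that is at z = 0, where
  the phase is 0 and the amplitude 1.\<close>

definition saddle_value :: "nat \<Rightarrow> real \<Rightarrow> real" where
  "saddle_value k X = exp ((real k + 1) / real k * lead_const k * X powr (1 / real k) - 1 / 2) * (2 * pi) powr (- real k / 2) * X powr (- 1 / 2)"

lemma saddle_params_lead_const:
  assumes k: "k \<ge> 1"
  shows "saddle_params k n X Y \<longleftrightarrow> X > 0 \<and> Y > 0 \<and>
     real n = X * (lead_const k / real k * X powr (1 / real k) - 1 / 2 - zeta_real (- real k) / (2 * X)) \<and>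
     Y = (real k + 1) / (2 * real k ^ 2) * lead_const k * X powr (1 / real k) - 1 / 4"
proof -
  have "real k \<noteq> 0"
    using k by simp
  then have 1: "1 / real k ^ 2 * zeta_real ((real k + 1) / real k) * Gamma (1 / real k) = lead_const k / real k"
    and 2: "(real k + 1) / (2 * real k ^ 3) * zeta_real ((real k + 1) / real k) * Gamma (1 / real k) =
       (real k + 1) / (2 * real k ^ 2) * lead_const k"
    unfolding lead_const_eq [OF k] by (simp_all add: power2_eq_square power3_eq_cube)
  have 3: "1 / 2 * zeta_real (- real k) * X powi (- 1) = zeta_real (- real k) / (2 * X)"
    by (simp add: field_simps)
  show ?thesis
    unfolding saddle_params_def 1 2 3 ..
qed

text \<open>Write P = \<open>lead_const\<close> X^(1/k). The equation for n removes zeta(-k) and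
  turns the linear part into (P/k - 1/2)(1 + z); the equation for Y says that P is 2k^2/(k+1) times
  Y + 1/4, so the terms with P become the value at z = 0 plus (Y + 1/4) times the phase.\<close>

lemma saddle_exponent:
  assumes k: "k \<ge> 2" and S: "saddle_params k n X Y" and z: "norm z < 1"
  defines "\<tau> \<equiv> (1 + z) / of_real X"
  shows "exp (main_log k \<tau> + of_nat n * \<tau>) = of_real (saddle_value k X) * (exp (of_real Y * phase k z) * amplitude k z)"
proof -
  have k1: "k \<ge> 1" and k0: "real k \<noteq> 0" "real k + 1 \<noteq> 0"
    using k by auto
  have X: "X > 0" and n: "real n = X * (lead_const k / real k * X powr (1 / real k) - 1 / 2 - zeta_real (- real k) / (2 * X))"
    and Y: "Y = (real k + 1) / (2 * real k ^ 2) * lead_const k * X powr (1 / real k) - 1 / 4"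
    using S unfolding saddle_params_lead_const [OF k1] by auto
  define P where "P = lead_const k * X powr (1 / real k)"
  have nz: "1 + z \<noteq> 0"
    using one_plus_nonpos_Reals [OF z] by auto
  have Ln: "Ln \<tau> = Ln (1 + z) - of_real (ln X)"
  proof -
    have "Ln (of_real (1 / X)) = complex_of_real (ln (1 / X))"
      by (rule Ln_of_real) (use X in simp)
    also have "ln (1 / X) = - ln X"
      using X by (simp add: ln_div)
    finally have "Ln (1 / complex_of_real X) = - of_real (ln X)"
      by simp
    then show ?thesis
      unfolding \<tau>_def using Ln_times_of_real [of "1 / X" "1 + z"] X nz by simp
  qed
  have pw: "exp (- (Ln \<tau> / of_nat k)) = of_real (X powr (1 / real k)) * (1 + z) powr of_real (- 1 / real k)"
    unfolding Ln using X nz k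
    by (simp add: powr_def diff_divide_distrib exp_diff exp_minus flip: exp_of_real) (simp add: field_simps exp_minus)
  have ntau: "of_nat n * \<tau> + of_real (zeta_real (- real k) / 2) * \<tau> = of_real (P / real k - 1 / 2) * (1 + z)"
  proof -
    have "real n + zeta_real (- real k) / 2 = X * (P / real k - 1 / 2)"
      unfolding n P_def using X by (simp add: field_simps)
    then have "of_nat n + of_real (zeta_real (- real k) / 2) = complex_of_real (X * (P / real k - 1 / 2))"
      by (metis of_real_add of_real_of_nat_eq)
    then have "of_nat n * \<tau> + of_real (zeta_real (- real k) / 2) * \<tau> = complex_of_real (X * (P / real k - 1 / 2)) * \<tau>"
      by (metis distrib_right)
    then show ?thesis
      using X by (simp add: \<tau>_def)
  qed
  have YP: "of_real (2 * real k ^ 2 / (real k + 1)) * (of_real Y + 1 / 4) = complex_of_real P"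
  proof -
    have "2 * real k ^ 2 / (real k + 1) * (Y + 1 / 4) = P"
      unfolding Y P_def using k0 by auto
    then have "complex_of_real (2 * real k ^ 2 / (real k + 1) * (Y + 1 / 4)) = of_real P"
      by simp
    then show ?thesis
      by (simp only: of_real_mult of_real_add of_real_divide of_real_1 of_real_numeral)
  qed
  define W where "W = (1 + z) powr of_real (- 1 / real k)"
  have ph: "(of_real Y + 1 / 4) * phase k z = of_real P * (W - 1 + of_real (1 / real k) * z)"
    unfolding phase_def W_def [symmetric] using YP by (simp only: mult.assoc [symmetric] mult.commute [of "of_real Y + 1 / 4"])
  define E0 where "E0 = (real k + 1) / real k * lead_const k * X powr (1 / real k) - 1 / 2"
  have E0: "E0 = P + P / real k - 1 / 2"
    unfolding E0_def P_def using k0 by (simp add: field_simps)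
  have "main_log k \<tau> + of_nat n * \<tau> = of_real P * W + (Ln (1 + z) - of_real (ln X)) / 2
      - of_real (real k / 2 * ln (2 * pi)) + of_real (P / real k - 1 / 2) * (1 + z)"
    unfolding main_log_def pw unfolding W_def [symmetric] ntau [symmetric] Ln by (simp add: P_def)
  also have "\<dots> = of_real E0 + of_real (- real k / 2 * ln (2 * pi)) + of_real (- 1 / 2 * ln X)
      + (of_real Y * phase k z + (phase k z / 4 + Ln (1 + z) / 2 - z / 2))"
  proof -
    have "of_real Y * phase k z + phase k z / 4 = of_real P * (W - 1 + of_real (1 / real k) * z)"
      using ph by (simp add: algebra_simps)
    then have "of_real Y * phase k z + (phase k z / 4 + Ln (1 + z) / 2 - z / 2) = of_real P * (W - 1 + of_real (1 / real k) * z) + Ln (1 + z) / 2 - z / 2"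
      by (simp add: add_diff_eq flip: add.assoc)
    moreover have "complex_of_real (P / real k - 1 / 2) = of_real P * of_real (1 / real k) - 1 / 2"
      "complex_of_real (P + P / real k - 1 / 2) = of_real P + of_real P * of_real (1 / real k) - 1 / 2"
      by simp_all
    moreover have "a * W + (l - x) / 2 - b + (a * q - 1 / 2) * (1 + z)
        = a + a * q - 1 / 2 + - b + - x / 2 + (a * (W - 1 + q * z) + l / 2 - z / 2)" for a l x b q :: complex
      by (simp add: algebra_simps add_divide_distrib diff_divide_distrib)
    moreover have "complex_of_real (- real k / 2 * ln (2 * pi)) = - of_real (real k / 2 * ln (2 * pi))"
      "complex_of_real (- 1 / 2 * ln X) = - of_real (ln X) / 2"
      by simp_all
    ultimately show ?thesis
      unfolding E0 by (simp only:)
  qed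
  finally have "exp (main_log k \<tau> + of_nat n * \<tau>) = of_real (exp E0 * exp (- real k / 2 * ln (2 * pi)) * exp (- 1 / 2 * ln X))
      * (exp (of_real Y * phase k z) * amplitude k z)"
    by (simp only: exp_add amplitude_def exp_of_real) (simp only: of_real_mult)
  also have "exp E0 * exp (- real k / 2 * ln (2 * pi)) * exp (- 1 / 2 * ln X) = saddle_value k X"
    unfolding saddle_value_def E0_def powr_def using X by simp
  finally show ?thesis .
qed

text \<open>With w = X^(1/(2k)) the gain is exp(-bw) up to a constant, while X^N = w^(2kN); one term
  of the exponential series suffices.\<close>

lemma power_times_powr_bounded:
  assumes \<rho>: "0 < \<rho>" "\<rho> < 1" and k: "k \<ge> 1"
  shows "\<exists>C. \<forall>X\<ge>1. X ^ N * \<rho> powr (X powr (1 / (2 * real k)) / 4 - 1) \<le> C"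
proof -
  define b where "b = - ln \<rho> / 4"
  have b: "b > 0"
    using \<rho> by (simp add: b_def)
  have "X ^ N * \<rho> powr (X powr (1 / (2 * real k)) / 4 - 1) \<le> fact (2 * k * N) / b ^ (2 * k * N) / \<rho>" if X: "X \<ge> 1" for X
  proof -
    define w where "w = X powr (1 / (2 * real k))"
    have w: "w > 0"
      using X by (simp add: w_def)
    have "w ^ (2 * k) = X"
      using X k by (simp add: w_def powr_powr flip: powr_realpow)
    then have Xw: "X ^ N = w ^ (2 * k * N)"
      by (simp add: power_mult)
    have "\<rho> powr (w / 4 - 1) = \<rho> powr (w / 4) / \<rho>"
      using \<rho> by (simp add: powr_diff)
    also have "\<rho> powr (w / 4) = exp (- (b * w))"
      using \<rho> by (simp add: powr_def b_def mult.commute)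
    also have "\<dots> \<le> fact (2 * k * N) / (b * w) ^ (2 * k * N)"
      using b w by (intro exp_minus_le_power) simp
    finally have "\<rho> powr (w / 4 - 1) \<le> fact (2 * k * N) / (b * w) ^ (2 * k * N) / \<rho>"
      using \<rho> by (simp add: divide_right_mono)
    then have "X ^ N * \<rho> powr (w / 4 - 1) \<le> X ^ N * (fact (2 * k * N) / (b * w) ^ (2 * k * N) / \<rho>)"
      using X by (intro mult_left_mono) auto
    also have "\<dots> = fact (2 * k * N) / b ^ (2 * k * N) / \<rho>"
      unfolding Xw power_mult_distrib using w b by simp
    finally show ?thesis
      by (simp add: w_def)
  qed
  then show ?thesis
    by blast
qed

lemma saddle_value_pos: "X > 0 \<Longrightarrow> saddle_value k X > 0"
  by (simp add: saddle_value_def)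

lemma norm_exp_minus_1_le: "norm (exp z - 1) \<le> exp (norm z) * norm (z :: complex)"
  using Taylor_exp_field [of z 0] by simp

text \<open>The integral splits at |v| = u0/X. The inner part is Laplace's integral after the
  substitution u = X v, up to the error of \<open>log_prod\<close>; the outer parts are compared
  with the value at v = 0.\<close>

lemma partition_count_expansion:
  assumes k: "k \<ge> 2"
  shows "\<exists>(c :: nat \<Rightarrow> complex) (C :: real). c 0 = of_real (sqrt pi) \<and> (\<forall>n X Y. saddle_params k n X Y \<longrightarrow> X \<ge> 2 \<longrightarrow> Y \<ge> 1 \<longrightarrow>
    norm (of_real (real (power_partition_count k n) / (saddle_value k X / (2 * pi * X * sqrt Y)))
       - (\<Sum>j\<le>J. c j * of_real (Y powr (- real j)))) \<le> C * Y powr (- (real J + 1)))"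
proof -
  have k1: "k \<ge> 1"
    using k by simp
  obtain L u0 where L: "L holomorphic_on ball 0 1" "\<And>z. z \<in> ball 0 1 \<Longrightarrow> phase k z = z ^ 2 + z ^ 3 * L z"
    and u0: "0 < u0" "u0 \<le> 1 / 16"
    and small: "\<And>u. u \<in> {-u0..u0} \<Longrightarrow> \<bar>u\<bar> * norm (L (\<i> * of_real u)) \<le> 1 / 2"
    using phase_small_radius [OF k1] by metis
  define I where "I Y = integral {-u0..u0} (\<lambda>u. exp (of_real Y * phase k (\<i> * of_real u)) * amplitude k (\<i> * of_real u))" for Y :: real
  have "u0 < 1"
    using u0 by simp
  from laplace_expansion [OF L(1) holomorphic_amplitude [of k] u0(1) this L(2) small, of J, folded I_def]
  obtain c C1 where c: "c 0 = of_real (sqrt pi)"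
    "\<And>Y. Y \<ge> 1 \<Longrightarrow> norm (of_real (sqrt Y) * I Y - (\<Sum>j\<le>J. c j * of_real (Y powr (- real j)))) \<le> C1 * Y powr (- (real J + 1))"
    unfolding asym_exp_def by auto
  \<comment> \<open>Chosen so that the range of \<open>minor_arc_bound\<close> begins exactly where
    the major arc ends.\<close>
  define \<eta> where "\<eta> = u0 / (2 * pi * 2 ^ k)"
  have \<eta>: "0 < \<eta>" "2 ^ (k + 2) * \<eta> \<le> 1"
  proof -
    show "0 < \<eta>"
      using u0 by (simp add: \<eta>_def)
    have "2 ^ (k + 2) * \<eta> = 2 * u0 / pi"
      by (simp add: \<eta>_def power_add field_simps)
    also have "\<dots> \<le> 1"
      using u0 pi_gt3 by (simp add: divide_le_eq)
    finally show "2 ^ (k + 2) * \<eta> \<le> 1" .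
  qed
  have \<eta>u0: "2 * pi * (2 ^ k * \<eta>) = u0"
    by (simp add: \<eta>_def)
  have "(4::real) * \<eta> \<le> 2 ^ (k + 2) * \<eta>"
    using \<eta>(1) by (intro mult_right_mono) (simp_all add: power_add)
  then have "\<eta> \<le> 1 / 4"
    using \<eta> by linarith
  define \<rho> where "\<rho> = minor_ratio \<eta>"
  have \<rho>: "0 < \<rho>" "\<rho> < 1"
    using minor_ratio_bounds [OF \<eta>(1) \<open>\<eta> \<le> 1 / 4\<close>] by (auto simp: \<rho>_def)
  \<comment> \<open>Order J + 2 in tau suffices, because Y^(J+1) sqrt Y is at most
    (\<open>C0\<close> X)^(J+2).\<close>
  obtain K where K: "\<And>\<tau>. Re \<tau> > 0 \<Longrightarrow> \<bar>Im \<tau>\<bar> \<le> Re \<tau> / 16 \<Longrightarrow> norm \<tau> \<le> 1 \<Longrightarrow>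
    norm (log_prod k \<tau> - main_log k \<tau>) \<le> K * norm \<tau> ^ (J + 2)"
    using log_prod_expansion [OF k, of "J + 2"] by blast
  define K2 where "K2 = \<bar>K\<bar> * 2 ^ (J + 2)"
  have K2: "K2 \<ge> 0"
    by (simp add: K2_def)
  have sub: "\<i> * of_real u \<in> ball 0 1" if "u \<in> {-u0..u0}" for u
    using that u0 by (auto simp: norm_mult)
  have comp_cont: "continuous_on {-u0..u0} (\<lambda>u. f (\<i> * of_real u))" if "f holomorphic_on ball 0 1" for f
    by (rule continuous_on_compose2 [OF holomorphic_on_imp_continuous_on [OF that]])
       (use sub in \<open>auto intro!: continuous_intros\<close>)
  have "bounded ((\<lambda>u. amplitude k (\<i> * of_real u)) ` {-u0..u0})"
    by (intro compact_imp_bounded compact_continuous_image comp_cont holomorphic_amplitude) auto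
  then obtain Ba where Ba: "\<And>u. u \<in> {-u0..u0} \<Longrightarrow> norm (amplitude k (\<i> * of_real u)) \<le> Ba"
    unfolding bounded_iff by fastforce
  have Ba0: "Ba \<ge> 0"
    using order_trans [OF norm_ge_zero Ba [of 0]] u0 by simp
  define C0 where "C0 = (real k + 1) / (2 * real k ^ 2) * lead_const k"
  have C0: "C0 > 0"
    using lead_const_pos [OF k1] k by (simp add: C0_def)
  obtain C2 where C2: "\<And>X. X \<ge> 1 \<Longrightarrow> X ^ (J + 3) * \<rho> powr (X powr (1 / (2 * real k)) / 4 - 1) \<le> C2"
    using power_times_powr_bounded [OF \<rho> k1, of "J + 3"] by blast
  \<comment> \<open>The three errors: Laplace's expansion, the expansion of \<open>log_prod\<close>
    on the major arc, and the two minor arcs.\<close>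
  define C where "C = C1 + Ba * exp K2 * K2 * C0 ^ (J + 2) + 2 * pi * exp K2 * C0 ^ (J + 2) * C2"
  have main: "norm (of_real (real (power_partition_count k n) / (saddle_value k X / (2 * pi * X * sqrt Y)))
       - (\<Sum>j\<le>J. c j * of_real (Y powr (- real j)))) \<le> C * Y powr (- (real J + 1))"
    if S: "saddle_params k n X Y" and X: "X \<ge> 2" and Y: "Y \<ge> 1" for n X Y
  proof -
    have X0: "X > 0" and Yeq: "Y = C0 * X powr (1 / real k) - 1 / 4"
      using S unfolding saddle_params_lead_const [OF k1] C0_def by auto
    define \<sigma> where "\<sigma> = 1 / X"
    have \<sigma>: "\<sigma> > 0"
      using X0 by (simp add: \<sigma>_def)
    define w where "w = u0 / X"
    define D where "D = saddle_value k X"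
    have D: "D > 0"
      using saddle_value_pos [OF X0] by (simp add: D_def)
    have w: "0 < w" "w \<le> pi" "2 * w \<le> 1 / X"
    proof -
      show "0 < w"
        using u0 X0 by (simp add: w_def)
      have "u0 / X \<le> u0 / 1"
        using u0 X by (intro divide_left_mono) auto
      then show "w \<le> pi"
        using u0 pi_gt3 by (simp add: w_def)
      show "2 * w \<le> 1 / X"
        using u0 X0 by (simp add: w_def field_simps)
    qed
    define \<Phi> where "\<Phi> v = exp (log_prod k (Complex \<sigma> v)) * exp (of_nat n * Complex \<sigma> v)" for v
    define \<Psi> where "\<Psi> v = of_real D * (exp (of_real Y * phase k (\<i> * of_real (X * v))) * amplitude k (\<i> * of_real (X * v)))" for v
    define R where "R v = log_prod k (Complex \<sigma> v) - main_log k (Complex \<sigma> v)" for v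
    have \<Phi>_int: "(\<Phi> has_integral 2 * pi * of_nat (power_partition_count k n)) {-pi..pi}"
      unfolding \<Phi>_def by (rule power_partition_count_integral_limit [OF k1 \<sigma>])
    have Xv: "X * v \<in> {-u0..u0}" if "v \<in> {-w..w}" for v
      using that X0 by (auto simp: w_def field_simps)
    have \<Phi>_eq: "\<Phi> v = \<Psi> v * exp (R v)" and R_bound: "norm (R v) \<le> K2 * (1 / X) ^ (J + 2)" if v: "v \<in> {-w..w}" for v
    proof -
      have z: "norm (\<i> * complex_of_real (X * v)) < 1"
        using sub [OF Xv [OF v]] by simp
      have \<tau>: "Complex \<sigma> v = (1 + \<i> * of_real (X * v)) / of_real X"
        using X0 by (simp add: complex_eq_iff \<sigma>_def)
      have "exp (main_log k (Complex \<sigma> v) + of_nat n * Complex \<sigma> v) = \<Psi> v"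
        unfolding \<tau> \<Psi>_def D_def by (rule saddle_exponent [OF k S z])
      moreover have "\<Phi> v = exp (main_log k (Complex \<sigma> v) + of_nat n * Complex \<sigma> v) * exp (R v)"
        by (simp add: \<Phi>_def R_def algebra_simps flip: exp_add)
      ultimately show "\<Phi> v = \<Psi> v * exp (R v)"
        by simp
      have nt: "norm (Complex \<sigma> v) \<le> 2 / X"
      proof -
        have "norm (1 + \<i> * complex_of_real (X * v)) \<le> 2"
          using norm_triangle_ineq [of 1 "\<i> * complex_of_real (X * v)"] z by simp
        then show ?thesis
          unfolding \<tau> using X0 by (simp add: norm_divide divide_right_mono)
      qed
      have "\<bar>v\<bar> \<le> \<sigma> / 16"
        using v u0 X0 by (auto simp: w_def \<sigma>_def field_simps abs_le_iff)
      then have "norm (R v) \<le> K * norm (Complex \<sigma> v) ^ (J + 2)"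
        unfolding R_def using \<sigma> nt X by (intro K) (auto intro: order_trans)
      also have "\<dots> \<le> \<bar>K\<bar> * (2 / X) ^ (J + 2)"
        using nt by (intro mult_mono power_mono) auto
      also have "\<dots> = K2 * (1 / X) ^ (J + 2)"
        by (simp add: K2_def power_divide)
      finally show "norm (R v) \<le> K2 * (1 / X) ^ (J + 2)" .
    qed
    have X1le: "(1 / X) ^ (J + 2) \<le> 1"
      using X by (intro power_le_one) auto
    have R_le: "norm (R v) \<le> K2" if v: "v \<in> {-w..w}" for v
      using R_bound [OF v] mult_left_mono [OF X1le K2] by linarith
    have \<Psi>_bound: "norm (\<Psi> v) \<le> D * Ba" if v: "v \<in> {-w..w}" for v
    proof -
      have "Re (phase k (\<i> * of_real (X * v))) \<le> 0"
        using Xv [OF v] by (intro Re_phase_nonpos [OF L(2) small] sub)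
      then have "norm (exp (of_real Y * phase k (\<i> * of_real (X * v)))) \<le> 1"
        using Y by (simp add: mult_nonneg_nonpos)
      then have "norm (exp (of_real Y * phase k (\<i> * of_real (X * v)))) * norm (amplitude k (\<i> * of_real (X * v))) \<le> 1 * Ba"
        using Ba [OF Xv [OF v]] by (intro mult_mono) auto
      then show ?thesis
        unfolding \<Psi>_def norm_mult norm_of_real using D by (simp add: mult_left_mono)
    qed
    have i1: "\<Phi> integrable_on {-pi..-w}" "\<Phi> integrable_on {-w..w}" "\<Phi> integrable_on {w..pi}"
      using has_integral_integrable [OF \<Phi>_int] w by (auto intro: integrable_subinterval_real)
    have split: "complex_of_real (2 * pi * real (power_partition_count k n)) = integral {-pi..-w} \<Phi> + integral {-w..w} \<Phi> + integral {w..pi} \<Phi>"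
    proof -
      have "integral {-pi..pi} \<Phi> = integral {-pi..-w} \<Phi> + integral {-w..pi} \<Phi>"
        using has_integral_integrable [OF \<Phi>_int] w by (intro Henstock_Kurzweil_Integration.integral_combine [symmetric]) auto
      moreover have "integral {-w..pi} \<Phi> = integral {-w..w} \<Phi> + integral {w..pi} \<Phi>"
      proof -
        have "\<Phi> integrable_on {-w..pi}"
          by (rule integrable_subinterval_real [OF has_integral_integrable [OF \<Phi>_int]]) (use w in auto)
        then show ?thesis
          using w by (intro Henstock_Kurzweil_Integration.integral_combine [symmetric]) auto
      qed
      ultimately show ?thesis
        using integral_unique [OF \<Phi>_int] by simp
    qed
    define \<mu> where "\<mu> = D * exp K2 * \<rho> powr (X powr (1 / (2 * real k)) / 4 - 1)"
    have minor: "norm (\<Phi> v) \<le> \<mu>" if v: "\<bar>v\<bar> \<le> pi" "\<bar>v\<bar> \<ge> w" for v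
    proof -
      have "norm (exp (log_prod k (Complex \<sigma> v))) \<le> \<rho> powr (X powr (1 / (2 * real k)) / 4 - 1) * norm (exp (log_prod k (of_real \<sigma>)))"
        unfolding \<rho>_def \<sigma>_def using v X by (intro minor_arc_bound [OF k1 _ \<eta>]) (auto simp: \<eta>u0 w_def)
      then have "norm (\<Phi> v) \<le> (\<rho> powr (X powr (1 / (2 * real k)) / 4 - 1) * norm (exp (log_prod k (of_real \<sigma>)))) * exp (real n * \<sigma>)"
        unfolding \<Phi>_def norm_mult by (simp add: mult_right_mono)
      also have "\<dots> = \<rho> powr (X powr (1 / (2 * real k)) / 4 - 1) * norm (\<Phi> 0)"
      proof -
        have "complex_of_real \<sigma> = Complex \<sigma> 0"
          by (simp add: complex_eq_iff)
        then show ?thesis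
          by (simp add: \<Phi>_def norm_mult)
      qed
      \<comment> \<open>The value at v = 0 belongs to the major arc, where it is already known up to
        the factor exp(\<open>K2\<close>).\<close>
      also have "\<dots> \<le> \<rho> powr (X powr (1 / (2 * real k)) / 4 - 1) * (D * exp K2)"
      proof (rule mult_left_mono)
        have 0: "(0::real) \<in> {-w..w}"
          using w by simp
        have "norm (exp (R 0)) \<le> exp K2"
          using R_le [OF 0] complex_Re_le_cmod [of "R 0"] by simp
        moreover have "norm (\<Psi> 0) = D"
          using D by (simp add: \<Psi>_def)
        ultimately show "norm (\<Phi> 0) \<le> D * exp K2"
          unfolding \<Phi>_eq [OF 0] norm_mult using D by (simp add: mult_left_mono)
      qed simp
      also have "\<dots> = \<mu>"
        by (simp add: \<mu>_def)
      finally show ?thesis .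
    qed
    have \<mu>0: "\<mu> \<ge> 0"
      using D by (simp add: \<mu>_def)
    have rest1: "norm (integral {-pi..-w} \<Phi>) \<le> pi * \<mu>"
    proof -
      have "norm (integral {-pi..-w} \<Phi>) \<le> integral {-pi..-w} (\<lambda>_. \<mu>)"
        using i1(1) w by (intro integral_norm_bound_integral minor integrable_const_ivl) auto
      also have "\<dots> = (pi - w) * \<mu>"
        using w by simp
      also have "\<dots> \<le> pi * \<mu>"
        using \<mu>0 w by (intro mult_right_mono) auto
      finally show ?thesis .
    qed
    have rest2: "norm (integral {w..pi} \<Phi>) \<le> pi * \<mu>"
    proof -
      have "norm (integral {w..pi} \<Phi>) \<le> integral {w..pi} (\<lambda>_. \<mu>)"
        using i1(3) w by (intro integral_norm_bound_integral minor integrable_const_ivl) auto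
      also have "\<dots> = (pi - w) * \<mu>"
        using w by simp
      also have "\<dots> \<le> pi * \<mu>"
        using \<mu>0 w by (intro mult_right_mono) auto
      finally show ?thesis .
    qed
    have \<Psi>_int: "(\<Psi> has_integral of_real (D / X) * I Y) {-w..w}"
    proof -
      let ?h = "\<lambda>u. exp (of_real Y * phase k (\<i> * of_real u)) * amplitude k (\<i> * of_real u)"
      have "(?h has_integral I Y) (cbox (-u0) u0)"
        unfolding I_def cbox_interval
        by (intro integrable_integral integrable_continuous_real continuous_intros comp_cont holomorphic_phase holomorphic_amplitude)
      from has_integral_affinity' [OF this X0, of 0]
      have "((\<lambda>v. ?h (X * v)) has_integral I Y /\<^sub>R X) {-w..w}"
        by (simp add: w_def field_simps scaleR_conv_of_real)
      from has_integral_mult_right [OF this, of "of_real D"] show ?thesis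
        unfolding \<Psi>_def by (simp add: scaleR_conv_of_real divide_inverse mult_ac)
    qed
    have major: "norm (integral {-w..w} \<Phi> - of_real (D / X) * I Y) \<le> D / X * (Ba * exp K2 * K2 * (1 / X) ^ (J + 2))"
    proof -
      let ?b = "D * Ba * (exp K2 * (K2 * (1 / X) ^ (J + 2)))"
      have "norm (integral {-w..w} (\<lambda>v. \<Phi> v - \<Psi> v)) \<le> integral {-w..w} (\<lambda>_. ?b)"
      proof (rule integral_norm_bound_integral)
        show "(\<lambda>v. \<Phi> v - \<Psi> v) integrable_on {-w..w}"
          using i1(2) \<Psi>_int by (intro integrable_diff) auto
        show "(\<lambda>_. ?b) integrable_on {-w..w}"
          by (rule integrable_const_ivl)
        fix v assume v: "v \<in> {-w..w}"
        have "norm (\<Phi> v - \<Psi> v) = norm (\<Psi> v) * norm (exp (R v) - 1)"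
          unfolding \<Phi>_eq [OF v] by (simp add: algebra_simps flip: norm_mult)
        also have "\<dots> \<le> (D * Ba) * (exp (norm (R v)) * norm (R v))"
          using \<Psi>_bound [OF v] norm_exp_minus_1_le [of "R v"] D Ba0 by (intro mult_mono) auto
        also have "\<dots> \<le> (D * Ba) * (exp K2 * (K2 * (1 / X) ^ (J + 2)))"
          using R_le [OF v] R_bound [OF v] D Ba0 by (intro mult_left_mono mult_mono) auto
        finally show "norm (\<Phi> v - \<Psi> v) \<le> ?b" .
      qed
      also have "\<dots> = (2 * w) * ?b"
        using w by simp
      also have "\<dots> \<le> (1 / X) * ?b"
        using w D Ba0 K2 X0 by (intro mult_right_mono mult_nonneg_nonneg) auto
      also have "\<dots> = D / X * (Ba * exp K2 * K2 * (1 / X) ^ (J + 2))"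
        by (simp add: mult_ac)
      finally show ?thesis
        using i1(2) \<Psi>_int by (simp add: integral_diff integral_unique [OF \<Psi>_int] has_integral_integrable)
    qed
    \<comment> \<open>Converts the errors, which are powers of X, into the required power of Y; the
      half power of Y is rounded up.\<close>
    have YX: "Y ^ (J + 1) * sqrt Y \<le> (C0 * X) ^ (J + 2)"
    proof -
      have "sqrt Y \<le> Y"
        using Y real_sqrt_le_mono [of Y "Y ^ 2"] self_le_power [of Y 2] by simp
      then have "Y ^ (J + 1) * sqrt Y \<le> Y ^ (J + 1) * Y"
        using Y by (intro mult_left_mono) auto
      also have "\<dots> = Y ^ (J + 2)"
        by simp
      also have "\<dots> \<le> (C0 * X) ^ (J + 2)"
      proof (rule power_mono)
        have "X powr (1 / real k) \<le> X powr 1"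
          using X k by (intro powr_mono) auto
        then have "C0 * X powr (1 / real k) \<le> C0 * X"
          using C0 X0 by (intro mult_left_mono) auto
        then show "Y \<le> C0 * X"
          using Yeq by linarith
      qed (use Y in auto)
      finally show ?thesis .
    qed
    have Ypow: "Y powr (- (real J + 1)) = inverse (Y ^ (J + 1))"
    proof -
      have "real J + 1 = real (J + 1)"
        by simp
      moreover have "Y powr real (J + 1) = Y ^ (J + 1)"
        using Y by (intro powr_realpow) simp
      ultimately show ?thesis
        by (simp only: powr_minus)
    qed
    let ?P = "real (power_partition_count k n) / (D / (2 * pi * X * sqrt Y))"
    have "complex_of_real ?P - of_real (sqrt Y) * I Y = of_real (X * sqrt Y / D) * (integral {-pi..-w} \<Phi> + integral {w..pi} \<Phi> + (integral {-w..w} \<Phi> - of_real (D / X) * I Y))"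
    proof -
      have 1: "complex_of_real ?P = of_real (X * sqrt Y / D) * of_real (2 * pi * real (power_partition_count k n))"
        unfolding of_real_mult [symmetric] of_real_eq_iff using D X0 Y by (simp add: field_simps)
      have 2: "complex_of_real (sqrt Y) = of_real (X * sqrt Y / D) * of_real (D / X)"
        unfolding of_real_mult [symmetric] of_real_eq_iff using D X0 by simp
      have gen: "a * (s + b + s') - a * d * i = a * (s + s' + (b - d * i))" for a s b s' d i :: complex
        by (simp add: algebra_simps)
      show ?thesis
        unfolding 1 2 split by (rule gen)
    qed
    then have "norm (complex_of_real ?P - of_real (sqrt Y) * I Y) = X * sqrt Y / D * norm (integral {-pi..-w} \<Phi> + integral {w..pi} \<Phi> + (integral {-w..w} \<Phi> - of_real (D / X) * I Y))"
      using X0 Y D by (simp add: norm_mult norm_divide)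
    also have "\<dots> \<le> X * sqrt Y / D * (pi * \<mu> + pi * \<mu> + D / X * (Ba * exp K2 * K2 * (1 / X) ^ (J + 2)))"
      using X0 Y D by (intro mult_left_mono norm_triangle_mono rest1 rest2 major) auto
    also have "\<dots> = sqrt Y * (Ba * exp K2 * K2 * (1 / X) ^ (J + 2)) + sqrt Y * (2 * pi * exp K2 * (X * \<rho> powr (X powr (1 / (2 * real k)) / 4 - 1)))"
      using X0 D by (simp add: \<mu>_def field_simps)
    also have "\<dots> = (Ba * exp K2 * K2 * ((1 / X) ^ (J + 2) * (Y ^ (J + 1) * sqrt Y))
        + 2 * pi * exp K2 * (X * \<rho> powr (X powr (1 / (2 * real k)) / 4 - 1) * (Y ^ (J + 1) * sqrt Y))) * Y powr (- (real J + 1))"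
      unfolding Ypow using Y by (simp add: field_simps)
    also have "\<dots> \<le> (Ba * exp K2 * K2 * ((1 / X) ^ (J + 2) * (C0 * X) ^ (J + 2))
        + 2 * pi * exp K2 * (X * \<rho> powr (X powr (1 / (2 * real k)) / 4 - 1) * (C0 * X) ^ (J + 2))) * Y powr (- (real J + 1))"
      using YX Ba0 K2 X0 by (intro mult_right_mono add_mono mult_left_mono mult_nonneg_nonneg) auto
    also have "(1 / X) ^ (J + 2) * (C0 * X) ^ (J + 2) = C0 ^ (J + 2)"
      using X0 by (simp add: power_divide power_mult_distrib)
    also have "X * \<rho> powr (X powr (1 / (2 * real k)) / 4 - 1) * (C0 * X) ^ (J + 2)
        = C0 ^ (J + 2) * (X ^ (J + 3) * \<rho> powr (X powr (1 / (2 * real k)) / 4 - 1))"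
      by (simp add: power_mult_distrib numeral_3_eq_3)
    also have "(Ba * exp K2 * K2 * C0 ^ (J + 2) + 2 * pi * exp K2 * (C0 ^ (J + 2) * (X ^ (J + 3) * \<rho> powr (X powr (1 / (2 * real k)) / 4 - 1)))) * Y powr (- (real J + 1))
       \<le> (Ba * exp K2 * K2 * C0 ^ (J + 2) + 2 * pi * exp K2 * (C0 ^ (J + 2) * C2)) * Y powr (- (real J + 1))"
      using C2 [of X] X C0 by (intro mult_right_mono add_mono mult_left_mono mult_nonneg_nonneg order_refl) auto
    finally have e2: "norm (complex_of_real ?P - of_real (sqrt Y) * I Y) \<le>
       (Ba * exp K2 * K2 * C0 ^ (J + 2) + 2 * pi * exp K2 * (C0 ^ (J + 2) * C2)) * Y powr (- (real J + 1))" .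
    have "norm (complex_of_real ?P - of_real (sqrt Y) * I Y + (of_real (sqrt Y) * I Y - (\<Sum>j\<le>J. c j * of_real (Y powr (- real j)))))
      \<le> (Ba * exp K2 * K2 * C0 ^ (J + 2) + 2 * pi * exp K2 * (C0 ^ (J + 2) * C2)) * Y powr (- (real J + 1)) + C1 * Y powr (- (real J + 1))"
      by (rule norm_triangle_mono [OF e2 c(2) [OF Y]])
    then show ?thesis
      by (simp add: C_def D_def algebra_simps)
  qed
  then show ?thesis
    using c(1) by blast
qed

text \<open>The right-hand side of the equation for n is continuous in X, bounded above for X up to
  X1, and unbounded. For n beyond that bound the intermediate value theorem yields a solution, and
  every solution has X at least X1.\<close>

lemma saddle_params_exist:
  assumes k: "k \<ge> 2"
  shows "\<exists>N. \<forall>n\<ge>N. (\<exists>X Y. saddle_params k n X Y) \<and> (\<forall>X Y. saddle_params k n X Y \<longrightarrow> X \<ge> 2 \<and> Y \<ge> 1)"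
proof -
  have k1: "k \<ge> 1"
    using k by simp
  define q where "q = lead_const k / real k"
  define zc where "zc = zeta_real (- real k)"
  define C0 where "C0 = (real k + 1) / (2 * real k ^ 2) * lead_const k"
  have q: "q > 0" and C0: "C0 > 0"
    using lead_const_pos [OF k1] k by (simp_all add: q_def C0_def)
  define f where "f X = X * (q * X powr (1 / real k) - 1 / 2 - zc / (2 * X))" for X :: real
  define g where "g X = C0 * X powr (1 / real k) - 1 / 4" for X :: real
  have sp: "saddle_params k n X Y \<longleftrightarrow> X > 0 \<and> Y > 0 \<and> real n = f X \<and> Y = g X" for n X Y
    unfolding saddle_params_lead_const [OF k1] f_def g_def q_def zc_def C0_def ..
  have root: "X powr (1 / real k) \<ge> a" if "X \<ge> a ^ k" "a > 0" for X a :: real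
  proof -
    have "a = (a ^ k) powr (1 / real k)"
      using that k by (simp add: powr_powr flip: powr_realpow)
    also have "\<dots> \<le> X powr (1 / real k)"
      using that by (intro powr_mono2) auto
    finally show ?thesis .
  qed
  \<comment> \<open>From here on \<open>C0\<close> X^(1/k) is at least 2, so Y exceeds 1.\<close>
  define X1 where "X1 = max 2 ((2 / C0) ^ k)"
  have X1: "X1 \<ge> 2"
    by (simp add: X1_def)
  have gX1: "g X \<ge> 1" if "X \<ge> X1" for X
  proof -
    have "X powr (1 / real k) \<ge> 2 / C0"
      using that C0 by (intro root) (auto simp: X1_def)
    then have "C0 * X powr (1 / real k) \<ge> 2"
      using C0 by (simp add: field_simps)
    then show ?thesis
      by (simp add: g_def)
  qed
  have f_eq: "f X = X * (q * X powr (1 / real k)) - X / 2 - zc / 2" if "X > 0" for X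
    using that by (simp add: f_def field_simps)
  define Bd where "Bd = X1 * (q * X1 powr (1 / real k)) + \<bar>zc\<bar>"
  have f_le: "f X \<le> Bd" if "0 < X" "X \<le> X1" for X
  proof -
    have "X * (q * X powr (1 / real k)) \<le> X1 * (q * X1 powr (1 / real k))"
      using that q by (intro mult_mono powr_mono2 mult_nonneg_nonneg) auto
    then show ?thesis
      unfolding f_eq [OF that(1)] Bd_def using that by linarith
  qed
  show ?thesis
  proof (intro exI [of _ "nat \<lceil>Bd\<rceil> + 1"] allI impI conjI)
    fix n assume "n \<ge> nat \<lceil>Bd\<rceil> + 1"
    then have n: "real n > Bd"
      by linarith
    show "\<exists>X Y. saddle_params k n X Y"
    proof -
      \<comment> \<open>Beyond (2/q)^k the leading term is at least 2 X; subtracting X/2 and zc/2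
        still leaves at least n.\<close>
      define X2 where "X2 = max X1 (max (real n + \<bar>zc\<bar>) ((2 / q) ^ k))"
      have X2: "X2 \<ge> X1" "X2 \<ge> real n + \<bar>zc\<bar>" "X2 \<ge> (2 / q) ^ k"
        by (auto simp: X2_def)
      have "X2 powr (1 / real k) \<ge> 2 / q"
        using X2 q by (intro root) auto
      then have "q * X2 powr (1 / real k) \<ge> 2"
        using q by (simp add: field_simps)
      then have "X2 * (q * X2 powr (1 / real k)) \<ge> X2 * 2"
        using X1 X2 by (intro mult_left_mono) auto
      then have "real n \<le> f X2"
        using X1 X2 f_eq [of X2] by linarith
      moreover have "f X1 \<le> real n"
        using f_le [of X1] X1 n by linarith
      moreover have "continuous_on {X1..X2} f"
        unfolding f_def using X1 by (intro continuous_intros) auto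
      ultimately obtain X where X: "X1 \<le> X" "X \<le> X2" "f X = real n"
        using IVT' [of f X1 "real n" X2] X2 by auto
      then have "saddle_params k n X (g X)"
        unfolding sp using gX1 [of X] X1 by auto
      then show ?thesis
        by blast
    qed
    fix X Y assume S: "saddle_params k n X Y"
    have "X \<ge> X1"
    proof (rule ccontr)
      assume "\<not> X \<ge> X1"
      then have "f X \<le> Bd"
        using S by (intro f_le) (auto simp: sp)
      then show False
        using S n by (simp add: sp)
    qed
    then show "X \<ge> 2" "Y \<ge> 1"
      using X1 gX1 S by (auto simp: sp)
  qed
qed

theorem theorem1:
  fixes k :: nat
  assumes "k \<ge> 2"
  shows "\<exists>N::nat.
    (\<forall>n\<ge>N. \<exists>X Y. saddle_params k n X Y) \<and>
    (\<forall>J::nat. \<exists>(c :: nat \<Rightarrow> real) (C :: real). \<forall>n\<ge>N. \<forall>X Y. saddle_params k n X Y \<longrightarrow>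
      (\<exists>E::real. \<bar>E\<bar> \<le> C * Y powi (- int J - 1) \<and>
        real (power_partition_count k n) =
          exp ((real k + 1) / real k ^ 2 * zeta_real ((real k + 1) / real k) * Gamma (1 / real k)
                 * X powr (1 / real k) - 1 / 2)
          / ((2 * pi) powr ((real k + 2) / 2) * X powr (3 / 2) * Y powr (1 / 2))
          * (pi powr (1 / 2) + (\<Sum>j=1..J. c j * Y powi (- int j)) + E)))"
proof -
  have k1: "k \<ge> 1"
    using assms by simp
  \<comment> \<open>One N serves all J: the expansion holds for all X at least 2 and Y at least 1,
    so J affects only the coefficients and the error constant.\<close>
  obtain N where N: "\<And>n. n \<ge> N \<Longrightarrow> \<exists>X Y. saddle_params k n X Y"
    "\<And>n X Y. n \<ge> N \<Longrightarrow> saddle_params k n X Y \<Longrightarrow> X \<ge> 2 \<and> Y \<ge> 1"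
    using saddle_params_exist [OF assms] by blast
  show ?thesis
  proof (intro exI [of _ N] conjI allI impI)
    show "\<exists>X Y. saddle_params k n X Y" if "n \<ge> N" for n
      by (rule N(1) [OF that])
    fix J :: nat
    obtain c :: "nat \<Rightarrow> complex" and C :: real where c0: "c 0 = of_real (sqrt pi)" and C: "\<And>n X Y. saddle_params k n X Y \<Longrightarrow> X \<ge> 2 \<Longrightarrow> Y \<ge> 1 \<Longrightarrow>
      norm (of_real (real (power_partition_count k n) / (saddle_value k X / (2 * pi * X * sqrt Y)))
       - (\<Sum>j\<le>J. c j * of_real (Y powr (- real j)))) \<le> C * Y powr (- (real J + 1))"
      using partition_count_expansion [OF assms, of J] by blast
    show "\<exists>(c :: nat \<Rightarrow> real) (C :: real). \<forall>n\<ge>N. \<forall>X Y. saddle_params k n X Y \<longrightarrow>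
      (\<exists>E::real. \<bar>E\<bar> \<le> C * Y powi (- int J - 1) \<and>
        real (power_partition_count k n) =
          exp ((real k + 1) / real k ^ 2 * zeta_real ((real k + 1) / real k) * Gamma (1 / real k)
                 * X powr (1 / real k) - 1 / 2)
          / ((2 * pi) powr ((real k + 2) / 2) * X powr (3 / 2) * Y powr (1 / 2))
          * (pi powr (1 / 2) + (\<Sum>j=1..J. c j * Y powi (- int j)) + E))"
    \<comment> \<open>The count and Y are real, so taking real parts of the complex coefficients
      does not increase the error.\<close>
    proof (rule exI [of _ "\<lambda>j. Re (c j)"], rule exI [of _ C], intro allI impI)
      fix n X Y assume n: "n \<ge> N" and S: "saddle_params k n X Y"
      have X: "X \<ge> 2" and Y: "Y \<ge> 1"
        using N(2) [OF n S] by auto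
      have powi: "Y powi (- int j) = Y powr (- real j)" for j
        using Y powr_real_of_int' [of Y "- int j"] by simp
      have powiJ: "Y powi (- int J - 1) = Y powr (- (real J + 1))"
        using Y powr_real_of_int' [of Y "- int J - 1"] by simp
      define x where "x = real (power_partition_count k n) / (saddle_value k X / (2 * pi * X * sqrt Y))"
      define E where "E = x - (\<Sum>j\<le>J. Re (c j) * Y powr (- real j))"
      have "\<bar>E\<bar> = \<bar>Re (of_real x - (\<Sum>j\<le>J. c j * of_real (Y powr (- real j))))\<bar>"
        by (simp add: E_def)
      also have "\<dots> \<le> C * Y powr (- (real J + 1))"
        using C [OF S X Y] abs_Re_le_cmod order_trans unfolding x_def by blast
      finally have E: "\<bar>E\<bar> \<le> C * Y powi (- int J - 1)"
        by (simp only: powiJ)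
      have "(\<Sum>j\<le>J. Re (c j) * Y powr (- real j)) = sqrt pi + (\<Sum>j=1..J. Re (c j) * Y powi (- int j))"
        unfolding powi using Y by (simp add: atMost_atLeast0 sum.atLeast_Suc_atMost c0)
      then have xE: "x = pi powr (1 / 2) + (\<Sum>j=1..J. Re (c j) * Y powi (- int j)) + E"
        by (simp add: E_def powr_half_sqrt)
      have pre: "exp ((real k + 1) / real k ^ 2 * zeta_real ((real k + 1) / real k) * Gamma (1 / real k) * X powr (1 / real k) - 1 / 2)
          / ((2 * pi) powr ((real k + 2) / 2) * X powr (3 / 2) * Y powr (1 / 2)) = saddle_value k X / (2 * pi * X * sqrt Y)"
      proof -
        have e: "(real k + 1) / real k ^ 2 * zeta_real ((real k + 1) / real k) * Gamma (1 / real k) = (real k + 1) / real k * lead_const k"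
          unfolding lead_const_eq [OF k1] using k1 by (simp add: power2_eq_square)
        have "(2 * pi) powr (- real k / 2) = inverse ((2 * pi) powr (real k / 2))"
          "X powr (- 1 / 2) = inverse (X powr (1 / 2))"
          using powr_minus [of "2 * pi" "real k / 2"] powr_minus [of X "1 / 2"] by simp_all
        moreover have "(2 * pi) powr ((real k + 2) / 2) = (2 * pi) powr (real k / 2) * (2 * pi)"
          using powr_add [of "2 * pi" "real k / 2" 1] by (simp add: add_divide_distrib)
        moreover have "X powr (3 / 2) = X powr (1 / 2) * X"
          using powr_add [of X "1 / 2" 1] X by simp
        moreover have "Y powr (1 / 2) = sqrt Y"
          using Y by (simp add: powr_half_sqrt)
        moreover have "a / ((b * p) * (d * x) * s) = a * inverse b * inverse d / (p * x * s)" for a b p d x s :: real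
          by (simp add: divide_inverse mult_ac)
        ultimately show ?thesis
          unfolding e saddle_value_def by (simp only:)
      qed
      have "saddle_value k X / (2 * pi * X * sqrt Y) \<noteq> 0"
        using saddle_value_pos [of X k] X Y by simp
      then have "real (power_partition_count k n) = saddle_value k X / (2 * pi * X * sqrt Y) * x"
        by (simp add: x_def)
      then show "\<exists>E::real. \<bar>E\<bar> \<le> C * Y powi (- int J - 1) \<and>
        real (power_partition_count k n) =
          exp ((real k + 1) / real k ^ 2 * zeta_real ((real k + 1) / real k) * Gamma (1 / real k)
                 * X powr (1 / real k) - 1 / 2)
          / ((2 * pi) powr ((real k + 2) / 2) * X powr (3 / 2) * Y powr (1 / 2))
          * (pi powr (1 / 2) + (\<Sum>j=1..J. Re (c j) * Y powi (- int j)) + E)"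
        unfolding pre xE using E by blast
    qed
  qed
qed

end
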